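(* Consider the autoregressive stochastic-volatility model described in the context, in the mildly explosive regime $\rho_n = 1+\frac{c}{k_n}$, under the rate separation condition that $r_n^q=o(k_n)$ and $k_n r_n^q=o(n)$ for every fixed $q>0$, and with initial value satisfying $y_0=o_p(k_n^{1/2})$. Let $\widehat\rho_n=\sum_{t=1}^n y_{t-1}y_t\big/\sum_{t=1}^n y_{t-1}^2$, let the local deviation rate $\gamma_n$ be defined by $\rho_n=1+n^{-\gamma_n}$, and let $$\widehat\gamma_n:=-\frac{\log|\widehat\rho_n-1|}{\log n}.$$ Let $\lambda\in(0,1)$ and $z_\lambda^{\mathcal C}:=\Phi_{\mathcal C}^{-1}\!\left(\frac{1+\lambda}{2}\right)$, where $\Phi_{\mathcal C}^{-1}$ is the standard Cauchy quantile function. Then, if $\widehat\rho_n>1$, the interval $$\widehat\rho_n\;\pm\; z_\lambda^{\mathcal C}\,\frac{2}{n^{\widehat\gamma_n}\,\widehat\rho_n^{\,n}}$$ is an asymptotic $100\lambda\%$ confidence interval for $\rho_n$, and the interval $$\widehat\gamma_n\;\pm\; z_\lambda^{\mathcal C}\,\frac{2}{\bigl(1+n^{-\widehat\gamma_n}\bigr)^n\log n}$$ is an asymptotic $100\lambda\%$ confidence interval for $\gamma_n$. That is, conditionally on the event $\{\widehat\rho_n>1\}$, the probability that the first interval contains $\rho_n$ and the probability that the second interval contains $\gamma_n$ each converge to $\lambda$ as $n\to\infty$.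
   Context: Model. Fixed constants: $c>0$, $d>0$, $\alpha>0$. Deterministic sequences: $k_n>0$ with $k_n\to\infty$ and $k_n=o(n)$; $r_n>1$, where either $r_n\to\infty$ or $r_n$ is constant. The volatility persistence parameter is $\phi_n=1-\frac{d}{\log r_n}$, and $|\phi_n|<1$. For each $n$ (triangular array; dependence on $n$ is suppressed in the notation) and $1\le t\le n$, $$y_t=\rho_n y_{t-1}+u_t,\qquad u_t=\sigma_t\varepsilon_t,\qquad \log\sigma_t^2=\phi_n\log\sigma_{t-1}^2+\eta_t .$$ Here $(\varepsilon_t)_{t\ge1}$ are i.i.d. with $\mathbb{E}[\varepsilon_t]=0$, $\mathbb{E}[\varepsilon_t^2]=1$, $\mathbb{E}[\varepsilon_t^4]<\infty$; $(\eta_t)_{t\ge1}$ are i.i.d. $N(0,\alpha^2)$; the sequences $(\varepsilon_t)$ and $(\eta_t)$ are independent of each other. The initial volatility is $\sigma_0=1$, and the initial value $y_0$ (possibly depending on $n$) is independent of $\{(\varepsilon_t,\eta_t):t\ge1\}$. The estimator $\widehat\rho_n$ is the least-squares estimator (defined when its denominator is nonzero). Since $n^{-\gamma_n}=c/k_n$, one has $0<\gamma_n<1$ for all large $n$. The notation $a\pm b$ denotes the interval $[a-b,a+b]$. The standard Cauchy law has density $\{\pi(1+x^2)\}^{-1}$. *)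

theory Defs
  imports "HOL-Probability.Probability" "HOL-Library.Landau_Symbols"
begin

text \<open>\<open>small_o_p M X a\<close>: \<open>X\<^sub>n = o\<^sub>p(a\<^sub>n)\<close>, i.e. \<open>X\<^sub>n / a\<^sub>n\<close> tends to 0 in probability.\<close>

definition small_o_p :: "'a measure \<Rightarrow> (nat \<Rightarrow> 'a \<Rightarrow> real) \<Rightarrow> (nat \<Rightarrow> real) \<Rightarrow> bool" where
  "small_o_p M X a \<longleftrightarrow>
     (\<forall>e>0. (\<lambda>n. \<P>(\<omega> in M. \<bar>X n \<omega> / a n\<bar> > e)) \<longlonglongrightarrow> 0)"

definition std_cauchy_density :: "real \<Rightarrow> real" where
  "std_cauchy_density x = 1 / (pi * (1 + x\<^sup>2))"

definition std_cauchy :: "real measure" where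
  "std_cauchy = density lborel (\<lambda>x. ennreal (std_cauchy_density x))"

definition quantile :: "real measure \<Rightarrow> real \<Rightarrow> real" where
  "quantile D p = Inf {x. p \<le> cdf D x}"

text \<open>
  Least-squares estimator computed from \<open>y 0, \<dots>, y n\<close>.  If the denominator vanishes, then
  the value is 0 by the convention for division, so the event that the estimator exceeds 1
  contains only outcomes for which it is genuinely defined.
\<close>

definition least_squares_ar1 :: "nat \<Rightarrow> (nat \<Rightarrow> real) \<Rightarrow> real" where
  "least_squares_ar1 n y =
     (\<Sum>t=1..n. y (t - 1) * y t) / (\<Sum>t=1..n. (y (t - 1))\<^sup>2)"

end

theory Submission
  imports Defs
begin

text \<open>
  \<^bold>\<open>Reduction to one random ratio.\<close>  Put \<open>\<kappa> = \<rho>\<^sup>2 - 1\<close> and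
  \<open>T = \<rho>\<^sup>n (\<rho>hat - \<rho>) / \<kappa>\<close>.  Both intervals compare the same quantity with \<open>z\<close>: the first one
  contains \<open>\<rho>\<close> iff \<open>\<bar>T\<bar> F \<le> z F'\<close> with factors \<open>F, F'\<close> that tend to 1 uniformly for bounded \<open>T\<close>,
  and so does the second one, after a first-order expansion of the logarithm
  (\<open>interval_membership\<close>).  It therefore suffices that \<open>T\<close> is asymptotically standard Cauchy
  (\<open>scaled_error_tends_to_cauchy\<close>), because \<open>z = tan (\<pi> \<lambda> / 2)\<close> gives
  \<open>2 arctan z / \<pi> = \<lambda>\<close>.

  \<^bold>\<open>The Cauchy limit.\<close>  An explosive path is dominated by its early shocks: \<open>y\<^sub>n \<approx> \<rho>\<^sup>n X\<close> with
  \<open>X = \<Sum> u\<^sub>t / \<rho>\<^sup>t\<close>, while the score \<open>\<Sum> y\<^sub>t\<^sub>-\<^sub>1 u\<^sub>t\<close> is \<open>\<rho>\<^sup>n X Y\<close> up to a remainder, where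
  \<open>Y = \<Sum> u\<^sub>t / \<rho> ^ (n + 1 - t)\<close> collects the late shocks.  The remainder is a combination of squares
  with explicit means (\<open>ar1_score\<close>, \<open>discounted_score\<close>).  Squaring the recursion shows that the
  denominator \<open>\<Sum> y\<^sub>t\<^sub>-\<^sub>1\<^sup>2\<close> times \<open>\<kappa>\<close> is \<open>y\<^sub>n\<^sup>2\<close> up to the score and the sum of the squared shocks
  (\<open>ar1_energy\<close>).  So second moments of the shocks suffice to make all corrections negligible,
  and \<open>T \<approx> Y / X\<close>.

  \<^bold>\<open>Joint normality of \<open>(X, Y)\<close>.\<close>  Given the volatilities, \<open>a X + b Y\<close> is a weighted sum of
  independent variables, and its conditional characteristic function is within a third-moment
  error of \<open>exp (- V / 2)\<close>, where \<open>V\<close> is the conditional variance.  Since \<open>log \<sigma>\<^sub>t\<^sup>2\<close> is Gaussian,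
  the mean and the variance of \<open>V\<close> are explicit; the covariances decay geometrically in the lag.  Apart from errors
  of order \<open>1 / \<rho>\<^sup>n\<close> and \<open>\<kappa> n / \<rho>\<^sup>n\<close>, every error is bounded by a power of \<open>\<kappa>\<close> times some
  \<open>exp (q \<alpha>\<^sup>2 / (1 - \<phi>\<^sup>2))\<close>.  If \<open>r\<^sub>n\<close> diverges, then the exponential is at most a power of \<open>r\<^sub>n\<close>, which the
  rate separation makes negligible against \<open>k\<^sub>n\<close>; otherwise it is constant.

  \<^bold>\<open>From the pair to the ratio.\<close>  The one-dimensional continuity theorem of Levy, applied first
  to laws reweighted by bounded functions of the other coordinate, yields
  \<open>E f(X) g(Y) \<rightarrow> E f(Z) E g(Z')\<close> for bounded almost everywhere continuous \<open>f, g\<close>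
  (\<open>bivariate_levy_continuity\<close>).  Taking \<open>f, g\<close> trigonometric in \<open>ln \<bar>x\<bar>\<close> gives the
  characteristic function of \<open>ln \<bar>Y\<bar> - ln \<bar>X\<bar>\<close>, so a further application in one dimension
  settles \<open>\<bar>Y / X\<bar>\<close> (\<open>ratio_tends_to_cauchy\<close>).
\<close>

section \<open>Levy continuity under bounded weights and for pairs\<close>

text \<open>
  Normalising the weight by its mean turns it into a change of measure, under which the
  hypothesis is pointwise convergence of ordinary characteristic functions.
\<close>

lemma (in prob_space) levy_continuity_positive_weight:
  fixes X W :: "nat \<Rightarrow> 'a \<Rightarrow> real" and f :: "real \<Rightarrow> real"
  assumes X[measurable]: "\<And>n. X n \<in> borel_measurable M"
    and W[measurable]: "\<And>n. W n \<in> borel_measurable M"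
    and pos: "\<delta> > 0" "\<And>n \<omega>. \<delta> \<le> W n \<omega>" "\<And>n \<omega>. W n \<omega> \<le> C"
    and \<mu>: "real_distribution \<mu>"
    and conv: "\<And>t. (\<lambda>n. CLINT \<omega>|M. W n \<omega> * iexp (t * X n \<omega>)) \<longlonglongrightarrow> h * char \<mu> t"
    and f[measurable]: "f \<in> borel_measurable borel" and f_bdd: "\<And>x. \<bar>f x\<bar> \<le> D"
    and f_cont: "emeasure \<mu> {x. \<not> isCont f x} = 0"
  shows "(\<lambda>n. expectation (\<lambda>\<omega>. W n \<omega> * f (X n \<omega>))) \<longlonglongrightarrow> h * (LINT x|\<mu>. f x)"
proof -
  interpret \<mu>: real_distribution \<mu> by fact
  have W_int[simp]: "integrable M (W n)" for n
  proof (rule integrable_const_bound[where B=C])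
    show "AE \<omega> in M. norm (W n \<omega>) \<le> C"
      using pos(1) order_trans[OF less_imp_le[OF pos(1)] pos(2)] pos(3)[of n] by (auto intro!: AE_I2)
  qed simp
  define w where "w n = expectation (W n)" for n
  have w_pos: "\<delta> \<le> w n" for n
    unfolding w_def using pos(2) by (intro integral_ge_const) auto
  have w_pos': "0 < w n" for n
    using w_pos[of n] pos(1) by simp
  have "(\<lambda>n. complex_of_real (w n)) \<longlonglongrightarrow> complex_of_real h"
    using conv[of 0] by (simp add: \<mu>.char_zero w_def)
  then have w_lim: "w \<longlonglongrightarrow> h"
    by (simp add: tendsto_of_real_iff)
  have h: "\<delta> \<le> h"
    using w_lim by (rule LIMSEQ_le_const) (use w_pos in auto)
  define Mn where "Mn n = density M (\<lambda>\<omega>. ennreal (W n \<omega> / w n))" for n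
  have nn: "0 \<le> W n \<omega> / w n" for n \<omega>
    using w_pos'[of n] pos(1) pos(2)[of n \<omega>] by simp
  have prob: "prob_space (Mn n)" for n
  proof (rule prob_spaceI)
    have "emeasure (Mn n) (space (Mn n)) = (\<integral>\<^sup>+\<omega>. ennreal (W n \<omega> / w n) \<partial>M)"
      unfolding Mn_def by (subst emeasure_density) (auto intro!: nn_integral_cong simp: indicator_def)
    also have "\<dots> = ennreal (expectation (\<lambda>\<omega>. W n \<omega> / w n))"
      using nn by (intro nn_integral_eq_integral) auto
    also have "expectation (\<lambda>\<omega>. W n \<omega> / w n) = 1"
      using w_pos'[of n] by (simp add: w_def)
    finally show "emeasure (Mn n) (space (Mn n)) = 1" by simp
  qed
  have Xm: "X n \<in> borel_measurable (Mn n)" for n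
    unfolding Mn_def by simp
  have rd: "real_distribution (distr (Mn n) borel (X n))" for n
    using prob_space.real_distribution_distr[OF prob Xm] .
  have tr: "(LINT x|distr (Mn n) borel (X n). g x) = (LINT \<omega>|M. (W n \<omega> / w n) *\<^sub>R g (X n \<omega>))"
    if [measurable]: "g \<in> borel_measurable borel" for g :: "real \<Rightarrow> 'c::{banach, second_countable_topology}" and n
  proof -
    have "(LINT x|distr (Mn n) borel (X n). g x) = (LINT \<omega>|Mn n. g (X n \<omega>))"
      by (rule integral_distr) (use Xm in auto)
    also have "\<dots> = (LINT \<omega>|M. (W n \<omega> / w n) *\<^sub>R g (X n \<omega>))"
      unfolding Mn_def by (rule integral_density) (use nn in auto)
    finally show ?thesis .
  qed
  have ch: "char (distr (Mn n) borel (X n)) t = (CLINT \<omega>|M. W n \<omega> * iexp (t * X n \<omega>)) / w n" for n t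
  proof -
    have "char (distr (Mn n) borel (X n)) t = (CLINT \<omega>|M. (W n \<omega> / w n) *\<^sub>R iexp (t * X n \<omega>))"
      unfolding char_def by (rule tr) auto
    also have "\<dots> = (CLINT \<omega>|M. (W n \<omega> * iexp (t * X n \<omega>)) / w n)"
      by (simp add: scaleR_conv_of_real field_simps)
    finally show ?thesis by simp
  qed
  have "weak_conv_m (\<lambda>n. distr (Mn n) borel (X n)) \<mu>"
  proof (rule levy_continuity[OF rd \<mu>])
    fix t
    have "(\<lambda>n. (CLINT \<omega>|M. W n \<omega> * iexp (t * X n \<omega>)) / complex_of_real (w n)) \<longlonglongrightarrow> h * char \<mu> t / h"
      using h pos(1) by (intro tendsto_divide conv tendsto_of_real w_lim) auto
    then show "(\<lambda>n. char (distr (Mn n) borel (X n)) t) \<longlonglongrightarrow> char \<mu> t"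
      using h pos(1) by (simp add: ch)
  qed
  then have "(\<lambda>n. LINT x|distr (Mn n) borel (X n). f x) \<longlonglongrightarrow> (LINT x|\<mu>. f x)"
    by (rule weak_conv_imp_bdd_ae_continuous_conv[OF rd \<mu>])
       (use f_bdd f_cont in auto)
  then have "(\<lambda>n. w n * (LINT x|distr (Mn n) borel (X n). f x)) \<longlonglongrightarrow> h * (LINT x|\<mu>. f x)"
    by (intro tendsto_mult w_lim)
  moreover have "w n * (LINT x|distr (Mn n) borel (X n). f x) = expectation (\<lambda>\<omega>. W n \<omega> * f (X n \<omega>))" for n
  proof -
    have "w n * (LINT x|distr (Mn n) borel (X n). f x) = (LINT \<omega>|M. w n * ((W n \<omega> / w n) *\<^sub>R f (X n \<omega>)))"
      by (subst tr) auto
    also have "\<dots> = expectation (\<lambda>\<omega>. W n \<omega> * f (X n \<omega>))"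
      using w_pos'[of n] by (intro Bochner_Integration.integral_cong) auto
    finally show ?thesis .
  qed
  ultimately show ?thesis by simp
qed

text \<open>
  A bounded weight of arbitrary sign becomes positive after adding a constant; the contribution
  of that constant is the unweighted case, which is subtracted again.  The shift also covers \<open>h = 0\<close>,
  where normalisation by the mean would be impossible.
\<close>

lemma (in prob_space) levy_continuity_weighted:
  fixes X H :: "nat \<Rightarrow> 'a \<Rightarrow> real" and f :: "real \<Rightarrow> real"
  assumes X[measurable]: "\<And>n. X n \<in> borel_measurable M"
    and H[measurable]: "\<And>n. H n \<in> borel_measurable M"
    and H_bdd: "\<And>n \<omega>. \<bar>H n \<omega>\<bar> \<le> B"
    and \<mu>: "real_distribution \<mu>"
    and conv: "\<And>t. (\<lambda>n. CLINT \<omega>|M. iexp (t * X n \<omega>)) \<longlonglongrightarrow> char \<mu> t"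
    and conv_H: "\<And>t. (\<lambda>n. CLINT \<omega>|M. H n \<omega> * iexp (t * X n \<omega>)) \<longlonglongrightarrow> h * char \<mu> t"
    and f[measurable]: "f \<in> borel_measurable borel" and f_bdd: "\<And>x. \<bar>f x\<bar> \<le> D"
    and f_cont: "emeasure \<mu> {x. \<not> isCont f x} = 0"
  shows "(\<lambda>n. expectation (\<lambda>\<omega>. H n \<omega> * f (X n \<omega>))) \<longlonglongrightarrow> h * (LINT x|\<mu>. f x)"
proof -
  \<comment> \<open>With this shift the weight is at least 1.\<close>
  define A where "A = B + 1"
  have A: "1 \<le> H n \<omega> + A" "H n \<omega> + A \<le> 2 * A" for n \<omega>
    unfolding A_def using H_bdd[of n \<omega>] by (auto simp: abs_le_iff)
  have int1: "integrable M (\<lambda>\<omega>. iexp (t * X n \<omega>))" for n t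
    by (rule integrable_const_bound[where B=1]) auto
  have int2: "integrable M (\<lambda>\<omega>. H n \<omega> * iexp (t * X n \<omega>))" for n t
    by (rule integrable_const_bound[where B=B]) (use H_bdd in \<open>auto simp: norm_mult\<close>)
  have int3: "integrable M (\<lambda>\<omega>. f (X n \<omega>))" for n
    by (rule integrable_const_bound[where B=D]) (use f_bdd in auto)
  have int4: "integrable M (\<lambda>\<omega>. H n \<omega> * f (X n \<omega>))" for n
    by (rule Bochner_Integration.integrable_bound[OF integrable_mult_right[OF int3, of B]])
       (use H_bdd in \<open>auto simp: abs_mult intro!: AE_I2 mult_right_mono order_trans[OF H_bdd abs_ge_self]\<close>)
  have "(\<lambda>n. expectation (\<lambda>\<omega>. (H n \<omega> + A) * f (X n \<omega>))) \<longlonglongrightarrow> (h + A) * (LINT x|\<mu>. f x)"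
  proof (rule levy_continuity_positive_weight[where \<delta>=1, OF X _ _ A \<mu> _ f f_bdd f_cont])
    fix t
    have "(CLINT \<omega>|M. complex_of_real (H n \<omega> + A) * iexp (t * X n \<omega>)) =
        (CLINT \<omega>|M. H n \<omega> * iexp (t * X n \<omega>) + A * iexp (t * X n \<omega>))" for n
      by (simp only: of_real_add distrib_right)
    also have "\<dots> n =
        (CLINT \<omega>|M. H n \<omega> * iexp (t * X n \<omega>)) + A * (CLINT \<omega>|M. iexp (t * X n \<omega>))" for n
      by (subst Bochner_Integration.integral_add[OF int2 integrable_mult_right[OF int1]]) simp
    finally have "(CLINT \<omega>|M. complex_of_real (H n \<omega> + A) * iexp (t * X n \<omega>)) =
        (CLINT \<omega>|M. H n \<omega> * iexp (t * X n \<omega>)) + A * (CLINT \<omega>|M. iexp (t * X n \<omega>))" for n .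
    moreover have "(\<lambda>n. (CLINT \<omega>|M. H n \<omega> * iexp (t * X n \<omega>)) + A * (CLINT \<omega>|M. iexp (t * X n \<omega>)))
        \<longlonglongrightarrow> h * char \<mu> t + A * char \<mu> t"
      by (intro tendsto_add tendsto_mult conv conv_H tendsto_const)
    ultimately show "(\<lambda>n. CLINT \<omega>|M. complex_of_real (H n \<omega> + A) * iexp (t * X n \<omega>))
        \<longlonglongrightarrow> complex_of_real (h + A) * char \<mu> t"
      by (simp add: ring_distribs)
  qed auto
  moreover have "(\<lambda>n. expectation (\<lambda>\<omega>. 1 * f (X n \<omega>))) \<longlonglongrightarrow> 1 * (LINT x|\<mu>. f x)"
    by (rule levy_continuity_positive_weight[where \<delta>=1 and C=1 and W="\<lambda>n \<omega>. 1", OF X _ _ _ _ \<mu> _ f f_bdd f_cont])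
       (use conv in auto)
  ultimately have "(\<lambda>n. expectation (\<lambda>\<omega>. (H n \<omega> + A) * f (X n \<omega>)) - A * expectation (\<lambda>\<omega>. 1 * f (X n \<omega>)))
      \<longlonglongrightarrow> (h + A) * (LINT x|\<mu>. f x) - A * (1 * (LINT x|\<mu>. f x))"
    by (intro tendsto_diff tendsto_mult tendsto_const)
  then show ?thesis
    using int3 int4 by (simp add: ring_distribs)
qed

abbreviation (input) "std_normal_pair \<equiv> std_normal_distribution \<Otimes>\<^sub>M std_normal_distribution"

lemma cos_times_iexp: "complex_of_real (cos (b * y)) * iexp u = (iexp (u + b * y) + iexp (u + (- b) * y)) / 2"
  unfolding cis_conv_exp[symmetric]
  by (simp add: complex_eq_iff cos_add cos_diff sin_add sin_diff mult.commute)

lemma sin_times_iexp: "complex_of_real (sin (b * y)) * iexp u = (iexp (u + b * y) - iexp (u + (- b) * y)) / (2 * \<i>)"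
  unfolding cis_conv_exp[symmetric]
  by (simp add: complex_eq_iff cos_add cos_diff sin_add sin_diff mult.commute Re_divide Im_divide power2_eq_square)

text \<open>
  Test functions of product form replace a two-dimensional continuity theorem.  With weights
  \<open>cos (b Y)\<close> and \<open>sin (b Y)\<close> the weighted theorem identifies the limit of \<open>E f(X) exp (i b Y)\<close>; this is
  exactly the hypothesis of the same theorem for the variable \<open>Y\<close> with the weight \<open>f(X)\<close>.
\<close>

lemma (in prob_space) bivariate_levy_continuity:
  fixes X Y :: "nat \<Rightarrow> 'a \<Rightarrow> real" and f g :: "real \<Rightarrow> real"
  assumes X[measurable]: "\<And>n. X n \<in> borel_measurable M"
    and Y[measurable]: "\<And>n. Y n \<in> borel_measurable M"
    and conv: "\<And>a b. (\<lambda>n. CLINT \<omega>|M. iexp (a * X n \<omega> + b * Y n \<omega>)) \<longlonglongrightarrow> exp (- (a\<^sup>2 + b\<^sup>2) / 2)"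
    and f[measurable]: "f \<in> borel_measurable borel" and f_bdd: "\<And>x. \<bar>f x\<bar> \<le> B"
    and f_cont: "emeasure std_normal_distribution {x. \<not> isCont f x} = 0"
    and g[measurable]: "g \<in> borel_measurable borel" and g_bdd: "\<And>x. \<bar>g x\<bar> \<le> C"
    and g_cont: "emeasure std_normal_distribution {x. \<not> isCont g x} = 0"
  shows "(\<lambda>n. expectation (\<lambda>\<omega>. f (X n \<omega>) * g (Y n \<omega>))) \<longlonglongrightarrow>
    (LINT x|std_normal_distribution. f x) * (LINT y|std_normal_distribution. g y)"
proof -
  let ?N = "std_normal_distribution"
  have int: "integrable M (\<lambda>\<omega>. iexp (a * X n \<omega> + b * Y n \<omega>))" for a b n
    by (rule integrable_const_bound[where B=1]) auto
  have exp_split: "complex_of_real (exp (- (a\<^sup>2 + b\<^sup>2) / 2)) = exp (- b\<^sup>2 / 2) * char ?N a" for a b :: real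
  proof -
    have "exp (- (a\<^sup>2 + b\<^sup>2) / 2) = exp (- b\<^sup>2 / 2) * exp (- a\<^sup>2 / 2)"
      by (simp add: exp_add[symmetric] add_divide_distrib diff_divide_distrib)
    then show ?thesis
      by (simp only: char_std_normal_distribution of_real_mult)
  qed
  have convX: "(\<lambda>n. CLINT \<omega>|M. iexp (a * X n \<omega>)) \<longlonglongrightarrow> char ?N a" for a
    using conv[of a 0] by (simp add: char_std_normal_distribution)
  have convY: "(\<lambda>n. CLINT \<omega>|M. iexp (b * Y n \<omega>)) \<longlonglongrightarrow> char ?N b" for b
    using conv[of 0 b] by (simp add: char_std_normal_distribution)
  have c: "(\<lambda>n. expectation (\<lambda>\<omega>. cos (b * Y n \<omega>) * f (X n \<omega>))) \<longlonglongrightarrow> exp (- b\<^sup>2 / 2) * (LINT x|?N. f x)" for b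
  proof (rule levy_continuity_weighted[where B=1, OF X _ _ real_dist_normal_dist convX _ f f_bdd f_cont])
    fix a
    have "(CLINT \<omega>|M. cos (b * Y n \<omega>) * iexp (a * X n \<omega>)) =
        (CLINT \<omega>|M. (iexp (a * X n \<omega> + b * Y n \<omega>) + iexp (a * X n \<omega> + (-b) * Y n \<omega>)) / 2)" for n
      by (intro Bochner_Integration.integral_cong refl)
         (rule cos_times_iexp)
    also have "\<dots> n = ((CLINT \<omega>|M. iexp (a * X n \<omega> + b * Y n \<omega>)) + (CLINT \<omega>|M. iexp (a * X n \<omega> + (-b) * Y n \<omega>))) / 2" for n
      by (simp only: integral_divide_zero Bochner_Integration.integral_add[OF int int])
    finally have *: "(CLINT \<omega>|M. cos (b * Y n \<omega>) * iexp (a * X n \<omega>)) = \<dots> n" for n .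
    have "(\<lambda>n. ((CLINT \<omega>|M. iexp (a * X n \<omega> + b * Y n \<omega>)) + (CLINT \<omega>|M. iexp (a * X n \<omega> + (-b) * Y n \<omega>))) / 2)
       \<longlonglongrightarrow> (complex_of_real (exp (- (a\<^sup>2 + b\<^sup>2) / 2)) + complex_of_real (exp (- (a\<^sup>2 + (-b)\<^sup>2) / 2))) / 2"
      by (intro tendsto_divide tendsto_add conv tendsto_const) auto
    then show "(\<lambda>n. CLINT \<omega>|M. cos (b * Y n \<omega>) * iexp (a * X n \<omega>)) \<longlonglongrightarrow> exp (- b\<^sup>2 / 2) * char ?N a"
      unfolding * exp_split by (simp add: mult.commute)
  qed auto
  have s: "(\<lambda>n. expectation (\<lambda>\<omega>. sin (b * Y n \<omega>) * f (X n \<omega>))) \<longlonglongrightarrow> 0 * (LINT x|?N. f x)" for b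
  proof (rule levy_continuity_weighted[where B=1, OF X _ _ real_dist_normal_dist convX _ f f_bdd f_cont])
    fix a
    have "(CLINT \<omega>|M. sin (b * Y n \<omega>) * iexp (a * X n \<omega>)) =
        (CLINT \<omega>|M. (iexp (a * X n \<omega> + b * Y n \<omega>) - iexp (a * X n \<omega> + (-b) * Y n \<omega>)) / (2 * \<i>))" for n
      by (intro Bochner_Integration.integral_cong refl)
         (rule sin_times_iexp)
    also have "\<dots> n = ((CLINT \<omega>|M. iexp (a * X n \<omega> + b * Y n \<omega>)) - (CLINT \<omega>|M. iexp (a * X n \<omega> + (-b) * Y n \<omega>))) / (2 * \<i>)" for n
      by (simp only: integral_divide_zero Bochner_Integration.integral_diff[OF int int])
    finally have *: "(CLINT \<omega>|M. sin (b * Y n \<omega>) * iexp (a * X n \<omega>)) = \<dots> n" for n .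
    have "(\<lambda>n. ((CLINT \<omega>|M. iexp (a * X n \<omega> + b * Y n \<omega>)) - (CLINT \<omega>|M. iexp (a * X n \<omega> + (-b) * Y n \<omega>))) / (2 * \<i>))
       \<longlonglongrightarrow> (complex_of_real (exp (- (a\<^sup>2 + b\<^sup>2) / 2)) - complex_of_real (exp (- (a\<^sup>2 + (-b)\<^sup>2) / 2))) / (2 * \<i>)"
      by (intro tendsto_divide tendsto_diff conv tendsto_const) auto
    then show "(\<lambda>n. CLINT \<omega>|M. sin (b * Y n \<omega>) * iexp (a * X n \<omega>)) \<longlonglongrightarrow> complex_of_real 0 * char ?N a"
      unfolding * by simp
  qed auto
  show ?thesis
  proof (rule levy_continuity_weighted[OF Y _ f_bdd real_dist_normal_dist convY _ g g_bdd g_cont])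
    fix b
    have ic: "integrable M (\<lambda>\<omega>. cos (b * Y n \<omega>) * f (X n \<omega>))" and isin: "integrable M (\<lambda>\<omega>. sin (b * Y n \<omega>) * f (X n \<omega>))" for n
      by (rule integrable_const_bound[where B=B];
          auto simp: abs_mult intro!: AE_I2 order_trans[OF mult_mono[OF abs_cos_le_one f_bdd]]
            order_trans[OF mult_mono[OF abs_sin_le_one f_bdd]])+
    have "(CLINT \<omega>|M. f (X n \<omega>) * iexp (b * Y n \<omega>)) =
        (CLINT \<omega>|M. complex_of_real (cos (b * Y n \<omega>) * f (X n \<omega>)) + \<i> * complex_of_real (sin (b * Y n \<omega>) * f (X n \<omega>)))" for n
      by (intro Bochner_Integration.integral_cong refl) (simp add: exp_Euler algebra_simps flip: cos_of_real sin_of_real)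
    also have "\<dots> n = complex_of_real (expectation (\<lambda>\<omega>. cos (b * Y n \<omega>) * f (X n \<omega>)))
         + \<i> * complex_of_real (expectation (\<lambda>\<omega>. sin (b * Y n \<omega>) * f (X n \<omega>)))" for n
      by (simp only: Bochner_Integration.integral_add[OF integrable_of_real[OF ic] integrable_mult_right[OF integrable_of_real[OF isin]]]
          integral_mult_right_zero integral_complex_of_real)
    finally have *: "(CLINT \<omega>|M. f (X n \<omega>) * iexp (b * Y n \<omega>)) = \<dots> n" for n .
    have "(\<lambda>n. complex_of_real (expectation (\<lambda>\<omega>. cos (b * Y n \<omega>) * f (X n \<omega>)))
         + \<i> * complex_of_real (expectation (\<lambda>\<omega>. sin (b * Y n \<omega>) * f (X n \<omega>)))) \<longlonglongrightarrow>
        complex_of_real (exp (- b\<^sup>2 / 2) * (LINT x|?N. f x)) + \<i> * complex_of_real (0 * (LINT x|?N. f x))"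
      by (intro tendsto_intros c s)
    then show "(\<lambda>n. CLINT \<omega>|M. f (X n \<omega>) * iexp (b * Y n \<omega>)) \<longlonglongrightarrow> (LINT x|?N. f x) * char ?N b"
      unfolding * by (simp add: char_std_normal_distribution mult.commute)
  qed auto
qed

lemma std_normal_finite_null: "finite A \<Longrightarrow> emeasure std_normal_distribution A = 0"
proof -
  assume A: "finite A"
  have "AE x in lborel. x \<notin> A"
    using finite_imp_null_set_lborel[OF A] by (rule AE_not_in)
  then have "AE x in std_normal_distribution. x \<notin> A"
    by (subst AE_density) auto
  then show ?thesis
    using A by (subst AE_iff_measurable[symmetric, where P="\<lambda>x. x \<notin> A"]) (auto intro: finite_imp_closed borel_closed)
qed

lemma std_normal_pair_prod:
  fixes f g :: "real \<Rightarrow> real"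
  assumes f[measurable]: "f \<in> borel_measurable borel" and f_bdd: "\<And>x. \<bar>f x\<bar> \<le> B"
    and g[measurable]: "g \<in> borel_measurable borel" and g_bdd: "\<And>x. \<bar>g x\<bar> \<le> C"
  shows "integrable std_normal_pair (\<lambda>(x, y). f x * g y)"
    and "(LINT p|std_normal_pair. f (fst p) * g (snd p)) = (LINT x|std_normal_distribution. f x) * (LINT y|std_normal_distribution. g y)"
proof -
  interpret N: real_distribution std_normal_distribution by (rule real_dist_normal_dist)
  interpret P: pair_prob_space std_normal_distribution std_normal_distribution ..
  have B: "0 \<le> B" using f_bdd[of 0] by simp
  show int: "integrable std_normal_pair (\<lambda>(x, y). f x * g y)"
    by (rule P.integrable_const_bound[where B="B * C"])
       (auto simp: abs_mult B split_beta intro!: AE_I2 mult_mono f_bdd g_bdd)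
  show "(LINT p|std_normal_pair. f (fst p) * g (snd p)) = (LINT x|std_normal_distribution. f x) * (LINT y|std_normal_distribution. g y)"
    using P.integral_fst'[OF int] by (simp add: split_beta')
qed

section \<open>The standard Cauchy law as a ratio of normals\<close>

lemma emeasure_std_normal_pair:
  assumes [measurable]: "A \<in> sets (borel \<Otimes>\<^sub>M borel)"
  shows "emeasure std_normal_pair A = (\<integral>\<^sup>+x. \<integral>\<^sup>+y. ennreal (std_normal_density x) * (ennreal (std_normal_density y) * indicator A (x, y)) \<partial>lborel \<partial>lborel)"
proof -
  interpret N: real_distribution std_normal_distribution by (rule real_dist_normal_dist)
  have "emeasure std_normal_pair A = (\<integral>\<^sup>+x. \<integral>\<^sup>+y. indicator A (x, y) \<partial>std_normal_distribution \<partial>std_normal_distribution)"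
    by (rule N.emeasure_pair_measure) (simp add: sets_pair_measure_cong[OF sets_density sets_density] cong: sets_pair_measure_cong)
  also have "\<dots> = (\<integral>\<^sup>+x. (\<integral>\<^sup>+y. ennreal (std_normal_density y) * indicator A (x, y) \<partial>lborel) \<partial>std_normal_distribution)"
    by (simp add: nn_integral_density)
  also have "\<dots> = (\<integral>\<^sup>+x. ennreal (std_normal_density x) * (\<integral>\<^sup>+y. ennreal (std_normal_density y) * indicator A (x, y) \<partial>lborel) \<partial>lborel)"
    by (subst nn_integral_density) auto
  also have "\<dots> = (\<integral>\<^sup>+x. \<integral>\<^sup>+y. ennreal (std_normal_density x) * (ennreal (std_normal_density y) * indicator A (x, y)) \<partial>lborel \<partial>lborel)"
    by (intro nn_integral_cong) (subst nn_integral_cmult, auto)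
  finally show ?thesis .
qed

lemma nn_integral_abs_std_normal:
  "(\<integral>\<^sup>+x. ennreal (\<bar>x\<bar> * std_normal_density x) \<partial>lborel) = ennreal (sqrt (2 / pi))"
  using std_normal_moment_abs_odd[of 0]
  by (subst nn_integral_eq_integral)
     (auto simp: has_bochner_integral_iff mult.commute)

text \<open>
  The density at \<open>t\<close> of the quotient of two independent standard normals: the two Gaussian factors
  combine to one with scale \<open>sqrt (1 + t\<^sup>2)\<close>, and a substitution reduces the integral to the first
  absolute moment.
\<close>

lemma std_normal_ratio_density:
  "(\<integral>\<^sup>+x. ennreal (\<bar>x\<bar> * std_normal_density x * std_normal_density (t * x)) \<partial>lborel) = ennreal (std_cauchy_density t)"
proof -
  define s where "s = sqrt (1 + t\<^sup>2)"
  have s: "s > 0" "s\<^sup>2 = 1 + t\<^sup>2"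
    unfolding s_def by (auto simp: add_pos_nonneg)
  have e: "\<bar>x\<bar> * std_normal_density x * std_normal_density (t * x) =
      1 / (s * sqrt (2 * pi)) * (\<bar>s * x\<bar> * std_normal_density (s * x))" for x
  proof -
    have "exp (- x\<^sup>2 / 2) * exp (- (t * x)\<^sup>2 / 2) = exp (- (s * x)\<^sup>2 / 2)"
      unfolding exp_add[symmetric] power_mult_distrib s(2) by (simp add: field_simps)
    then have "\<bar>x\<bar> * std_normal_density x * std_normal_density (t * x) = \<bar>x\<bar> * (1 / sqrt (2 * pi))\<^sup>2 * exp (- (s * x)\<^sup>2 / 2)"
      unfolding std_normal_density_def by (simp add: power2_eq_square)
    also have "\<dots> = 1 / (s * sqrt (2 * pi)) * (\<bar>s * x\<bar> * std_normal_density (s * x))"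
      unfolding std_normal_density_def using s(1) by (simp add: abs_mult power2_eq_square)
    finally show ?thesis .
  qed
  have "(\<integral>\<^sup>+x. ennreal (\<bar>x\<bar> * std_normal_density x) \<partial>lborel) = \<bar>s\<bar> * (\<integral>\<^sup>+x. ennreal (\<bar>0 + s * x\<bar> * std_normal_density (0 + s * x)) \<partial>lborel)"
    using s(1) by (intro nn_integral_real_affine) auto
  then have *: "ennreal (sqrt (2 / pi)) = ennreal s * (\<integral>\<^sup>+x. ennreal (\<bar>s * x\<bar> * std_normal_density (s * x)) \<partial>lborel)"
    using s(1) by (simp add: nn_integral_abs_std_normal)
  have "(\<integral>\<^sup>+x. ennreal (\<bar>s * x\<bar> * std_normal_density (s * x)) \<partial>lborel) = ennreal (1 / s) * (ennreal s * (\<integral>\<^sup>+x. ennreal (\<bar>s * x\<bar> * std_normal_density (s * x)) \<partial>lborel))"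
    using s(1) by (simp add: mult.assoc[symmetric] ennreal_mult[symmetric])
  also have "\<dots> = ennreal (sqrt (2 / pi) / s)"
    unfolding *[symmetric] using s(1) by (simp add: ennreal_mult[symmetric])
  finally have **: "(\<integral>\<^sup>+x. ennreal (\<bar>s * x\<bar> * std_normal_density (s * x)) \<partial>lborel) = ennreal (sqrt (2 / pi) / s)" .
  have "(\<integral>\<^sup>+x. ennreal (\<bar>x\<bar> * std_normal_density x * std_normal_density (t * x)) \<partial>lborel) =
     ennreal (1 / (s * sqrt (2 * pi))) * (\<integral>\<^sup>+x. ennreal (\<bar>s * x\<bar> * std_normal_density (s * x)) \<partial>lborel)"
    unfolding e using s(1) by (subst nn_integral_cmult[symmetric]) (auto simp: ennreal_mult[symmetric])
  also have "\<dots> = ennreal (1 / (s * sqrt (2 * pi)) * (sqrt (2 / pi) / s))"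
    unfolding ** using s(1) by (simp add: ennreal_mult[symmetric])
  also have "1 / (s * sqrt (2 * pi)) * (sqrt (2 / pi) / s) = 1 / (pi * s\<^sup>2)"
    using s(1) by (simp add: real_sqrt_divide real_sqrt_mult power2_eq_square field_simps)
  finally show ?thesis
    by (simp add: std_cauchy_density_def s(2))
qed

text \<open>
  Substitute \<open>y = x t\<close> in the inner integral and exchange the order of integration.
\<close>

lemma std_normal_ratio_cauchy:
  "emeasure std_normal_pair {p. \<bar>snd p\<bar> \<le> w * \<bar>fst p\<bar>} = (\<integral>\<^sup>+t. ennreal (std_cauchy_density t) * indicator {-w..w} t \<partial>lborel)"
proof -
  let ?A = "{p :: real \<times> real. \<bar>snd p\<bar> \<le> w * \<bar>fst p\<bar>}"
  have [measurable]: "?A \<in> sets (borel \<Otimes>\<^sub>M borel)"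
    unfolding borel_prod by (intro borel_closed closed_Collect_le continuous_intros)
  have sub: "(\<integral>\<^sup>+y. ennreal (std_normal_density x) * (ennreal (std_normal_density y) * indicator ?A (x, y)) \<partial>lborel) =
      (\<integral>\<^sup>+t. ennreal (\<bar>x\<bar> * std_normal_density x * std_normal_density (t * x)) * indicator {-w..w} t \<partial>lborel)"
    if x: "x \<noteq> 0" for x
  proof -
    have ind: "indicator ?A (x, 0 + x * t) = (indicator {-w..w} t :: ennreal)" for t
      using x by (auto simp: indicator_def abs_mult mult.commute[of _ "\<bar>x\<bar>"])
    have "(\<integral>\<^sup>+y. ennreal (std_normal_density x) * (ennreal (std_normal_density y) * indicator ?A (x, y)) \<partial>lborel) =
        \<bar>x\<bar> * (\<integral>\<^sup>+t. ennreal (std_normal_density x) * (ennreal (std_normal_density (0 + x * t)) * indicator ?A (x, 0 + x * t)) \<partial>lborel)"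
      using x by (intro nn_integral_real_affine) auto
    also have "\<dots> = (\<integral>\<^sup>+t. \<bar>x\<bar> * (ennreal (std_normal_density x) * (ennreal (std_normal_density (0 + x * t)) * indicator {-w..w} t)) \<partial>lborel)"
      unfolding ind by (subst nn_integral_cmult[symmetric]) auto
    also have "\<dots> = (\<integral>\<^sup>+t. ennreal (\<bar>x\<bar> * std_normal_density x * std_normal_density (t * x)) * indicator {-w..w} t \<partial>lborel)"
      by (intro nn_integral_cong) (simp add: ennreal_mult mult.assoc mult.commute[of x])
    finally show ?thesis .
  qed
  have "emeasure std_normal_pair ?A = (\<integral>\<^sup>+x. \<integral>\<^sup>+t. ennreal (\<bar>x\<bar> * std_normal_density x * std_normal_density (t * x)) * indicator {-w..w} t \<partial>lborel \<partial>lborel)"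
    using AE_lborel_singleton[of "0::real"]
    by (subst emeasure_std_normal_pair) (auto intro!: nn_integral_cong_AE sub)
  also have "\<dots> = (\<integral>\<^sup>+t. \<integral>\<^sup>+x. ennreal (\<bar>x\<bar> * std_normal_density x * std_normal_density (t * x)) * indicator {-w..w} t \<partial>lborel \<partial>lborel)"
    by (rule lborel_pair.Fubini') measurable
  also have "\<dots> = (\<integral>\<^sup>+t. ennreal (std_cauchy_density t) * indicator {-w..w} t \<partial>lborel)"
    by (simp add: nn_integral_multc std_normal_ratio_density)
  finally show ?thesis .
qed

lemma std_cauchy_primitive: "DERIV (\<lambda>x. arctan x / pi) x :> std_cauchy_density x"
  unfolding std_cauchy_density_def by (auto intro!: derivative_eq_intros simp: divide_simps add_nonneg_eq_0_iff)

lemma std_cauchy_density_nonneg: "0 \<le> std_cauchy_density x"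
  unfolding std_cauchy_density_def by simp

lemma borel_measurable_std_cauchy_density[measurable]: "std_cauchy_density \<in> borel_measurable borel"
  unfolding std_cauchy_density_def[abs_def] by measurable

lemma std_normal_ratio_prob:
  assumes "w > 0"
  shows "measure std_normal_pair {p. \<bar>snd p\<bar> \<le> w * \<bar>fst p\<bar>} = 2 * arctan w / pi"
proof -
  have "(\<integral>\<^sup>+t. ennreal (std_cauchy_density t) * indicator {-w..w} t \<partial>lborel) = ennreal (arctan w / pi - arctan (- w) / pi)"
    using assms by (intro nn_integral_FTC_Icc) (auto intro!: std_cauchy_primitive std_cauchy_density_nonneg DERIV_subset[OF std_cauchy_primitive])
  also have "arctan w / pi - arctan (- w) / pi = 2 * arctan w / pi"
    by (simp add: arctan_minus field_simps)
  finally show ?thesis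
    unfolding measure_def std_normal_ratio_cauchy using assms by simp
qed

lemma cdf_std_cauchy: "cdf std_cauchy x = 1 / 2 + arctan x / pi"
proof -
  have lim: "((\<lambda>x. arctan x / pi) \<longlongrightarrow> (pi / 2) / pi) at_top"
    by (intro tendsto_divide tendsto_arctan_at_top) auto
  have "emeasure std_cauchy {..x} = (\<integral>\<^sup>+t. ennreal (std_cauchy_density t) * indicator {..x} t \<partial>lborel)"
    unfolding std_cauchy_def by (subst emeasure_density) auto
  also have "\<dots> = ennreal \<bar>-1\<bar> * (\<integral>\<^sup>+t. ennreal (std_cauchy_density (0 + (-1) * t)) * indicator {..x} (0 + (-1) * t) \<partial>lborel)"
    by (intro nn_integral_real_affine) auto
  also have "\<dots> = (\<integral>\<^sup>+t. ennreal (std_cauchy_density t) * indicator {-x..} t \<partial>lborel)"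
    by (auto intro!: nn_integral_cong simp: indicator_def std_cauchy_density_def)
  also have "\<dots> = ennreal ((pi / 2) / pi - arctan (- x) / pi)"
    by (intro nn_integral_FTC_atLeast lim std_cauchy_primitive std_cauchy_density_nonneg) auto
  also have "(pi / 2) / pi - arctan (- x) / pi = 1 / 2 + arctan x / pi"
    by (simp add: arctan_minus)
  finally have "emeasure std_cauchy {..x} = ennreal (1 / 2 + arctan x / pi)" .
  moreover have "0 \<le> 1 / 2 + arctan x / pi"
    using arctan_lbound[of x] pi_gt_zero by (simp add: field_simps)
  ultimately show ?thesis
    unfolding cdf_def2 measure_def by simp
qed

lemma quantile_std_cauchy:
  assumes "0 < p" "p < 1"
  shows "quantile std_cauchy p = tan (pi * (p - 1 / 2))"
proof -
  let ?a = "pi * (p - 1 / 2)"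
  have a: "- (pi / 2) < ?a" "?a < pi / 2"
    using assms pi_gt_zero by (simp_all add: algebra_simps)
  have "p \<le> cdf std_cauchy x \<longleftrightarrow> ?a \<le> arctan x" for x
    unfolding cdf_std_cauchy using pi_gt_zero by (simp add: field_simps)
  also have "?a \<le> arctan x \<longleftrightarrow> tan ?a \<le> x" for x
    using arctan_le_iff[of "tan ?a" x] arctan_tan[OF a] by simp
  finally show ?thesis
    unfolding quantile_def by (simp add: atLeast_def[symmetric])
qed

section \<open>Ratios of asymptotically normal pairs\<close>

text \<open>
  The point is that each expectation on the right has the product form required by
  \<open>bivariate_levy_continuity\<close>.
\<close>

lemma (in prob_space) char_log_ratio:
  fixes X Y :: "'a \<Rightarrow> real"
  assumes [measurable]: "X \<in> borel_measurable M" "Y \<in> borel_measurable M"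
  defines "C \<equiv> \<lambda>t x. cos (t * ln \<bar>x\<bar>)" and "S \<equiv> \<lambda>t x. sin (t * ln \<bar>x\<bar>)"
  shows "char (distr M borel (\<lambda>\<omega>. ln \<bar>Y \<omega>\<bar> - ln \<bar>X \<omega>\<bar>)) t =
    complex_of_real (expectation (\<lambda>\<omega>. C t (X \<omega>) * C t (Y \<omega>)) + expectation (\<lambda>\<omega>. S t (X \<omega>) * S t (Y \<omega>)))
    + \<i> * complex_of_real (expectation (\<lambda>\<omega>. C t (X \<omega>) * S t (Y \<omega>)) - expectation (\<lambda>\<omega>. S t (X \<omega>) * C t (Y \<omega>)))"
proof -
  have int: "integrable M (\<lambda>\<omega>. f (t * ln \<bar>X \<omega>\<bar>) * g (t * ln \<bar>Y \<omega>\<bar>))"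
    if "f \<in> {cos, sin}" "g \<in> {cos, sin}" for f g :: "real \<Rightarrow> real"
  proof (rule integrable_const_bound[where B="1 * 1"])
    have "\<bar>f x\<bar> \<le> 1" "\<bar>g x\<bar> \<le> 1" for x using that by auto
    then show "AE \<omega> in M. norm (f (t * ln \<bar>X \<omega>\<bar>) * g (t * ln \<bar>Y \<omega>\<bar>)) \<le> 1 * 1"
      unfolding real_norm_def abs_mult by (intro AE_I2 mult_mono) auto
  qed (use that in auto)
  have "char (distr M borel (\<lambda>\<omega>. ln \<bar>Y \<omega>\<bar> - ln \<bar>X \<omega>\<bar>)) t =
     (CLINT \<omega>|M. iexp (t * (ln \<bar>Y \<omega>\<bar> - ln \<bar>X \<omega>\<bar>)))"
    unfolding char_def by (rule integral_distr) auto
  also have "\<dots> = (CLINT \<omega>|M. complex_of_real (C t (X \<omega>) * C t (Y \<omega>) + S t (X \<omega>) * S t (Y \<omega>))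
     + \<i> * complex_of_real (C t (X \<omega>) * S t (Y \<omega>) - S t (X \<omega>) * C t (Y \<omega>)))"
    unfolding cis_conv_exp[symmetric] C_def S_def
    by (intro Bochner_Integration.integral_cong refl)
       (simp add: complex_eq_iff right_diff_distrib cos_diff sin_diff)
  also have "\<dots> = (CLINT \<omega>|M. complex_of_real (C t (X \<omega>) * C t (Y \<omega>) + S t (X \<omega>) * S t (Y \<omega>)))
     + (CLINT \<omega>|M. \<i> * complex_of_real (C t (X \<omega>) * S t (Y \<omega>) - S t (X \<omega>) * C t (Y \<omega>)))"
    unfolding C_def S_def
    by (intro Bochner_Integration.integral_add integrable_mult_right integrable_of_real
        Bochner_Integration.integrable_add Bochner_Integration.integrable_diff int) auto
  also have "\<dots> = complex_of_real (expectation (\<lambda>\<omega>. C t (X \<omega>) * C t (Y \<omega>) + S t (X \<omega>) * S t (Y \<omega>)))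
     + \<i> * complex_of_real (expectation (\<lambda>\<omega>. C t (X \<omega>) * S t (Y \<omega>) - S t (X \<omega>) * C t (Y \<omega>)))"
    by (simp only: integral_mult_right_zero integral_complex_of_real)
  also have "expectation (\<lambda>\<omega>. C t (X \<omega>) * C t (Y \<omega>) + S t (X \<omega>) * S t (Y \<omega>)) =
      expectation (\<lambda>\<omega>. C t (X \<omega>) * C t (Y \<omega>)) + expectation (\<lambda>\<omega>. S t (X \<omega>) * S t (Y \<omega>))"
    unfolding C_def S_def by (intro Bochner_Integration.integral_add int) auto
  also have "expectation (\<lambda>\<omega>. C t (X \<omega>) * S t (Y \<omega>) - S t (X \<omega>) * C t (Y \<omega>)) =
      expectation (\<lambda>\<omega>. C t (X \<omega>) * S t (Y \<omega>)) - expectation (\<lambda>\<omega>. S t (X \<omega>) * C t (Y \<omega>))"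
    unfolding C_def S_def by (intro Bochner_Integration.integral_diff int) auto
  finally show ?thesis .
qed

lemma (in prob_space) bivariate_normal_limit_abs_le:
  fixes X Y :: "nat \<Rightarrow> 'a \<Rightarrow> real"
  assumes X[measurable]: "\<And>n. X n \<in> borel_measurable M"
    and Y[measurable]: "\<And>n. Y n \<in> borel_measurable M"
    and conv: "\<And>a b. (\<lambda>n. CLINT \<omega>|M. iexp (a * X n \<omega> + b * Y n \<omega>)) \<longlonglongrightarrow> exp (- (a\<^sup>2 + b\<^sup>2) / 2)"
  shows "(\<lambda>n. prob {\<omega>\<in>space M. \<bar>X n \<omega>\<bar> \<le> w}) \<longlonglongrightarrow> measure std_normal_distribution {-w..w}"
    and "(\<lambda>n. prob {\<omega>\<in>space M. \<bar>Y n \<omega>\<bar> \<le> w}) \<longlonglongrightarrow> measure std_normal_distribution {-w..w}"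
proof -
  interpret N: real_distribution std_normal_distribution by (rule real_dist_normal_dist)
  have *: "(\<lambda>n. prob {\<omega>\<in>space M. \<bar>Z n \<omega>\<bar> \<le> w}) \<longlonglongrightarrow> measure std_normal_distribution {-w..w}"
    if Z[measurable]: "\<And>n. Z n \<in> borel_measurable M"
      and c: "\<And>a. (\<lambda>n. CLINT \<omega>|M. iexp (a * Z n \<omega>)) \<longlonglongrightarrow> exp (- a\<^sup>2 / 2)" for Z :: "nat \<Rightarrow> 'a \<Rightarrow> real"
  proof -
    have rd: "real_distribution (distr M borel (Z n))" for n
      by (rule real_distribution_distr) simp
    have "weak_conv_m (\<lambda>n. distr M borel (Z n)) std_normal_distribution"
    proof (rule levy_continuity[OF rd real_dist_normal_dist])
      fix t
      have "char (distr M borel (Z n)) t = (CLINT \<omega>|M. iexp (t * Z n \<omega>))" for n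
        unfolding char_def by (rule integral_distr) auto
      then show "(\<lambda>n. char (distr M borel (Z n)) t) \<longlonglongrightarrow> char std_normal_distribution t"
        using c[of t] by (simp add: char_std_normal_distribution)
    qed
    then have "(\<lambda>n. measure (distr M borel (Z n)) {-w..w}) \<longlonglongrightarrow> measure std_normal_distribution {-w..w}"
    proof (rule weak_conv_imp_continuity_set_conv[OF rd real_dist_normal_dist])
      have "frontier {-w..w} \<subseteq> {-w, w}"
        by (auto simp: frontier_def interior_atLeastAtMost_real)
      then show "emeasure std_normal_distribution (frontier {-w..w}) = 0"
        by (intro std_normal_finite_null) (auto intro: finite_subset)
    qed auto
    moreover have "measure (distr M borel (Z n)) {-w..w} = prob {\<omega>\<in>space M. \<bar>Z n \<omega>\<bar> \<le> w}" for n
      by (subst measure_distr) (auto intro!: arg_cong[where f=prob] simp: abs_le_iff)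
    ultimately show ?thesis by simp
  qed
  show "(\<lambda>n. prob {\<omega>\<in>space M. \<bar>X n \<omega>\<bar> \<le> w}) \<longlonglongrightarrow> measure std_normal_distribution {-w..w}"
    using conv[of _ 0] by (intro *) auto
  show "(\<lambda>n. prob {\<omega>\<in>space M. \<bar>Y n \<omega>\<bar> \<le> w}) \<longlonglongrightarrow> measure std_normal_distribution {-w..w}"
    using conv[of 0] by (intro *) auto
qed

text \<open>
  On the logarithmic scale the ratio is a difference, so its characteristic function is a
  combination of expectations of products.  The test functions are discontinuous only at 0, a null
  set of the normal law.  The convention \<open>ln 0 = 0\<close> is harmless since \<open>X\<close> and \<open>Y\<close> vanish with
  probability tending to 0.
\<close>

lemma (in prob_space) ratio_tends_to_cauchy:
  fixes X Y :: "nat \<Rightarrow> 'a \<Rightarrow> real"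
  assumes X[measurable]: "\<And>n. X n \<in> borel_measurable M"
    and Y[measurable]: "\<And>n. Y n \<in> borel_measurable M"
    and conv: "\<And>a b. (\<lambda>n. CLINT \<omega>|M. iexp (a * X n \<omega> + b * Y n \<omega>)) \<longlonglongrightarrow> exp (- (a\<^sup>2 + b\<^sup>2) / 2)"
    and w: "w > 0"
  shows "(\<lambda>n. prob {\<omega>\<in>space M. \<bar>Y n \<omega> / X n \<omega>\<bar> \<le> w}) \<longlonglongrightarrow> 2 * arctan w / pi"
proof -
  let ?N = "std_normal_distribution"
  interpret N: real_distribution ?N by (rule real_dist_normal_dist)
  interpret P: pair_prob_space ?N ?N ..
  define L where "L p = ln \<bar>snd p\<bar> - ln \<bar>fst p\<bar>" for p :: "real \<times> real"
  define D where "D n \<omega> = ln \<bar>Y n \<omega>\<bar> - ln \<bar>X n \<omega>\<bar>" for n \<omega>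
  have [measurable]: "L \<in> borel_measurable (borel \<Otimes>\<^sub>M borel)"
    unfolding L_def[abs_def] by measurable
  have [measurable]: "D n \<in> borel_measurable M" for n
    unfolding D_def[abs_def] by measurable
  define \<mu> where "\<mu> = distr std_normal_pair borel L"
  have rd: "real_distribution (distr M borel (D n))" for n
    by (rule real_distribution_distr) simp
  have rd': "real_distribution \<mu>"
    unfolding \<mu>_def by (rule P.real_distribution_distr) simp
  interpret \<mu>': real_distribution \<mu> by (rule rd')
  have cont: "emeasure ?N {x. \<not> isCont (\<lambda>x. f (t * ln \<bar>x\<bar>)) x} = 0"
    if "f \<in> {cos, sin}" for f :: "real \<Rightarrow> real" and t
  proof -
    have "isCont (\<lambda>x. f (t * ln \<bar>x\<bar>)) x" if "x \<noteq> 0" for x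
      using \<open>f \<in> _\<close> that by (auto intro!: continuous_intros)
    then have "{x. \<not> isCont (\<lambda>x. f (t * ln \<bar>x\<bar>)) x} \<subseteq> {0}" by auto
    then show ?thesis
      by (intro std_normal_finite_null) (auto intro: finite_subset)
  qed
  have lim: "(\<lambda>n. expectation (\<lambda>\<omega>. f (t * ln \<bar>X n \<omega>\<bar>) * g (t * ln \<bar>Y n \<omega>\<bar>))) \<longlonglongrightarrow>
      (LINT p|std_normal_pair. f (t * ln \<bar>fst p\<bar>) * g (t * ln \<bar>snd p\<bar>))"
    if fg: "f \<in> {cos, sin}" "g \<in> {cos, sin}" for f g :: "real \<Rightarrow> real" and t
  proof -
    have b: "\<bar>f x\<bar> \<le> 1" "\<bar>g x\<bar> \<le> 1" for x using fg by auto
    have m[measurable]: "(\<lambda>x. f (t * ln \<bar>x\<bar>)) \<in> borel_measurable borel" "(\<lambda>x. g (t * ln \<bar>x\<bar>)) \<in> borel_measurable borel"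
      using fg by auto
    show ?thesis
      using bivariate_levy_continuity[OF X Y conv m(1) b(1) cont[OF fg(1)] m(2) b(2) cont[OF fg(2)]]
        std_normal_pair_prod(2)[OF m(1) b(1) m(2) b(2)] by simp
  qed
  have weak: "weak_conv_m (\<lambda>n. distr M borel (D n)) \<mu>"
  proof (rule levy_continuity[OF rd rd'])
    fix t
    show "(\<lambda>n. char (distr M borel (D n)) t) \<longlonglongrightarrow> char \<mu> t"
      unfolding \<mu>_def D_def[abs_def] L_def[abs_def]
      by (subst char_log_ratio, simp, simp, subst P.char_log_ratio, simp, simp)
         (intro tendsto_add tendsto_mult tendsto_of_real tendsto_diff tendsto_const lim, auto)
  qed
  have null: "AE p in std_normal_pair. fst p \<noteq> 0 \<and> snd p \<noteq> 0 \<and> \<bar>snd p\<bar> \<noteq> w * \<bar>fst p\<bar>"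
  proof (rule P.AE_pair_measure)
    show "{x \<in> space std_normal_pair. fst x \<noteq> 0 \<and> snd x \<noteq> 0 \<and> \<bar>snd x\<bar> \<noteq> w * \<bar>fst x\<bar>} \<in> sets std_normal_pair"
      by measurable
    have *: "AE x in ?N. x \<notin> A" if "finite A" for A
      using std_normal_finite_null[OF that] by (intro AE_not_in null_setsI) (auto intro: that finite_imp_closed borel_closed)
    show "AE x in ?N. AE y in ?N. fst (x, y) \<noteq> 0 \<and> snd (x, y) \<noteq> 0 \<and> \<bar>snd (x, y)\<bar> \<noteq> w * \<bar>fst (x, y)\<bar>"
    proof -
      have "AE x in ?N. x \<notin> {0}"
        by (rule *) simp
      then show ?thesis
      proof eventually_elim
        case (elim x)
        have "AE y in ?N. y \<notin> {0, w * \<bar>x\<bar>, - (w * \<bar>x\<bar>)}"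
          by (rule *) simp
        then show ?case
          by eventually_elim (use elim in auto)
      qed
    qed
  qed
  have LN[measurable]: "L \<in> borel_measurable std_normal_pair"
    unfolding L_def[abs_def] by measurable
  have Lsets: "{p \<in> space std_normal_pair. L p = ln w} \<in> sets std_normal_pair" "{p \<in> space std_normal_pair. L p \<le> ln w} \<in> sets std_normal_pair"
    by measurable
  have "measure \<mu> {ln w} = P.prob {p \<in> space std_normal_pair. L p = ln w}"
    unfolding \<mu>_def by (subst measure_distr) (auto intro!: arg_cong[where f=P.prob])
  also have "\<dots> = P.prob {}"
  proof (rule P.finite_measure_eq_AE)
    show "AE x in std_normal_pair. (x \<in> {p \<in> space std_normal_pair. L p = ln w}) = (x \<in> {})"
      using null
    proof eventually_elim
      case (elim p)
      then have "L p = ln (\<bar>snd p\<bar> / \<bar>fst p\<bar>)" by (simp add: L_def ln_div)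
      moreover have "\<bar>snd p\<bar> / \<bar>fst p\<bar> \<noteq> w" using elim by (auto simp: field_simps)
      ultimately show ?case using elim w by auto
    qed
  qed (use Lsets in auto)
  finally have "isCont (cdf \<mu>) (ln w)"
    by (simp add: \<mu>'.isCont_cdf)
  with weak have 1: "(\<lambda>n. cdf (distr M borel (D n)) (ln w)) \<longlonglongrightarrow> cdf \<mu> (ln w)"
    unfolding weak_conv_m_def weak_conv_def by auto
  have "cdf \<mu> (ln w) = P.prob {p \<in> space std_normal_pair. L p \<le> ln w}"
    unfolding \<mu>_def cdf_def2 by (subst measure_distr) (auto intro!: arg_cong[where f=P.prob])
  also have "\<dots> = P.prob {p. \<bar>snd p\<bar> \<le> w * \<bar>fst p\<bar>}"
  proof (rule P.finite_measure_eq_AE)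
    show "AE x in std_normal_pair. (x \<in> {p \<in> space std_normal_pair. L p \<le> ln w}) = (x \<in> {p. \<bar>snd p\<bar> \<le> w * \<bar>fst p\<bar>})"
      using null
    proof eventually_elim
      case (elim p)
      then have "L p = ln (\<bar>snd p\<bar> / \<bar>fst p\<bar>)" by (simp add: L_def ln_div)
      then show ?case using elim w by (auto simp: space_pair_measure field_simps)
    qed
    have "{p. \<bar>snd p\<bar> \<le> w * \<bar>fst p\<bar>} = {p \<in> space std_normal_pair. \<bar>snd p\<bar> \<le> w * \<bar>fst p\<bar>}"
      by (auto simp: space_pair_measure)
    also have "\<dots> \<in> sets std_normal_pair" by measurable
    finally show "{p. \<bar>snd p\<bar> \<le> w * \<bar>fst p\<bar>} \<in> sets std_normal_pair" .
  qed (rule Lsets)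
  finally have 2: "cdf \<mu> (ln w) = 2 * arctan w / pi"
    using std_normal_ratio_prob[OF w] by simp
  have 3: "cdf (distr M borel (D n)) (ln w) = prob {\<omega>\<in>space M. D n \<omega> \<le> ln w}" for n
    unfolding cdf_def2 by (subst measure_distr) (auto intro!: arg_cong[where f=prob])
  have z: "measure ?N {- 0..0} = 0"
    using std_normal_finite_null[of "{0}"] by (simp add: measure_def)
  have z2: "(\<lambda>n. prob {\<omega>\<in>space M. \<bar>X n \<omega>\<bar> \<le> 0} + prob {\<omega>\<in>space M. \<bar>Y n \<omega>\<bar> \<le> 0}) \<longlonglongrightarrow> 0 + 0"
    using bivariate_normal_limit_abs_le[OF X Y conv, of 0] unfolding z by (intro tendsto_add)
  have close: "\<bar>prob {\<omega>\<in>space M. \<bar>Y n \<omega> / X n \<omega>\<bar> \<le> w} - prob {\<omega>\<in>space M. D n \<omega> \<le> ln w}\<bar>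
      \<le> prob {\<omega>\<in>space M. \<bar>X n \<omega>\<bar> \<le> 0} + prob {\<omega>\<in>space M. \<bar>Y n \<omega>\<bar> \<le> 0}" for n
  proof -
    define A where "A = {\<omega>\<in>space M. \<bar>Y n \<omega> / X n \<omega>\<bar> \<le> w}"
    define B where "B = {\<omega>\<in>space M. D n \<omega> \<le> ln w}"
    define U where "U = {\<omega>\<in>space M. \<bar>X n \<omega>\<bar> \<le> 0}"
    define V where "V = {\<omega>\<in>space M. \<bar>Y n \<omega>\<bar> \<le> 0}"
    have sets: "A \<in> events" "B \<in> events" "U \<in> events" "V \<in> events"
      unfolding A_def B_def U_def V_def by measurable
    have "\<omega> \<in> A \<longleftrightarrow> \<omega> \<in> B" if "\<omega> \<notin> U \<union> V" "\<omega> \<in> space M" for \<omega>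
    proof -
      have nz: "X n \<omega> \<noteq> 0" "Y n \<omega> \<noteq> 0" using that by (auto simp: U_def V_def)
      then have "D n \<omega> = ln (\<bar>Y n \<omega> / X n \<omega>\<bar>)" by (simp add: D_def ln_div)
      then show ?thesis using nz w that(2) by (simp add: A_def B_def)
    qed
    then have "A \<subseteq> B \<union> (U \<union> V)" "B \<subseteq> A \<union> (U \<union> V)"
      unfolding A_def B_def by blast+
    then have "prob A \<le> prob (B \<union> (U \<union> V))" "prob B \<le> prob (A \<union> (U \<union> V))"
      using sets by (auto intro!: finite_measure_mono)
    moreover have "prob (B \<union> (U \<union> V)) \<le> prob B + (prob U + prob V)" "prob (A \<union> (U \<union> V)) \<le> prob A + (prob U + prob V)"
      using sets by (auto intro!: order_trans[OF measure_Un_le] add_left_mono)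
    ultimately show ?thesis
      unfolding A_def[symmetric] B_def[symmetric] U_def[symmetric] V_def[symmetric] by simp
  qed
  have "(\<lambda>n. prob {\<omega>\<in>space M. \<bar>Y n \<omega> / X n \<omega>\<bar> \<le> w} - prob {\<omega>\<in>space M. D n \<omega> \<le> ln w}) \<longlonglongrightarrow> 0"
    by (rule Lim_null_comparison[OF always_eventually]) (use close z2 in auto)
  from tendsto_add[OF this 1[unfolded 3 2]] show ?thesis by simp
qed

text \<open>
  A form of Slutsky's theorem for events: if, outside a set of small probability, \<open>A\<close> lies between
  \<open>{\<bar>U\<bar> \<le> z - \<tau>}\<close> and \<open>{\<bar>U\<bar> \<le> z + \<tau>}\<close>, then \<open>A\<close> has the limit probability of \<open>{\<bar>U\<bar> \<le> z}\<close>.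
\<close>

lemma (in prob_space) limit_of_sandwiched_events:
  fixes U :: "nat \<Rightarrow> 'a \<Rightarrow> real" and G :: "real \<Rightarrow> real"
  assumes U[measurable]: "\<And>n. U n \<in> borel_measurable M"
    and A: "\<And>n. A n \<in> events"
    and lim: "\<And>w. w > 0 \<Longrightarrow> (\<lambda>n. prob {\<omega>\<in>space M. \<bar>U n \<omega>\<bar> \<le> w}) \<longlonglongrightarrow> G w"
    and z: "z > 0" "isCont G z"
    and bad: "\<And>\<tau> \<epsilon>. \<tau> > 0 \<Longrightarrow> \<epsilon> > 0 \<Longrightarrow> \<exists>B. (\<forall>n. B n \<in> events) \<and> (\<forall>\<^sub>F n in sequentially. prob (B n) \<le> \<epsilon> \<and>
        (\<forall>\<omega>\<in>space M - B n. (\<omega> \<in> A n \<longrightarrow> \<bar>U n \<omega>\<bar> \<le> z + \<tau>) \<and> (\<bar>U n \<omega>\<bar> \<le> z - \<tau> \<longrightarrow> \<omega> \<in> A n)))"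
  shows "(\<lambda>n. prob (A n)) \<longlonglongrightarrow> G z"
proof (rule tendstoI)
  fix e :: real assume e: "e > 0"
  obtain s where s: "s > 0" "\<And>x. dist x z < s \<Longrightarrow> dist (G x) (G z) < e / 4"
    using z(2) e unfolding continuous_at_eps_delta by (metis divide_pos_pos zero_less_numeral)
  define \<tau> where "\<tau> = min (s / 2) (z / 2)"
  have \<tau>': "\<tau> > 0" "\<tau> < s" "z - \<tau> > 0"
    using s(1) z(1) by (auto simp: \<tau>_def)
  have \<tau>: "\<tau> > 0" "z - \<tau> > 0" "dist (G (z + \<tau>)) (G z) < e / 4" "dist (G (z - \<tau>)) (G z) < e / 4"
    using \<tau>' s(2)[of "z + \<tau>"] s(2)[of "z - \<tau>"] by (auto simp: dist_real_def)
  obtain B where B: "\<And>n. B n \<in> events" and ev: "\<forall>\<^sub>F n in sequentially. prob (B n) \<le> e / 4 \<and>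
        (\<forall>\<omega>\<in>space M - B n. (\<omega> \<in> A n \<longrightarrow> \<bar>U n \<omega>\<bar> \<le> z + \<tau>) \<and> (\<bar>U n \<omega>\<bar> \<le> z - \<tau> \<longrightarrow> \<omega> \<in> A n))"
    using bad[of \<tau> "e / 4"] \<tau>(1) e by auto
  have "\<forall>\<^sub>F n in sequentially. dist (prob {\<omega>\<in>space M. \<bar>U n \<omega>\<bar> \<le> z + \<tau>}) (G (z + \<tau>)) < e / 4"
    "\<forall>\<^sub>F n in sequentially. dist (prob {\<omega>\<in>space M. \<bar>U n \<omega>\<bar> \<le> z - \<tau>}) (G (z - \<tau>)) < e / 4"
    using lim[of "z + \<tau>"] lim[of "z - \<tau>"] \<tau> z e by (auto dest!: tendstoD[where e="e / 4"])
  with ev show "\<forall>\<^sub>F n in sequentially. dist (prob (A n)) (G z) < e"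
  proof eventually_elim
    case (elim n)
    have m: "{\<omega>\<in>space M. \<bar>U n \<omega>\<bar> \<le> w} \<in> events" for w
      by measurable
    have "A n \<subseteq> {\<omega>\<in>space M. \<bar>U n \<omega>\<bar> \<le> z + \<tau>} \<union> B n"
      using elim A[of n, THEN sets.sets_into_space] by auto
    then have "prob (A n) \<le> prob {\<omega>\<in>space M. \<bar>U n \<omega>\<bar> \<le> z + \<tau>} + prob (B n)"
      using m B by (intro order_trans[OF finite_measure_mono measure_Un_le]) auto
    moreover have "{\<omega>\<in>space M. \<bar>U n \<omega>\<bar> \<le> z - \<tau>} \<subseteq> A n \<union> B n"
      using elim by auto
    then have "prob {\<omega>\<in>space M. \<bar>U n \<omega>\<bar> \<le> z - \<tau>} \<le> prob (A n) + prob (B n)"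
      using m B A by (intro order_trans[OF finite_measure_mono measure_Un_le]) auto
    ultimately show ?case
      using elim \<tau>(3,4) unfolding dist_real_def by linarith
  qed
qed

lemma std_normal_small_interval:
  assumes "\<epsilon> > 0"
  obtains \<delta> where "\<delta> > 0" "measure std_normal_distribution {- \<delta>..\<delta>} < \<epsilon>"
proof -
  interpret N: real_distribution std_normal_distribution by (rule real_dist_normal_dist)
  have "(\<lambda>n. N.prob {- (1 / real (Suc n))..1 / real (Suc n)}) \<longlonglongrightarrow> N.prob (\<Inter>n. {- (1 / real (Suc n))..1 / real (Suc n)})"
    by (rule N.finite_Lim_measure_decseq) (auto simp: decseq_def frac_le intro: order_trans)
  also have "(\<Inter>n. {- (1 / real (Suc n))..1 / real (Suc n)}) = {0}"
  proof -
    have "x = 0" if x: "\<And>n. - (1 / real (Suc n)) \<le> x \<and> x \<le> 1 / real (Suc n)" for x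
    proof (rule ccontr)
      assume "x \<noteq> 0"
      then obtain n where "inverse (real (Suc n)) < \<bar>x\<bar>"
        using reals_Archimedean[of "\<bar>x\<bar>"] by auto
      with x[of n] show False by (simp add: inverse_eq_divide) linarith
    qed
    then show ?thesis by auto
  qed
  also have "N.prob {0} = 0"
    using std_normal_finite_null[of "{0}"] by (simp add: measure_def)
  finally have "\<forall>\<^sub>F n in sequentially. N.prob {- (1 / real (Suc n))..1 / real (Suc n)} < \<epsilon>"
    using assms by (rule order_tendstoD(2))
  then obtain n where "N.prob {- (1 / real (Suc n))..1 / real (Suc n)} < \<epsilon>"
    by (auto simp: eventually_sequentially)
  then show ?thesis by (intro that[of "1 / real (Suc n)"]) auto
qed

lemma std_normal_large_interval:
  assumes "\<epsilon> > 0"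
  obtains K where "K > 0" "measure std_normal_distribution {- K..K} > 1 - \<epsilon>"
proof -
  interpret N: real_distribution std_normal_distribution by (rule real_dist_normal_dist)
  have "(\<lambda>n. N.prob {- real (Suc n)..real (Suc n)}) \<longlonglongrightarrow> N.prob (\<Union>n. {- real (Suc n)..real (Suc n)})"
    by (rule N.finite_Lim_measure_incseq) (auto simp: incseq_def)
  also have "(\<Union>n. {- real (Suc n)..real (Suc n)}) = UNIV"
  proof -
    have "\<exists>n. - real (Suc n) \<le> x \<and> x \<le> real (Suc n)" for x
    proof -
      obtain n where "\<bar>x\<bar> < real n" using reals_Archimedean2 by blast
      then show ?thesis by (intro exI[of _ n]) auto
    qed
    then show ?thesis by auto
  qed
  also have "N.prob UNIV = 1"
    using N.prob_space by simp
  finally have "\<forall>\<^sub>F n in sequentially. N.prob {- real (Suc n)..real (Suc n)} > 1 - \<epsilon>"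
    using assms by (intro order_tendstoD(1)) auto
  then obtain n where "N.prob {- real (Suc n)..real (Suc n)} > 1 - \<epsilon>"
    by (auto simp: eventually_sequentially)
  then show ?thesis by (intro that[of "real (Suc n)"]) auto
qed

lemma abs_perturbed_ratio_diff_le:
  fixes x y f g K \<delta> \<eta> :: real
  assumes "\<delta> > 0" "\<delta> < \<bar>x\<bar>" "\<bar>x\<bar> \<le> K" "\<bar>y\<bar> \<le> K" "\<bar>f\<bar> \<le> \<eta>" "\<bar>g\<bar> \<le> \<eta>" "\<eta> \<le> \<delta>\<^sup>2 / 2"
  shows "\<bar>(x * y + f) / (x\<^sup>2 + g) - y / x\<bar> \<le> 4 * K * \<eta> / \<delta> ^ 3"
proof -
  have x: "\<delta>\<^sup>2 \<le> x\<^sup>2" using power_mono[of \<delta> "\<bar>x\<bar>" 2] assms by simp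
  have d: "\<delta>\<^sup>2 / 2 \<le> x\<^sup>2 + g" using x assms by linarith
  have \<delta>2: "0 < \<delta>\<^sup>2 / 2" using assms by simp
  have nz: "x \<noteq> 0" "x\<^sup>2 + g \<noteq> 0"
    using assms(1,2) less_le_trans[OF \<delta>2 d] by auto
  have "(x * y + f) / (x\<^sup>2 + g) - y / x = (x * f - y * g) / (x * (x\<^sup>2 + g))"
    using nz by (simp add: diff_frac_eq) (simp add: algebra_simps power2_eq_square)
  then have "\<bar>(x * y + f) / (x\<^sup>2 + g) - y / x\<bar> = \<bar>x * f - y * g\<bar> / (\<bar>x\<bar> * \<bar>x\<^sup>2 + g\<bar>)"
    by (simp add: abs_mult)
  also have "\<dots> \<le> (2 * K * \<eta>) / (\<delta> * (\<delta>\<^sup>2 / 2))"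
  proof (rule frac_le)
    have "\<bar>x * f - y * g\<bar> \<le> \<bar>x\<bar> * \<bar>f\<bar> + \<bar>y\<bar> * \<bar>g\<bar>"
      by (metis abs_mult abs_triangle_ineq4)
    also have "\<dots> \<le> K * \<eta> + K * \<eta>"
      using assms by (intro add_mono mult_mono) auto
    finally show "\<bar>x * f - y * g\<bar> \<le> 2 * K * \<eta>" by simp
    show "\<delta> * (\<delta>\<^sup>2 / 2) \<le> \<bar>x\<bar> * \<bar>x\<^sup>2 + g\<bar>"
      using assms d by (intro mult_mono) auto
  qed (use assms in auto)
  also have "\<dots> = 4 * K * \<eta> / \<delta> ^ 3"
    using assms by (simp add: power2_eq_square power3_eq_cube)
  finally show ?thesis .
qed

text \<open>
  Off an event of small probability \<open>X\<close> is bounded away from 0 and both variables are bounded,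
  so the perturbations \<open>F\<close> and \<open>G\<close> move the ratio only slightly.
\<close>

lemma (in prob_space) perturbed_ratio_tends_to_cauchy:
  fixes X Y F G :: "nat \<Rightarrow> 'a \<Rightarrow> real"
  assumes X[measurable]: "\<And>n. X n \<in> borel_measurable M"
    and Y[measurable]: "\<And>n. Y n \<in> borel_measurable M"
    and F[measurable]: "\<And>n. F n \<in> borel_measurable M"
    and G[measurable]: "\<And>n. G n \<in> borel_measurable M"
    and conv: "\<And>a b. (\<lambda>n. CLINT \<omega>|M. iexp (a * X n \<omega> + b * Y n \<omega>)) \<longlonglongrightarrow> exp (- (a\<^sup>2 + b\<^sup>2) / 2)"
    and F0: "small_o_p M F (\<lambda>_. 1)" and G0: "small_o_p M G (\<lambda>_. 1)"
    and w: "w > 0"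
  shows "(\<lambda>n. prob {\<omega>\<in>space M. \<bar>(X n \<omega> * Y n \<omega> + F n \<omega>) / ((X n \<omega>)\<^sup>2 + G n \<omega>)\<bar> \<le> w}) \<longlonglongrightarrow> 2 * arctan w / pi"
proof (rule limit_of_sandwiched_events[where U="\<lambda>n \<omega>. Y n \<omega> / X n \<omega>" and G="\<lambda>w. 2 * arctan w / pi"])
  show "(\<lambda>n. prob {\<omega> \<in> space M. \<bar>Y n \<omega> / X n \<omega>\<bar> \<le> w}) \<longlonglongrightarrow> 2 * arctan w / pi" if "w > 0" for w
    by (rule ratio_tends_to_cauchy[OF X Y conv that])
  fix \<tau> \<epsilon> :: real assume \<tau>: "\<tau> > 0" and \<epsilon>: "\<epsilon> > 0"
  interpret N: real_distribution std_normal_distribution by (rule real_dist_normal_dist)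
  obtain \<delta> where \<delta>: "\<delta> > 0" "measure std_normal_distribution {- \<delta>..\<delta>} < \<epsilon> / 5"
    using std_normal_small_interval[of "\<epsilon> / 5"] \<epsilon> by auto
  obtain K where K: "K > 0" "measure std_normal_distribution {- K..K} > 1 - \<epsilon> / 5"
    using std_normal_large_interval[of "\<epsilon> / 5"] \<epsilon> by auto
  \<comment> \<open>The first bound keeps the denominator at least \<open>\<delta>\<^sup>2 / 2\<close>, the second one makes the error of the ratio at most \<open>\<tau>\<close>.\<close>
  define \<eta> where "\<eta> = min (\<delta>\<^sup>2 / 2) (\<tau> * \<delta> ^ 3 / (4 * K))"
  have \<eta>: "\<eta> > 0" "\<eta> \<le> \<delta>\<^sup>2 / 2" "4 * K * \<eta> / \<delta> ^ 3 \<le> \<tau>"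
    using \<delta> K \<tau> by (auto simp: \<eta>_def min_def field_simps)
  define B1 where "B1 n = {\<omega>\<in>space M. \<bar>X n \<omega>\<bar> \<le> \<delta>}" for n
  define B2 where "B2 n = space M - {\<omega>\<in>space M. \<bar>X n \<omega>\<bar> \<le> K}" for n
  define B3 where "B3 n = space M - {\<omega>\<in>space M. \<bar>Y n \<omega>\<bar> \<le> K}" for n
  define B4 where "B4 n = {\<omega>\<in>space M. \<bar>F n \<omega> / 1\<bar> > \<eta>}" for n
  define B5 where "B5 n = {\<omega>\<in>space M. \<bar>G n \<omega> / 1\<bar> > \<eta>}" for n
  have sets: "B1 n \<in> events" "B2 n \<in> events" "B3 n \<in> events" "B4 n \<in> events" "B5 n \<in> events" for n
    unfolding B1_def B2_def B3_def B4_def B5_def by measurable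
  have ev: "\<forall>\<^sub>F n in sequentially. prob (B1 n) < \<epsilon> / 5" "\<forall>\<^sub>F n in sequentially. prob (B2 n) < \<epsilon> / 5"
    "\<forall>\<^sub>F n in sequentially. prob (B3 n) < \<epsilon> / 5" "\<forall>\<^sub>F n in sequentially. prob (B4 n) < \<epsilon> / 5"
    "\<forall>\<^sub>F n in sequentially. prob (B5 n) < \<epsilon> / 5"
  proof -
    show "\<forall>\<^sub>F n in sequentially. prob (B1 n) < \<epsilon> / 5"
      unfolding B1_def using bivariate_normal_limit_abs_le(1)[OF X Y conv] \<delta>(2) by (rule order_tendstoD)
    have "\<forall>\<^sub>F n in sequentially. prob {\<omega>\<in>space M. \<bar>X n \<omega>\<bar> \<le> K} > 1 - \<epsilon> / 5"
      using bivariate_normal_limit_abs_le(1)[OF X Y conv] K(2) by (rule order_tendstoD)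
    then show "\<forall>\<^sub>F n in sequentially. prob (B2 n) < \<epsilon> / 5"
      by eventually_elim (auto simp: B2_def prob_compl)
    have "\<forall>\<^sub>F n in sequentially. prob {\<omega>\<in>space M. \<bar>Y n \<omega>\<bar> \<le> K} > 1 - \<epsilon> / 5"
      using bivariate_normal_limit_abs_le(2)[OF X Y conv] K(2) by (rule order_tendstoD)
    then show "\<forall>\<^sub>F n in sequentially. prob (B3 n) < \<epsilon> / 5"
      by eventually_elim (auto simp: B3_def prob_compl)
    show "\<forall>\<^sub>F n in sequentially. prob (B4 n) < \<epsilon> / 5"
      unfolding B4_def using F0 \<eta>(1) \<epsilon> by (intro order_tendstoD(2)[where y=0]) (auto simp: small_o_p_def)
    show "\<forall>\<^sub>F n in sequentially. prob (B5 n) < \<epsilon> / 5"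
      unfolding B5_def using G0 \<eta>(1) \<epsilon> by (intro order_tendstoD(2)[where y=0]) (auto simp: small_o_p_def)
  qed
  define B where "B n = B1 n \<union> (B2 n \<union> (B3 n \<union> (B4 n \<union> B5 n)))" for n
  have Bs: "B n \<in> events" for n
    unfolding B_def using sets by auto
  show "\<exists>B. (\<forall>n. B n \<in> events) \<and> (\<forall>\<^sub>F n in sequentially. prob (B n) \<le> \<epsilon> \<and>
        (\<forall>\<omega>\<in>space M - B n. (\<omega> \<in> {\<omega>\<in>space M. \<bar>(X n \<omega> * Y n \<omega> + F n \<omega>) / ((X n \<omega>)\<^sup>2 + G n \<omega>)\<bar> \<le> w} \<longrightarrow> \<bar>Y n \<omega> / X n \<omega>\<bar> \<le> w + \<tau>)
        \<and> (\<bar>Y n \<omega> / X n \<omega>\<bar> \<le> w - \<tau> \<longrightarrow> \<omega> \<in> {\<omega>\<in>space M. \<bar>(X n \<omega> * Y n \<omega> + F n \<omega>) / ((X n \<omega>)\<^sup>2 + G n \<omega>)\<bar> \<le> w})))"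
    (is "\<exists>B. _ \<and> (\<forall>\<^sub>F n in _. ?Q B n)")
  proof (intro exI[of _ B] conjI allI Bs)
    show "\<forall>\<^sub>F n in sequentially. ?Q B n"
      using ev
    proof eventually_elim
      case (elim n)
      have "prob (B n) \<le> prob (B1 n) + (prob (B2 n) + (prob (B3 n) + (prob (B4 n) + prob (B5 n))))"
        unfolding B_def using sets by (intro order_trans[OF measure_Un_le] add_left_mono) auto
      then have "prob (B n) \<le> \<epsilon>" using elim by linarith
      moreover have "\<bar>(X n \<omega> * Y n \<omega> + F n \<omega>) / ((X n \<omega>)\<^sup>2 + G n \<omega>) - Y n \<omega> / X n \<omega>\<bar> \<le> \<tau>"
        if "\<omega> \<in> space M - B n" for \<omega>
        using that \<delta>(1) \<eta>(2) unfolding B_def B1_def B2_def B3_def B4_def B5_def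
        by (intro order_trans[OF abs_perturbed_ratio_diff_le \<eta>(3)]) auto
      then have "(\<bar>(X n \<omega> * Y n \<omega> + F n \<omega>) / ((X n \<omega>)\<^sup>2 + G n \<omega>)\<bar> \<le> w \<longrightarrow> \<bar>Y n \<omega> / X n \<omega>\<bar> \<le> w + \<tau>)
        \<and> (\<bar>Y n \<omega> / X n \<omega>\<bar> \<le> w - \<tau> \<longrightarrow> \<bar>(X n \<omega> * Y n \<omega> + F n \<omega>) / ((X n \<omega>)\<^sup>2 + G n \<omega>)\<bar> \<le> w)"
        if "\<omega> \<in> space M - B n" for \<omega>
        using that by (fastforce dest: abs_le_D1 abs_le_D2 intro: abs_leI)
      ultimately show ?case by auto
    qed
  qed
next
  show "isCont (\<lambda>w. 2 * arctan w / pi) w" by (intro continuous_intros) auto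
qed (use w in measurable)

lemma (in prob_space) small_o_p_of_expectation:
  assumes [measurable]: "\<And>n. X n \<in> borel_measurable M"
    and int: "\<forall>\<^sub>F n in sequentially. integrable M (X n) \<and> expectation (\<lambda>\<omega>. \<bar>X n \<omega>\<bar>) \<le> b n"
    and b: "b \<longlonglongrightarrow> 0"
  shows "small_o_p M X (\<lambda>_. 1)"
  unfolding small_o_p_def
proof (intro allI impI)
  fix e :: real assume e: "e > 0"
  have "\<forall>\<^sub>F n in sequentially. norm (\<P>(\<omega> in M. \<bar>X n \<omega> / 1\<bar> > e)) \<le> b n / e"
    using int
  proof eventually_elim
    case (elim n)
    have "prob {\<omega>\<in>space M. \<bar>X n \<omega>\<bar> > e} \<le> prob {\<omega>\<in>space M. \<bar>X n \<omega>\<bar> \<ge> e}"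
      by (intro finite_measure_mono) auto
    also have "\<dots> \<le> expectation (\<lambda>\<omega>. \<bar>X n \<omega>\<bar>) / e"
      using elim e by (intro integral_Markov_inequality_measure[where A="{}"]) auto
    also have "\<dots> \<le> b n / e" using elim e by (intro divide_right_mono) auto
    finally show ?case by simp
  qed
  moreover have "(\<lambda>n. b n / e) \<longlonglongrightarrow> 0"
    using tendsto_divide[OF b tendsto_const[of e]] e by simp
  ultimately show "(\<lambda>n. \<P>(\<omega> in M. \<bar>X n \<omega> / 1\<bar> > e)) \<longlonglongrightarrow> 0"
    by (rule Lim_null_comparison)
qed

section \<open>Moments of the lognormal volatility\<close>

text \<open>
  The logarithm of the squared volatility at time \<open>t\<close>, started at volatility 1, as a function of the
  path \<open>e\<close> of the volatility innovations.
\<close>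

definition log_vol :: "real \<Rightarrow> nat \<Rightarrow> (nat \<Rightarrow> real) \<Rightarrow> real" where
  "log_vol \<phi> t e = (\<Sum>j=1..t. \<phi> ^ (t - j) * e j)"

locale sv_noise = prob_space M for M :: "'a measure" +
  fixes \<alpha> :: real and \<epsilon> \<eta> :: "nat \<Rightarrow> 'a \<Rightarrow> real"
  assumes \<alpha>_pos: "\<alpha> > 0"
    and \<epsilon>_indep: "indep_vars (\<lambda>_. borel) \<epsilon> {1..}"
    and \<epsilon>_identical: "\<And>t. t \<ge> 1 \<Longrightarrow> distr M borel (\<epsilon> t) = distr M borel (\<epsilon> 1)"
    and \<epsilon>_mean: "expectation (\<epsilon> 1) = 0"
    and \<epsilon>_second_moment: "expectation (\<lambda>\<omega>. (\<epsilon> 1 \<omega>)\<^sup>2) = 1"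
    and \<epsilon>_fourth_moment: "integrable M (\<lambda>\<omega>. (\<epsilon> 1 \<omega>) ^ 4)"
    and \<eta>_indep: "indep_vars (\<lambda>_. borel) \<eta> {1..}"
    and \<eta>_normal: "\<And>t. t \<ge> 1 \<Longrightarrow> distributed M lborel (\<eta> t) (normal_density 0 \<alpha>)"
    and \<epsilon>_\<eta>_indep: "indep_var
          (Pi\<^sub>M {1..} (\<lambda>_. borel)) (\<lambda>\<omega>. \<lambda>t\<in>{1..}. \<epsilon> t \<omega>)
          (Pi\<^sub>M {1..} (\<lambda>_. borel)) (\<lambda>\<omega>. \<lambda>t\<in>{1..}. \<eta> t \<omega>)"
begin

lemma \<eta>_measurable[measurable]: "t \<ge> 1 \<Longrightarrow> \<eta> t \<in> borel_measurable M"
  using \<eta>_indep by (auto simp: indep_vars_def2)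

lemma \<epsilon>_measurable[measurable]: "t \<ge> 1 \<Longrightarrow> \<epsilon> t \<in> borel_measurable M"
  using \<epsilon>_indep by (auto simp: indep_vars_def2)

lemma normal_density_times_exp:
  "normal_density 0 \<alpha> x * exp (b * x) = exp (\<alpha>\<^sup>2 * b\<^sup>2 / 2) * normal_density (\<alpha>\<^sup>2 * b) \<alpha> x"
proof -
  have "- (x - 0)\<^sup>2 / (2 * \<alpha>\<^sup>2) + b * x = \<alpha>\<^sup>2 * b\<^sup>2 / 2 + (- (x - \<alpha>\<^sup>2 * b)\<^sup>2 / (2 * \<alpha>\<^sup>2))"
    using \<alpha>_pos by (simp add: field_simps power2_eq_square)
  then show ?thesis
    unfolding normal_density_def by (simp add: exp_add[symmetric])
qed

text \<open>
  Completing the square moves the factor \<open>exp (b x)\<close> into the mean of the normal density.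
\<close>

lemma \<eta>_exp_moment:
  assumes "t \<ge> 1"
  shows "integrable M (\<lambda>\<omega>. exp (b * \<eta> t \<omega>))"
    and "expectation (\<lambda>\<omega>. exp (b * \<eta> t \<omega>)) = exp (\<alpha>\<^sup>2 * b\<^sup>2 / 2)"
proof -
  note D = \<eta>_normal[OF assms]
  show "integrable M (\<lambda>\<omega>. exp (b * \<eta> t \<omega>))"
    using \<alpha>_pos by (subst distributed_integrable[OF D, symmetric]) (auto simp: normal_density_times_exp)
  have "(LINT x|lborel. normal_density 0 \<alpha> x * exp (b * x)) = expectation (\<lambda>\<omega>. exp (b * \<eta> t \<omega>))"
    by (rule distributed_integral[OF D]) auto
  then show "expectation (\<lambda>\<omega>. exp (b * \<eta> t \<omega>)) = exp (\<alpha>\<^sup>2 * b\<^sup>2 / 2)"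
    using \<alpha>_pos by (simp add: normal_density_times_exp)
qed

lemma \<eta>_sum_exp_moment:
  fixes b :: "nat \<Rightarrow> real"
  shows "integrable M (\<lambda>\<omega>. exp (\<Sum>j=1..t. b j * \<eta> j \<omega>))"
    and "expectation (\<lambda>\<omega>. exp (\<Sum>j=1..t. b j * \<eta> j \<omega>)) = exp (\<alpha>\<^sup>2 * (\<Sum>j=1..t. (b j)\<^sup>2) / 2)"
proof -
  have ind: "indep_vars (\<lambda>_. borel) (\<lambda>j \<omega>. exp (b j * \<eta> j \<omega>)) {1..t}"
    by (rule indep_vars_compose2[where X=\<eta> and M'="\<lambda>_. borel"])
       (auto intro: indep_vars_subset[OF \<eta>_indep])
  have int: "integrable M (\<lambda>\<omega>. exp (b j * \<eta> j \<omega>))" if "j \<in> {1..t}" for j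
    using that by (intro \<eta>_exp_moment) auto
  show "integrable M (\<lambda>\<omega>. exp (\<Sum>j=1..t. b j * \<eta> j \<omega>))"
    using indep_vars_integrable[OF finite_atLeastAtMost ind int] by (simp add: exp_sum)
  have "expectation (\<lambda>\<omega>. exp (\<Sum>j=1..t. b j * \<eta> j \<omega>)) = (\<Prod>j=1..t. expectation (\<lambda>\<omega>. exp (b j * \<eta> j \<omega>)))"
    using indep_vars_lebesgue_integral[OF finite_atLeastAtMost ind int] by (simp add: exp_sum)
  also have "\<dots> = (\<Prod>j=1..t. exp (\<alpha>\<^sup>2 * (b j)\<^sup>2 / 2))"
    by (intro prod.cong refl \<eta>_exp_moment) auto
  also have "\<dots> = exp (\<alpha>\<^sup>2 * (\<Sum>j=1..t. (b j)\<^sup>2) / 2)"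
    by (simp add: exp_sum[symmetric] sum_distrib_left sum_divide_distrib)
  finally show "expectation (\<lambda>\<omega>. exp (\<Sum>j=1..t. b j * \<eta> j \<omega>)) = exp (\<alpha>\<^sup>2 * (\<Sum>j=1..t. (b j)\<^sup>2) / 2)" .
qed

end

locale sv_volatility = sv_noise +
  fixes \<phi> :: real
  assumes \<phi>_stable: "\<bar>\<phi>\<bar> < 1"
begin

text \<open>
  The stationary variance of the log-volatility.
\<close>

definition s :: real where "s = \<alpha>\<^sup>2 / (1 - \<phi>\<^sup>2)"

definition var_log :: "nat \<Rightarrow> real" where "var_log t = s * (1 - (\<phi>\<^sup>2) ^ t)"

abbreviation h :: "nat \<Rightarrow> 'a \<Rightarrow> real" where "h t \<omega> \<equiv> log_vol \<phi> t (\<lambda>j. \<eta> j \<omega>)"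

definition vol :: "nat \<Rightarrow> 'a \<Rightarrow> real" where "vol t \<omega> = exp (h t \<omega> / 2)"

lemma \<phi>2: "0 \<le> \<phi>\<^sup>2" "\<phi>\<^sup>2 < 1"
  using \<phi>_stable by (auto simp: abs_square_less_1)

lemma s_pos: "s > 0"
  unfolding s_def using \<phi>2 \<alpha>_pos by simp

lemma var_log_bounds: "0 \<le> var_log t" "var_log t \<le> s"
  unfolding var_log_def using s_pos \<phi>2 power_le_one[OF \<phi>2(1), of t] zero_le_power[OF \<phi>2(1), of t]
  by (auto simp: mult_left_le)

lemma sum_sq_coeffs: "\<alpha>\<^sup>2 * (\<Sum>j=1..t. (\<phi> ^ (t - j))\<^sup>2) = var_log t"
proof -
  have "(\<Sum>j=1..t. (\<phi> ^ (t - j))\<^sup>2) = (\<Sum>i<t. (\<phi>\<^sup>2) ^ i)"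
    by (rule sum.reindex_bij_witness[where i="\<lambda>i. t - i" and j="\<lambda>j. t - j"])
       (auto simp: power_mult[symmetric] mult.commute)
  also have "\<dots> = (1 - (\<phi>\<^sup>2) ^ t) / (1 - \<phi>\<^sup>2)"
    using \<phi>2 by (subst geometric_sum) (auto simp: field_simps)
  finally show ?thesis
    by (simp add: var_log_def s_def)
qed

lemma h_measurable[measurable]: "h t \<in> borel_measurable M"
  unfolding log_vol_def by (intro borel_measurable_sum borel_measurable_times \<eta>_measurable) auto

lemma vol_measurable[measurable]: "vol t \<in> borel_measurable M"
  unfolding vol_def by measurable

lemma vol_pos: "0 < vol t \<omega>"
  unfolding vol_def by simp

lemma vol_power: "vol t \<omega> ^ m = exp ((real m / 2) * h t \<omega>)"
  unfolding vol_def by (simp add: exp_of_nat_mult[symmetric] field_simps)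

lemma h_exp_moment:
  shows "integrable M (\<lambda>\<omega>. exp (p * h t \<omega>))"
    and "expectation (\<lambda>\<omega>. exp (p * h t \<omega>)) = exp (p\<^sup>2 * var_log t / 2)"
proof -
  have e: "p * h t \<omega> = (\<Sum>j=1..t. (p * \<phi> ^ (t - j)) * \<eta> j \<omega>)" for \<omega>
    unfolding log_vol_def by (simp add: sum_distrib_left mult.assoc)
  have "\<alpha>\<^sup>2 * (\<Sum>j=1..t. (p * \<phi> ^ (t - j))\<^sup>2) = p\<^sup>2 * var_log t"
    unfolding sum_sq_coeffs[symmetric] power_mult_distrib by (simp add: sum_distrib_left mult_ac)
  then show "expectation (\<lambda>\<omega>. exp (p * h t \<omega>)) = exp (p\<^sup>2 * var_log t / 2)"
    unfolding e \<eta>_sum_exp_moment(2) by simp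
  show "integrable M (\<lambda>\<omega>. exp (p * h t \<omega>))"
    unfolding e by (rule \<eta>_sum_exp_moment(1))
qed

lemma vol_moment:
  shows "integrable M (\<lambda>\<omega>. vol t \<omega> ^ m)"
    and "expectation (\<lambda>\<omega>. vol t \<omega> ^ m) \<le> exp ((real m)\<^sup>2 * s / 8)"
proof -
  show "integrable M (\<lambda>\<omega>. vol t \<omega> ^ m)"
    unfolding vol_power by (rule h_exp_moment(1))
  have "expectation (\<lambda>\<omega>. vol t \<omega> ^ m) = exp ((real m)\<^sup>2 * var_log t / 8)"
    unfolding vol_power h_exp_moment(2) by (simp add: power_divide)
  then show "expectation (\<lambda>\<omega>. vol t \<omega> ^ m) \<le> exp ((real m)\<^sup>2 * s / 8)"
    using var_log_bounds(2)[of t] by (simp add: mult_left_mono)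
qed

definition vol2_mean :: "nat \<Rightarrow> real" where "vol2_mean t = exp (var_log t / 2)"

text \<open>
  The stationary mean of the squared volatility.
\<close>

definition stat_mean :: real where "stat_mean = exp (s / 2)"

lemma expectation_vol2: "expectation (\<lambda>\<omega>. (vol t \<omega>)\<^sup>2) = vol2_mean t"
  unfolding vol_power vol2_mean_def using h_exp_moment(2)[of 1 t] by simp

lemma stat_mean_ge_1: "1 \<le> stat_mean"
  unfolding stat_mean_def using s_pos by simp

lemma vol2_mean_le: "0 \<le> vol2_mean t" "vol2_mean t \<le> stat_mean"
  unfolding vol2_mean_def stat_mean_def using var_log_bounds by auto

text \<open>
  The deficit from the stationary mean decays geometrically, so its sum over all times is bounded
  by \<open>s\<^sup>2 / (2 \<alpha>\<^sup>2)\<close>.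
\<close>

lemma vol2_mean_deficit: "1 - vol2_mean t / stat_mean \<le> s * (\<phi>\<^sup>2) ^ t / 2"
proof -
  have "vol2_mean t / stat_mean = exp (- (s * (\<phi>\<^sup>2) ^ t / 2))"
    unfolding vol2_mean_def stat_mean_def exp_diff[symmetric] var_log_def by (simp add: field_simps)
  then show ?thesis
    using exp_ge_add_one_self[of "- (s * (\<phi>\<^sup>2) ^ t / 2)"] by linarith
qed

text \<open>
  For \<open>q \<le> t\<close> the covariance of the two log-volatilities is \<open>\<phi>\<^sup>(\<^sup>t\<^sup>-\<^sup>q\<^sup>)\<close> times the variance of
  the earlier one; it is the extra exponent here.
\<close>

lemma vol2_product_aux:
  assumes "q \<le> t"
  shows "integrable M (\<lambda>\<omega>. (vol q \<omega>)\<^sup>2 * (vol t \<omega>)\<^sup>2)"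
    and "expectation (\<lambda>\<omega>. (vol q \<omega>)\<^sup>2 * (vol t \<omega>)\<^sup>2) = vol2_mean q * vol2_mean t * exp (\<phi> ^ (t - q) * var_log q)"
proof -
  define b where "b j = \<phi> ^ (t - j) + (if j \<le> q then \<phi> ^ (q - j) else 0)" for j
  have split: "(\<Sum>j=1..t. if j \<le> q then f j else 0) = (\<Sum>j=1..q. f j)" for f :: "nat \<Rightarrow> real"
  proof -
    have "(\<Sum>j=1..t. if j \<le> q then f j else 0) = (\<Sum>j\<in>{j\<in>{1..t}. j \<le> q}. f j)"
      by (rule sum.inter_filter[symmetric]) simp
    also have "{j\<in>{1..t}. j \<le> q} = {1..q}" using assms by auto
    finally show ?thesis .
  qed
  have e: "(vol q \<omega>)\<^sup>2 * (vol t \<omega>)\<^sup>2 = exp (\<Sum>j=1..t. b j * \<eta> j \<omega>)" for \<omega>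
  proof -
    have "(\<Sum>j=1..t. b j * \<eta> j \<omega>) = h t \<omega> + (\<Sum>j=1..t. if j \<le> q then \<phi> ^ (q - j) * \<eta> j \<omega> else 0)"
      unfolding log_vol_def sum.distrib[symmetric]
      by (intro sum.cong refl) (simp add: b_def ring_distribs)
    then show ?thesis
      unfolding vol_power split by (simp add: exp_add log_vol_def)
  qed
  have "(\<Sum>j=1..t. (b j)\<^sup>2) = (\<Sum>j=1..t. (\<phi> ^ (t - j))\<^sup>2) + (\<Sum>j=1..t. if j \<le> q then (\<phi> ^ (q - j))\<^sup>2 + 2 * \<phi> ^ (t - q) * (\<phi> ^ (q - j))\<^sup>2 else 0)"
    unfolding sum.distrib[symmetric]
  proof (intro sum.cong refl)
    fix j assume "j \<in> {1..t}"
    have "\<phi> ^ (t - j) = \<phi> ^ (t - q) * \<phi> ^ (q - j)" if "j \<le> q"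
      using that assms by (simp add: power_add[symmetric])
    then show "(b j)\<^sup>2 = (\<phi> ^ (t - j))\<^sup>2 + (if j \<le> q then (\<phi> ^ (q - j))\<^sup>2 + 2 * \<phi> ^ (t - q) * (\<phi> ^ (q - j))\<^sup>2 else 0)"
      by (auto simp: b_def power2_eq_square algebra_simps)
  qed
  then have "\<alpha>\<^sup>2 * (\<Sum>j=1..t. (b j)\<^sup>2) = var_log t + var_log q + 2 * \<phi> ^ (t - q) * var_log q"
    unfolding split sum_sq_coeffs[symmetric] by (simp add: sum.distrib sum_distrib_left[symmetric] algebra_simps)
  then have "exp (\<alpha>\<^sup>2 * (\<Sum>j=1..t. (b j)\<^sup>2) / 2) = vol2_mean q * vol2_mean t * exp (\<phi> ^ (t - q) * var_log q)"
    unfolding vol2_mean_def exp_add[symmetric] by (simp add: add_divide_distrib)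
  then show "integrable M (\<lambda>\<omega>. (vol q \<omega>)\<^sup>2 * (vol t \<omega>)\<^sup>2)"
    "expectation (\<lambda>\<omega>. (vol q \<omega>)\<^sup>2 * (vol t \<omega>)\<^sup>2) = vol2_mean q * vol2_mean t * exp (\<phi> ^ (t - q) * var_log q)"
    unfolding e using \<eta>_sum_exp_moment[of b t] by simp_all
qed

lemma vol2_product_integrable: "integrable M (\<lambda>\<omega>. (vol q \<omega>)\<^sup>2 * (vol t \<omega>)\<^sup>2)"
  using vol2_product_aux(1)[of q t] vol2_product_aux(1)[of t q] by (cases "q \<le> t") (auto simp: mult.commute)

text \<open>
  Uses \<open>e\<^sup>x - 1 \<le> x e\<^sup>x\<close> for the exponent from \<open>vol2_product_aux\<close>.  The factor \<open>x\<close>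
  keeps the geometric decay in the lag.
\<close>

lemma vol2_covariance_le:
  "expectation (\<lambda>\<omega>. (vol q \<omega>)\<^sup>2 * (vol t \<omega>)\<^sup>2) - vol2_mean q * vol2_mean t
    \<le> stat_mean\<^sup>2 * s * exp s * \<bar>\<phi>\<bar> ^ ((t - q) + (q - t))"
proof -
  have main: "expectation (\<lambda>\<omega>. (vol q \<omega>)\<^sup>2 * (vol t \<omega>)\<^sup>2) - vol2_mean q * vol2_mean t
      \<le> stat_mean\<^sup>2 * s * exp s * \<bar>\<phi>\<bar> ^ (t - q)" if "q \<le> t" for q t
  proof -
    define x where "x = \<bar>\<phi>\<bar> ^ (t - q) * s"
    have p: "0 \<le> \<bar>\<phi>\<bar> ^ (t - q)" "\<bar>\<phi>\<bar> ^ (t - q) \<le> 1"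
      using \<phi>_stable by (auto intro: power_le_one)
    have x: "0 \<le> x" "x \<le> s"
      unfolding x_def using p s_pos by (auto simp: mult_left_le_one_le)
    have "\<phi> ^ (t - q) * var_log q \<le> \<bar>\<phi>\<bar> ^ (t - q) * var_log q"
      using var_log_bounds(1) by (intro mult_right_mono) (auto simp: power_abs[symmetric])
    also have "\<dots> \<le> x"
      unfolding x_def using p var_log_bounds by (intro mult_left_mono) auto
    finally have "exp (\<phi> ^ (t - q) * var_log q) \<le> exp x" by simp
    moreover have "exp x - 1 \<le> x * exp x"
    proof -
      have "exp x * (1 - x) \<le> exp x * exp (- x)"
        using exp_ge_add_one_self[of "- x"] by (intro mult_left_mono) auto
      then show ?thesis by (simp add: exp_minus algebra_simps)
    qed
    moreover have "x * exp x \<le> x * exp s" using x by (intro mult_left_mono) auto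
    ultimately have *: "exp (\<phi> ^ (t - q) * var_log q) - 1 \<le> x * exp s" by linarith
    have "expectation (\<lambda>\<omega>. (vol q \<omega>)\<^sup>2 * (vol t \<omega>)\<^sup>2) - vol2_mean q * vol2_mean t
       = (vol2_mean q * vol2_mean t) * (exp (\<phi> ^ (t - q) * var_log q) - 1)"
      unfolding vol2_product_aux(2)[OF that] by (simp add: algebra_simps)
    also have "\<dots> \<le> (vol2_mean q * vol2_mean t) * (x * exp s)"
      using vol2_mean_le by (intro mult_left_mono *) auto
    also have "\<dots> \<le> (stat_mean * stat_mean) * (x * exp s)"
      using vol2_mean_le x stat_mean_ge_1 by (intro mult_right_mono mult_mono) auto
    finally show ?thesis
      by (simp add: x_def power2_eq_square mult_ac)
  qed
  show ?thesis
  proof (cases "q \<le> t")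
    case True
    with main[OF True] show ?thesis by simp
  next
    case False
    with main[of t q] show ?thesis by (simp add: mult.commute)
  qed
qed

end

section \<open>Conditional Gaussian approximation\<close>

(* Otherwise simplification turns the index set {1..} into {Suc 0..}, and facts about the
   product space over {1..} no longer apply. *)
declare One_nat_def [simp del]

abbreviation (input) "real_seq \<equiv> Pi\<^sub>M {1..} (\<lambda>_::nat. borel :: real measure)"

lemma log_vol_measurable[measurable]: "log_vol \<phi> t \<in> borel_measurable real_seq"
  unfolding log_vol_def[abs_def]
  by (intro borel_measurable_sum borel_measurable_times borel_measurable_const measurable_component_singleton) auto

lemma log_vol_restrict: "log_vol \<phi> t (\<lambda>j\<in>{1..}. e j) = log_vol \<phi> t e"
  unfolding log_vol_def by (intro sum.cong) auto

context sv_noise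
begin

lemma \<epsilon>_power_integrable:
  assumes "t \<ge> 1" "m \<le> 4"
  shows "integrable M (\<lambda>\<omega>. \<bar>\<epsilon> t \<omega>\<bar> ^ m)" "integrable M (\<lambda>\<omega>. (\<epsilon> t \<omega>) ^ m)"
proof -
  have "integrable (distr M borel (\<epsilon> 1)) (\<lambda>x. x ^ 4)"
    using \<epsilon>_fourth_moment by (subst integrable_distr_eq) auto
  then have "integrable (distr M borel (\<epsilon> t)) (\<lambda>x. x ^ 4)"
    using \<epsilon>_identical[OF assms(1)] by simp
  then have 4: "integrable M (\<lambda>\<omega>. (\<epsilon> t \<omega>) ^ 4)"
    using assms by (subst (asm) integrable_distr_eq) auto
  have [measurable]: "\<epsilon> t \<in> borel_measurable M" using assms by simp
  have b: "\<bar>x\<bar> ^ m \<le> 1 + x ^ 4" for x :: real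
  proof (cases "\<bar>x\<bar> \<le> 1")
    case True
    then have "\<bar>x\<bar> ^ m \<le> 1" by (intro power_le_one) auto
    then show ?thesis by (simp add: add_increasing2)
  next
    case False
    then have "\<bar>x\<bar> ^ m \<le> \<bar>x\<bar> ^ 4" using assms by (intro power_increasing) auto
    then show ?thesis by (simp add: power_even_abs)
  qed
  show 1: "integrable M (\<lambda>\<omega>. \<bar>\<epsilon> t \<omega>\<bar> ^ m)"
    by (rule Bochner_Integration.integrable_bound[OF Bochner_Integration.integrable_add[OF integrable_const[of 1] 4]])
       (auto intro!: AE_I2 order_trans[OF b])
  show "integrable M (\<lambda>\<omega>. (\<epsilon> t \<omega>) ^ m)"
    by (rule Bochner_Integration.integrable_bound[OF 1]) (auto simp: power_abs)
qed

lemma \<epsilon>_moments: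
  assumes "t \<ge> 1"
  shows "expectation (\<epsilon> t) = 0" "expectation (\<lambda>\<omega>. (\<epsilon> t \<omega>)\<^sup>2) = 1"
proof -
  have *: "expectation (\<lambda>\<omega>. f (\<epsilon> t \<omega>)) = expectation (\<lambda>\<omega>. f (\<epsilon> 1 \<omega>))"
    if [measurable]: "f \<in> borel_measurable borel" for f :: "real \<Rightarrow> real"
  proof -
    have "expectation (\<lambda>\<omega>. f (\<epsilon> t \<omega>)) = (LINT x|distr M borel (\<epsilon> t). f x)"
      using assms by (subst integral_distr) auto
    also have "\<dots> = expectation (\<lambda>\<omega>. f (\<epsilon> 1 \<omega>))"
      unfolding \<epsilon>_identical[OF assms] by (subst integral_distr) auto
    finally show ?thesis .
  qed
  show "expectation (\<epsilon> t) = 0" using *[of "\<lambda>x. x"] \<epsilon>_mean by simp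
  show "expectation (\<lambda>\<omega>. (\<epsilon> t \<omega>)\<^sup>2) = 1" using *[of "\<lambda>x. x\<^sup>2"] \<epsilon>_second_moment by simp
qed

lemma \<epsilon>_product_moment:
  assumes "t \<ge> 1" "q \<ge> 1"
  shows "integrable M (\<lambda>\<omega>. \<epsilon> t \<omega> * \<epsilon> q \<omega>)"
    and "expectation (\<lambda>\<omega>. \<epsilon> t \<omega> * \<epsilon> q \<omega>) = (if t = q then 1 else 0)"
proof -
  have "integrable M (\<lambda>\<omega>. \<epsilon> t \<omega> * \<epsilon> q \<omega>) \<and> expectation (\<lambda>\<omega>. \<epsilon> t \<omega> * \<epsilon> q \<omega>) = (if t = q then 1 else 0)"
  proof (cases "t = q")
    case True
    then show ?thesis
      using \<epsilon>_power_integrable(2)[of t 2] \<epsilon>_moments(2)[of t] assms by (simp add: power2_eq_square)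
  next
    case False
    have ind: "indep_vars (\<lambda>_. borel) \<epsilon> {t, q}"
      using assms by (intro indep_vars_subset[OF \<epsilon>_indep]) auto
    have int: "integrable M (\<epsilon> j)" if "j \<in> {t, q}" for j
      using \<epsilon>_power_integrable(2)[of j 1] that assms by auto
    show ?thesis
      using indep_vars_lebesgue_integral[OF _ ind int] indep_vars_integrable[OF _ ind int] False \<epsilon>_moments(1) assms
      by simp
  qed
  then show "integrable M (\<lambda>\<omega>. \<epsilon> t \<omega> * \<epsilon> q \<omega>)"
    "expectation (\<lambda>\<omega>. \<epsilon> t \<omega> * \<epsilon> q \<omega>) = (if t = q then 1 else 0)" by auto
qed

definition char_const :: real where
  "char_const = (expectation (\<lambda>\<omega>. \<bar>\<epsilon> 1 \<omega>\<bar> ^ 3) + (LINT x|std_normal_distribution. \<bar>x\<bar> ^ 3)) / 6"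

text \<open>
  Both characteristic functions have the second-order expansion \<open>1 - t\<^sup>2 / 2\<close> with a third-moment
  error.
\<close>

lemma char_\<epsilon>_normal_diff:
  "cmod (char (distr M borel (\<epsilon> 1)) t - complex_of_real (exp (- t\<^sup>2 / 2))) \<le> char_const * \<bar>t\<bar> ^ 3"
proof -
  interpret N: real_distribution std_normal_distribution by (rule real_dist_normal_dist)
  let ?c = "complex_of_real (1 - t\<^sup>2 * 1 / 2)"
  have m: "t\<^sup>2 / 6 * (LINT x|Q. min (6 * (f x)\<^sup>2) (\<bar>t\<bar> * \<bar>f x\<bar> ^ 3)) \<le> \<bar>t\<bar> ^ 3 * (LINT x|Q. \<bar>f x\<bar> ^ 3) / 6"
    if "integrable Q (\<lambda>x. \<bar>f x\<bar> ^ 3)" "integrable Q (\<lambda>x. (f x)\<^sup>2)" "f \<in> borel_measurable Q"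
    for Q :: "'b measure" and f :: "'b \<Rightarrow> real"
  proof -
    have "(LINT x|Q. min (6 * (f x)\<^sup>2) (\<bar>t\<bar> * \<bar>f x\<bar> ^ 3)) \<le> (LINT x|Q. \<bar>t\<bar> * \<bar>f x\<bar> ^ 3)"
      using that by (intro integral_mono) (auto intro!: integrable_min)
    then have "t\<^sup>2 / 6 * (LINT x|Q. min (6 * (f x)\<^sup>2) (\<bar>t\<bar> * \<bar>f x\<bar> ^ 3)) \<le> t\<^sup>2 / 6 * (LINT x|Q. \<bar>t\<bar> * \<bar>f x\<bar> ^ 3)"
      by (intro mult_left_mono) auto
    also have "\<dots> = \<bar>t\<bar> ^ 3 * (LINT x|Q. \<bar>f x\<bar> ^ 3) / 6"
      by (simp add: power3_eq_cube power2_eq_square)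
    finally show ?thesis .
  qed
  have "cmod (char (distr M borel (\<epsilon> 1)) t - ?c) \<le> t\<^sup>2 / 6 * expectation (\<lambda>x. min (6 * (\<epsilon> 1 x)\<^sup>2) (\<bar>t\<bar> * \<bar>\<epsilon> 1 x\<bar> ^ 3))"
    using \<epsilon>_power_integrable(2)[of 1 1] \<epsilon>_power_integrable(2)[of 1 2] \<epsilon>_mean \<epsilon>_second_moment
    by (intro char_approx3'[where \<mu>="distr M borel (\<epsilon> 1)"]) auto
  also have "\<dots> \<le> \<bar>t\<bar> ^ 3 * expectation (\<lambda>\<omega>. \<bar>\<epsilon> 1 \<omega>\<bar> ^ 3) / 6"
    by (intro m) (auto intro: \<epsilon>_power_integrable)
  finally have 1: "cmod (char (distr M borel (\<epsilon> 1)) t - ?c) \<le> \<bar>t\<bar> ^ 3 * expectation (\<lambda>\<omega>. \<bar>\<epsilon> 1 \<omega>\<bar> ^ 3) / 6" .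
  have "cmod (char std_normal_distribution t - ?c) \<le> t\<^sup>2 / 6 * N.expectation (\<lambda>x. min (6 * x\<^sup>2) (\<bar>t\<bar> * \<bar>x\<bar> ^ 3))"
    using integrable_std_normal_distribution_moment[of 1] integrable_std_normal_distribution_moment[of 2]
      integral_std_normal_distribution_moment_odd[of 1] std_normal_distribution_even_moments(1)[of 1]
    by (intro N.char_approx3) auto
  also have "\<dots> \<le> \<bar>t\<bar> ^ 3 * (LINT x|std_normal_distribution. \<bar>x\<bar> ^ 3) / 6"
    using integrable_std_normal_distribution_moment[of 2] integrable_std_normal_distribution_moment[of 3]
    by (intro m) (auto simp: power_abs[symmetric])
  finally have 2: "cmod (char std_normal_distribution t - ?c) \<le> \<bar>t\<bar> ^ 3 * (LINT x|std_normal_distribution. \<bar>x\<bar> ^ 3) / 6" .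
  have "cmod (char (distr M borel (\<epsilon> 1)) t - char std_normal_distribution t) \<le>
      cmod (char (distr M borel (\<epsilon> 1)) t - ?c) + cmod (char std_normal_distribution t - ?c)"
    by (metis norm_minus_commute norm_triangle_sub norm_diff_triangle_ineq dist_triangle2 dist_norm)
  also have "\<dots> \<le> char_const * \<bar>t\<bar> ^ 3"
    using 1 2 unfolding char_const_def by (simp add: field_simps)
  finally show ?thesis
    by (simp add: char_std_normal_distribution)
qed

lemma char_const_nonneg: "0 \<le> char_const"
  unfolding char_const_def by (intro divide_nonneg_pos add_nonneg_nonneg integral_nonneg_AE) auto

text \<open>
  The characteristic function of the sum and its Gaussian counterpart are products of numbers in the
  unit disc, so the difference is at most the sum of
  the differences of the factors.
\<close>

lemma char_weighted_\<epsilon>_sum: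
  fixes c :: "nat \<Rightarrow> real"
  shows "cmod ((CLINT \<omega>|M. iexp (\<Sum>t=1..n. c t * \<epsilon> t \<omega>)) - complex_of_real (exp (- (\<Sum>t=1..n. (c t)\<^sup>2) / 2)))
    \<le> char_const * (\<Sum>t=1..n. \<bar>c t\<bar> ^ 3)"
proof -
  let ?\<chi> = "char (distr M borel (\<epsilon> 1))"
  interpret D: real_distribution "distr M borel (\<epsilon> 1)" by (rule real_distribution_distr) simp
  have ind: "indep_vars (\<lambda>_. borel) (\<lambda>t \<omega>. c t * \<epsilon> t \<omega>) {1..n}"
    by (rule indep_vars_compose2[where X=\<epsilon> and M'="\<lambda>_. borel"])
       (auto intro: indep_vars_subset[OF \<epsilon>_indep])
  have ch: "char (distr M borel (\<lambda>\<omega>. c t * \<epsilon> t \<omega>)) 1 = ?\<chi> (c t)" if "t \<in> {1..n}" for t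
  proof -
    have t: "t \<ge> 1" using that by simp
    then have [measurable]: "\<epsilon> t \<in> borel_measurable M" by simp
    have "char (distr M borel (\<lambda>\<omega>. c t * \<epsilon> t \<omega>)) 1 = (CLINT \<omega>|M. iexp (c t * \<epsilon> t \<omega>))"
      unfolding char_def by (subst integral_distr) auto
    also have "\<dots> = char (distr M borel (\<epsilon> t)) (c t)"
      unfolding char_def by (subst integral_distr) auto
    finally show ?thesis using \<epsilon>_identical[OF t] by simp
  qed
  have "(CLINT \<omega>|M. iexp (\<Sum>t=1..n. c t * \<epsilon> t \<omega>)) = char (distr M borel (\<lambda>\<omega>. \<Sum>t\<in>{1..n}. c t * \<epsilon> t \<omega>)) 1"
    unfolding char_def by (subst integral_distr) auto
  also have "\<dots> = (\<Prod>t\<in>{1..n}. ?\<chi> (c t))"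
    unfolding char_distr_sum[OF ind] using ch by (intro prod.cong) auto
  finally have 1: "(CLINT \<omega>|M. iexp (\<Sum>t=1..n. c t * \<epsilon> t \<omega>)) = (\<Prod>t\<in>{1..n}. ?\<chi> (c t))" .
  have "exp (- (\<Sum>t=1..n. (c t)\<^sup>2) / 2) = (\<Prod>t\<in>{1..n}. exp (- (c t)\<^sup>2 / 2))"
    by (simp add: exp_sum[symmetric] sum_negf sum_divide_distrib)
  then have 2: "complex_of_real (exp (- (\<Sum>t=1..n. (c t)\<^sup>2) / 2)) = (\<Prod>t\<in>{1..n}. complex_of_real (exp (- (c t)\<^sup>2 / 2)))"
    by simp
  have "cmod ((\<Prod>t\<in>{1..n}. ?\<chi> (c t)) - (\<Prod>t\<in>{1..n}. complex_of_real (exp (- (c t)\<^sup>2 / 2))))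
      \<le> (\<Sum>t\<in>{1..n}. cmod (?\<chi> (c t) - complex_of_real (exp (- (c t)\<^sup>2 / 2))))"
    by (intro norm_prod_diff) (use D.cmod_char_le_1 in \<open>auto simp del: of_real_exp\<close>)
  also have "\<dots> \<le> (\<Sum>t\<in>{1..n}. char_const * \<bar>c t\<bar> ^ 3)"
    by (intro sum_mono char_\<epsilon>_normal_diff)
  finally show ?thesis
    unfolding 1 2 by (simp add: sum_distrib_left)
qed

end

context sv_volatility
begin

lemma vol_eq: "vol t \<omega> = exp (log_vol \<phi> t (\<lambda>j\<in>{1..}. \<eta> j \<omega>) / 2)"
  unfolding vol_def log_vol_restrict ..

definition u :: "nat \<Rightarrow> 'a \<Rightarrow> real" where "u t \<omega> = vol t \<omega> * \<epsilon> t \<omega>"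

lemma u_measurable[measurable]: "t \<ge> 1 \<Longrightarrow> u t \<in> borel_measurable M"
  unfolding u_def by measurable

text \<open>
  A product of shocks splits into a function of \<open>\<epsilon>\<close> and a function of \<open>\<eta>\<close>.  Shocks at different
  times are thus uncorrelated although their volatilities are not.
\<close>

lemma u_product_moment:
  assumes tq: "t \<ge> 1" "q \<ge> 1"
  shows "integrable M (\<lambda>\<omega>. u t \<omega> * u q \<omega>)"
    and "expectation (\<lambda>\<omega>. u t \<omega> * u q \<omega>) = (if t = q then vol2_mean t else 0)"
proof -
  let ?A = "\<lambda>e. e t * e q :: real" and ?B = "\<lambda>e. exp (log_vol \<phi> t e / 2) * exp (log_vol \<phi> q e / 2)"
  have A[measurable]: "?A \<in> borel_measurable real_seq"
    using tq by (intro borel_measurable_times measurable_component_singleton) auto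
  have B: "?B \<in> borel_measurable real_seq"
    by measurable
  have "indep_var borel (?A \<circ> (\<lambda>\<omega>. \<lambda>t\<in>{1..}. \<epsilon> t \<omega>)) borel (?B \<circ> (\<lambda>\<omega>. \<lambda>t\<in>{1..}. \<eta> t \<omega>))"
    by (rule indep_var_compose[OF \<epsilon>_\<eta>_indep A B])
  also have "?A \<circ> (\<lambda>\<omega>. \<lambda>t\<in>{1..}. \<epsilon> t \<omega>) = (\<lambda>\<omega>. \<epsilon> t \<omega> * \<epsilon> q \<omega>)"
    using tq by (auto simp: fun_eq_iff)
  also have "?B \<circ> (\<lambda>\<omega>. \<lambda>t\<in>{1..}. \<eta> t \<omega>) = (\<lambda>\<omega>. vol t \<omega> * vol q \<omega>)"
    by (auto simp: fun_eq_iff vol_eq)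
  finally have ind: "indep_var borel (\<lambda>\<omega>. \<epsilon> t \<omega> * \<epsilon> q \<omega>) borel (\<lambda>\<omega>. vol t \<omega> * vol q \<omega>)" .
  have iv: "integrable M (\<lambda>\<omega>. vol t \<omega> * vol q \<omega>)"
  proof (rule Bochner_Integration.integrable_bound[OF Bochner_Integration.integrable_add[OF vol_moment(1)[of t 2] vol_moment(1)[of q 2]]])
    show "AE \<omega> in M. norm (vol t \<omega> * vol q \<omega>) \<le> norm ((vol t \<omega>)\<^sup>2 + (vol q \<omega>)\<^sup>2)"
    proof (intro AE_I2)
      fix \<omega>
      have "2 * (vol t \<omega> * vol q \<omega>) \<le> (vol t \<omega>)\<^sup>2 + (vol q \<omega>)\<^sup>2"
        using sum_squares_bound[of "vol t \<omega>" "vol q \<omega>"] by simp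
      moreover have "0 \<le> vol t \<omega> * vol q \<omega>" using vol_pos by (simp add: less_imp_le)
      ultimately show "norm (vol t \<omega> * vol q \<omega>) \<le> norm ((vol t \<omega>)\<^sup>2 + (vol q \<omega>)\<^sup>2)" by simp
    qed
  qed measurable
  have e: "u t \<omega> * u q \<omega> = (\<epsilon> t \<omega> * \<epsilon> q \<omega>) * (vol t \<omega> * vol q \<omega>)" for \<omega>
    by (simp add: u_def)
  show "integrable M (\<lambda>\<omega>. u t \<omega> * u q \<omega>)"
    unfolding e by (rule indep_var_integrable[OF ind \<epsilon>_product_moment(1)[OF tq] iv])
  show "expectation (\<lambda>\<omega>. u t \<omega> * u q \<omega>) = (if t = q then vol2_mean t else 0)"
    unfolding e indep_var_lebesgue_integral[OF ind \<epsilon>_product_moment(1)[OF tq] iv] \<epsilon>_product_moment(2)[OF tq]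
    using expectation_vol2[of t] by (auto simp: power2_eq_square)
qed

lemma u_lincomb_second_moment:
  fixes w :: "nat \<Rightarrow> real"
  assumes I: "finite I" "I \<subseteq> {1..}"
  shows "integrable M (\<lambda>\<omega>. (\<Sum>t\<in>I. w t * u t \<omega>)\<^sup>2)"
    and "expectation (\<lambda>\<omega>. (\<Sum>t\<in>I. w t * u t \<omega>)\<^sup>2) = (\<Sum>t\<in>I. (w t)\<^sup>2 * vol2_mean t)"
proof -
  have e: "(\<Sum>t\<in>I. w t * u t \<omega>)\<^sup>2 = (\<Sum>t\<in>I. \<Sum>q\<in>I. (w t * w q) * (u t \<omega> * u q \<omega>))" for \<omega>
    unfolding power2_eq_square sum_product by (simp add: mult_ac)
  have int: "integrable M (\<lambda>\<omega>. (w t * w q) * (u t \<omega> * u q \<omega>))" if "t \<in> I" "q \<in> I" for t q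
    using I that by (intro integrable_mult_right u_product_moment(1)) auto
  show "integrable M (\<lambda>\<omega>. (\<Sum>t\<in>I. w t * u t \<omega>)\<^sup>2)"
    unfolding e by (intro Bochner_Integration.integrable_sum int) auto
  have "expectation (\<lambda>\<omega>. (\<Sum>t\<in>I. w t * u t \<omega>)\<^sup>2) = (\<Sum>t\<in>I. \<Sum>q\<in>I. expectation (\<lambda>\<omega>. (w t * w q) * (u t \<omega> * u q \<omega>)))"
    unfolding e by (subst Bochner_Integration.integral_sum, (auto intro!: Bochner_Integration.integrable_sum int)[1],
        intro sum.cong refl Bochner_Integration.integral_sum int)
  also have "\<dots> = (\<Sum>t\<in>I. \<Sum>q\<in>I. if t = q then (w t)\<^sup>2 * vol2_mean t else 0)"
    using I by (intro sum.cong refl) (auto simp: u_product_moment(2) power2_eq_square subset_eq)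
  also have "\<dots> = (\<Sum>t\<in>I. (w t)\<^sup>2 * vol2_mean t)"
    using I by (simp add: sum.delta)
  finally show "expectation (\<lambda>\<omega>. (\<Sum>t\<in>I. w t * u t \<omega>)\<^sup>2) = (\<Sum>t\<in>I. (w t)\<^sup>2 * vol2_mean t)" .
qed

text \<open>
  By independence the law of all innovations is a product measure.  Integrating first over
  \<open>\<epsilon>\<close>, with the volatilities frozen, reduces the claim to \<open>char_weighted_\<epsilon>_sum\<close>; the error is then averaged over
  \<open>\<eta>\<close>.
\<close>

lemma conditional_gaussian_approximation:
  fixes w :: "nat \<Rightarrow> real"
  shows "cmod ((CLINT \<omega>|M. iexp (\<Sum>t=1..n. w t * u t \<omega>)) -
      complex_of_real (expectation (\<lambda>\<omega>. exp (- (\<Sum>t=1..n. (w t)\<^sup>2 * (vol t \<omega>)\<^sup>2) / 2))))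
    \<le> char_const * (\<Sum>t=1..n. \<bar>w t\<bar> ^ 3) * exp (9 * s / 8)"
proof -
  define Eps where "Eps \<omega> = (\<lambda>t\<in>{1..}. \<epsilon> t \<omega>)" for \<omega>
  define Eta where "Eta \<omega> = (\<lambda>t\<in>{1..}. \<eta> t \<omega>)" for \<omega>
  have rv[measurable]: "Eps \<in> measurable M real_seq" "Eta \<in> measurable M real_seq"
    using indep_var_rv1[OF \<epsilon>_\<eta>_indep] indep_var_rv2[OF \<epsilon>_\<eta>_indep]
    unfolding Eps_def[abs_def] Eta_def[abs_def] .
  have prod: "distr M real_seq Eps \<Otimes>\<^sub>M distr M real_seq Eta = distr M (real_seq \<Otimes>\<^sub>M real_seq) (\<lambda>\<omega>. (Eps \<omega>, Eta \<omega>))"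
    using \<epsilon>_\<eta>_indep[unfolded indep_var_distribution_eq] unfolding Eps_def[abs_def] Eta_def[abs_def] by blast
  interpret Pe: prob_space "distr M real_seq Eps" by (rule prob_space_distr[OF rv(1)])
  interpret Ph: prob_space "distr M real_seq Eta" by (rule prob_space_distr[OF rv(2)])
  interpret P: pair_prob_space "distr M real_seq Eps" "distr M real_seq Eta" ..
  define c where "c t g = w t * exp (log_vol \<phi> t g / 2)" for t g
  have c_Eta: "c t (Eta \<omega>) = w t * vol t \<omega>" for t \<omega>
    unfolding c_def Eta_def vol_eq ..
  have [measurable]: "c t \<in> borel_measurable real_seq" for t
    unfolding c_def[abs_def] by measurable
  define F where "F e g = iexp (\<Sum>t=1..n. c t g * e t)" for e g
  have comp[measurable]: "(\<lambda>p. fst p t :: real) \<in> borel_measurable (real_seq \<Otimes>\<^sub>M real_seq)" if "t \<in> {1..n}" for t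
    using that by (intro measurable_compose[OF measurable_fst] measurable_component_singleton) auto
  have F_m: "(\<lambda>(e, g). F e g) \<in> borel_measurable (real_seq \<Otimes>\<^sub>M real_seq)"
  proof -
    have "(\<lambda>p. \<Sum>t=1..n. c t (snd p) * fst p t) \<in> borel_measurable (real_seq \<Otimes>\<^sub>M real_seq)"
      by (intro borel_measurable_sum borel_measurable_times comp) auto
    then show ?thesis
      unfolding F_def split_beta by measurable
  qed
  have F_int: "integrable (distr M real_seq Eps \<Otimes>\<^sub>M distr M real_seq Eta) (\<lambda>(e, g). F e g)"
    by (rule P.integrable_const_bound[where B=1]) (use F_m in \<open>auto simp: F_def split_beta intro!: AE_I2\<close>)
  define J where "J g = (CLINT e|distr M real_seq Eps. F e g)" for g
  have J_eq: "J g = (CLINT \<omega>|M. iexp (\<Sum>t=1..n. c t g * \<epsilon> t \<omega>))" for g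
  proof -
    have "(\<lambda>e. \<Sum>t=1..n. c t g * e t) \<in> borel_measurable real_seq"
      by (intro borel_measurable_sum borel_measurable_times borel_measurable_const measurable_component_singleton) auto
    then have "(\<lambda>e. F e g) \<in> borel_measurable real_seq"
      unfolding F_def by measurable
    then have "J g = (CLINT \<omega>|M. F (Eps \<omega>) g)"
      unfolding J_def by (intro integral_distr) auto
    also have "\<dots> = (CLINT \<omega>|M. iexp (\<Sum>t=1..n. c t g * \<epsilon> t \<omega>))"
      unfolding F_def Eps_def by (intro Bochner_Integration.integral_cong refl arg_cong[where f=iexp] sum.cong) auto
    finally show ?thesis .
  qed
  have J_int: "integrable (distr M real_seq Eta) J"
    unfolding J_def[abs_def] using P.integrable_snd[OF F_int] by simp
  have J_m[measurable]: "J \<in> borel_measurable real_seq"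
    using borel_measurable_integrable[OF J_int] by simp
  have "(CLINT \<omega>|M. iexp (\<Sum>t=1..n. w t * u t \<omega>)) = (CLINT \<omega>|M. (\<lambda>(e, g). F e g) (Eps \<omega>, Eta \<omega>))"
    unfolding F_def prod.case c_Eta u_def Eps_def
    by (intro Bochner_Integration.integral_cong refl arg_cong[where f=iexp] sum.cong) auto
  also have "\<dots> = integral\<^sup>L (distr M (real_seq \<Otimes>\<^sub>M real_seq) (\<lambda>\<omega>. (Eps \<omega>, Eta \<omega>))) (\<lambda>(e, g). F e g)"
    by (rule integral_distr[symmetric]) (use F_m in auto)
  also have "\<dots> = (CLINT g|distr M real_seq Eta. J g)"
    unfolding prod[symmetric] J_def by (rule P.integral_snd[symmetric, OF F_int])
  also have "\<dots> = (CLINT \<omega>|M. J (Eta \<omega>))"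
    by (rule integral_distr) auto
  finally have 1: "(CLINT \<omega>|M. iexp (\<Sum>t=1..n. w t * u t \<omega>)) = (CLINT \<omega>|M. J (Eta \<omega>))" .
  have J_int': "integrable M (\<lambda>\<omega>. J (Eta \<omega>))"
    using J_int by (subst (asm) integrable_distr_eq) auto
  define V where "V \<omega> = exp (- (\<Sum>t=1..n. (w t)\<^sup>2 * (vol t \<omega>)\<^sup>2) / 2)" for \<omega>
  have V_m[measurable]: "V \<in> borel_measurable M"
    unfolding V_def[abs_def] by measurable
  have V_int: "integrable M V"
    by (rule integrable_const_bound[where B=1]) (auto simp: V_def intro!: AE_I2 divide_nonneg_pos sum_nonneg)
  have diff: "cmod (J (Eta \<omega>) - complex_of_real (V \<omega>)) \<le> char_const * (\<Sum>t=1..n. \<bar>w t\<bar> ^ 3 * vol t \<omega> ^ 3)" for \<omega>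
    using char_weighted_\<epsilon>_sum[of "\<lambda>t. c t (Eta \<omega>)" n] vol_pos[of _ \<omega>]
    unfolding J_eq V_def c_Eta by (simp add: power_mult_distrib abs_mult less_imp_le)
  have int3: "integrable M (\<lambda>\<omega>. char_const * (\<Sum>t=1..n. \<bar>w t\<bar> ^ 3 * vol t \<omega> ^ 3))"
    by (intro integrable_mult_right Bochner_Integration.integrable_sum vol_moment(1))
  have "cmod ((CLINT \<omega>|M. J (Eta \<omega>)) - complex_of_real (expectation V)) = cmod (CLINT \<omega>|M. J (Eta \<omega>) - complex_of_real (V \<omega>))"
    using J_int' V_int by (subst Bochner_Integration.integral_diff) auto
  also have "\<dots> \<le> (LINT \<omega>|M. cmod (J (Eta \<omega>) - complex_of_real (V \<omega>)))"
    by (rule integral_norm_bound)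
  also have "\<dots> \<le> expectation (\<lambda>\<omega>. char_const * (\<Sum>t=1..n. \<bar>w t\<bar> ^ 3 * vol t \<omega> ^ 3))"
    using J_int' V_int by (intro integral_mono int3 diff integrable_norm Bochner_Integration.integrable_diff integrable_of_real)
  also have "\<dots> = char_const * (\<Sum>t=1..n. \<bar>w t\<bar> ^ 3 * expectation (\<lambda>\<omega>. vol t \<omega> ^ 3))"
    by (subst integral_mult_right_zero, subst Bochner_Integration.integral_sum)
       (auto intro!: integrable_mult_right vol_moment(1))
  also have "\<dots> \<le> char_const * (\<Sum>t=1..n. \<bar>w t\<bar> ^ 3 * exp (9 * s / 8))"
    using vol_moment(2)[of _ 3] by (intro mult_left_mono sum_mono char_const_nonneg) auto
  finally show ?thesis
    unfolding 1 V_def by (simp add: sum_distrib_right mult_ac)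
qed

end

lemma (in prob_space) expectation_abs_le_sqrt:
  assumes [measurable]: "Z \<in> borel_measurable M" and Z: "integrable M (\<lambda>\<omega>. (Z \<omega>)\<^sup>2)"
  shows "integrable M Z" "expectation (\<lambda>\<omega>. \<bar>Z \<omega>\<bar>) \<le> sqrt (expectation (\<lambda>\<omega>. (Z \<omega>)\<^sup>2))"
proof -
  show "integrable M Z" by (rule square_integrable_imp_integrable[OF _ Z]) simp
  then have i: "integrable M (\<lambda>\<omega>. \<bar>Z \<omega>\<bar>)" by simp
  have "0 \<le> variance (\<lambda>\<omega>. \<bar>Z \<omega>\<bar>)" by (rule variance_positive)
  also have "\<dots> = expectation (\<lambda>\<omega>. (Z \<omega>)\<^sup>2) - (expectation (\<lambda>\<omega>. \<bar>Z \<omega>\<bar>))\<^sup>2"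
    using i Z by (subst variance_eq) auto
  finally show "expectation (\<lambda>\<omega>. \<bar>Z \<omega>\<bar>) \<le> sqrt (expectation (\<lambda>\<omega>. (Z \<omega>)\<^sup>2))"
    by (intro real_le_rsqrt) auto
qed

lemma abs_exp_minus_diff_le:
  fixes x y :: real
  assumes "0 \<le> x" "0 \<le> y"
  shows "\<bar>exp (- x) - exp (- y)\<bar> \<le> \<bar>x - y\<bar>"
proof -
  have *: "exp (- x) - exp (- y) \<le> y - x" if "0 \<le> x" "x \<le> y" for x y :: real
  proof -
    have "exp (- x) * (1 - exp (- (y - x))) \<le> 1 * (1 - exp (- (y - x)))"
      using that by (intro mult_right_mono) auto
    also have "\<dots> \<le> y - x"
      using exp_ge_add_one_self[of "- (y - x)"] unfolding mult_1 by linarith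
    also have "exp (- x) * (1 - exp (- (y - x))) = exp (- x) - exp (- y)"
      by (simp add: algebra_simps exp_add[symmetric])
    finally show ?thesis .
  qed
  show ?thesis
  proof (cases "x \<le> y")
    case True
    with *[of x y] assms show ?thesis by simp
  next
    case False
    with *[of y x] assms show ?thesis by simp
  qed
qed

lemma sum_geometric_two_sided_le:
  fixes p :: real
  assumes "0 \<le> p" "p < 1"
  shows "(\<Sum>t=1..n. p ^ ((t - q) + (q - t))) \<le> 2 / (1 - p)"
proof -
  have geo: "(\<Sum>i\<in>I. p ^ i) \<le> 1 / (1 - p)" if "finite I" for I
  proof -
    have "(\<Sum>i\<in>I. p ^ i) \<le> (\<Sum>i. p ^ i)"
      using assms that by (intro sum_le_suminf summable_geometric) auto
    then show ?thesis using assms by (simp add: suminf_geometric)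
  qed
  have "(\<Sum>t=1..n. p ^ ((t - q) + (q - t))) = (\<Sum>t\<in>{1..n} \<inter> {..q}. p ^ (q - t)) + (\<Sum>t\<in>{1..n} - {..q}. p ^ (t - q))"
    by (subst sum.Int_Diff[of _ _ "{..q}"]) (auto intro!: arg_cong2[where f=plus] sum.cong)
  also have "(\<Sum>t\<in>{1..n} \<inter> {..q}. p ^ (q - t)) = (\<Sum>i\<in>(\<lambda>t. q - t) ` ({1..n} \<inter> {..q}). p ^ i)"
    by (subst sum.reindex) (auto simp: inj_on_def)
  also have "(\<Sum>t\<in>{1..n} - {..q}. p ^ (t - q)) = (\<Sum>i\<in>(\<lambda>t. t - q) ` ({1..n} - {..q}). p ^ i)"
    by (subst sum.reindex) (auto simp: inj_on_def)
  also have "(\<Sum>i\<in>(\<lambda>t. q - t) ` ({1..n} \<inter> {..q}). p ^ i) + (\<Sum>i\<in>(\<lambda>t. t - q) ` ({1..n} - {..q}). p ^ i) \<le> 1 / (1 - p) + 1 / (1 - p)"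
    by (intro add_mono geo) auto
  finally show ?thesis by simp
qed

context sv_volatility
begin

definition cond_var :: "nat \<Rightarrow> (nat \<Rightarrow> real) \<Rightarrow> 'a \<Rightarrow> real" where
  "cond_var n w \<omega> = (\<Sum>t=1..n. (w t)\<^sup>2 * (vol t \<omega>)\<^sup>2)"

lemma cond_var_measurable[measurable]: "cond_var n w \<in> borel_measurable M"
  unfolding cond_var_def[abs_def] by measurable

lemma cond_var_nonneg: "0 \<le> cond_var n w \<omega>"
  unfolding cond_var_def by (intro sum_nonneg) auto

lemma expectation_cond_var:
  "integrable M (cond_var n w)"
  "expectation (cond_var n w) = (\<Sum>t=1..n. (w t)\<^sup>2 * vol2_mean t)"
proof -
  have i: "integrable M (\<lambda>\<omega>. (w t)\<^sup>2 * (vol t \<omega>)\<^sup>2)" for t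
    by (intro integrable_mult_right vol_moment(1))
  show "integrable M (cond_var n w)"
    unfolding cond_var_def[abs_def] by (intro Bochner_Integration.integrable_sum i)
  show "expectation (cond_var n w) = (\<Sum>t=1..n. (w t)\<^sup>2 * vol2_mean t)"
    unfolding cond_var_def[abs_def]
    using i by (subst Bochner_Integration.integral_sum) (simp_all add: expectation_vol2)
qed

lemma inverse_gap_le: "1 / (1 - \<bar>\<phi>\<bar>) \<le> 2 * s / \<alpha>\<^sup>2"
proof -
  have "1 - \<phi>\<^sup>2 = (1 - \<bar>\<phi>\<bar>) * (1 + \<bar>\<phi>\<bar>)"
    by (simp add: algebra_simps power2_eq_square)
  also have "\<dots> \<le> (1 - \<bar>\<phi>\<bar>) * 2"
    using \<phi>_stable by (intro mult_left_mono) auto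
  finally have "1 - \<phi>\<^sup>2 \<le> 2 * (1 - \<bar>\<phi>\<bar>)" by simp
  then have "1 / (1 - \<bar>\<phi>\<bar>) \<le> 2 / (1 - \<phi>\<^sup>2)"
    using \<phi>_stable \<phi>2 by (simp add: field_simps)
  also have "2 / (1 - \<phi>\<^sup>2) = 2 * s / \<alpha>\<^sup>2"
    using \<alpha>_pos by (simp add: s_def)
  finally show ?thesis .
qed

text \<open>
  The variance of the conditional variance is a double sum of covariances with geometric decay;
  one weight is bounded uniformly and the other one is summed.
\<close>

lemma cond_var_deviation:
  assumes W: "\<And>t. t \<in> {1..n} \<Longrightarrow> (w t)\<^sup>2 \<le> W" "0 \<le> W"
    and A: "(\<Sum>t=1..n. (w t)\<^sup>2) \<le> A"
  shows "expectation (\<lambda>\<omega>. \<bar>cond_var n w \<omega> - expectation (cond_var n w)\<bar>)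
    \<le> sqrt (4 * stat_mean\<^sup>2 * s\<^sup>2 * exp s * W * A / \<alpha>\<^sup>2)"
proof -
  let ?V = "cond_var n w"
  have e: "(?V \<omega>)\<^sup>2 = (\<Sum>t=1..n. \<Sum>q=1..n. ((w t)\<^sup>2 * (w q)\<^sup>2) * ((vol t \<omega>)\<^sup>2 * (vol q \<omega>)\<^sup>2))" for \<omega>
    unfolding cond_var_def power2_eq_square[of "sum _ _"] sum_product by (simp add: mult_ac)
  have i: "integrable M (\<lambda>\<omega>. ((w t)\<^sup>2 * (w q)\<^sup>2) * ((vol t \<omega>)\<^sup>2 * (vol q \<omega>)\<^sup>2))" for t q
    by (intro integrable_mult_right vol2_product_integrable)
  have V2: "integrable M (\<lambda>\<omega>. (?V \<omega>)\<^sup>2)"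
    unfolding e by (intro Bochner_Integration.integrable_sum i)
  have EV2: "expectation (\<lambda>\<omega>. (?V \<omega>)\<^sup>2) = (\<Sum>t=1..n. \<Sum>q=1..n. ((w t)\<^sup>2 * (w q)\<^sup>2) * expectation (\<lambda>\<omega>. (vol t \<omega>)\<^sup>2 * (vol q \<omega>)\<^sup>2))"
  proof -
    have "expectation (\<lambda>\<omega>. (?V \<omega>)\<^sup>2) = (\<Sum>t=1..n. expectation (\<lambda>\<omega>. \<Sum>q=1..n. ((w t)\<^sup>2 * (w q)\<^sup>2) * ((vol t \<omega>)\<^sup>2 * (vol q \<omega>)\<^sup>2)))"
      unfolding e by (intro Bochner_Integration.integral_sum Bochner_Integration.integrable_sum i)
    also have "\<dots> = (\<Sum>t=1..n. \<Sum>q=1..n. expectation (\<lambda>\<omega>. ((w t)\<^sup>2 * (w q)\<^sup>2) * ((vol t \<omega>)\<^sup>2 * (vol q \<omega>)\<^sup>2)))"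
      by (intro sum.cong refl Bochner_Integration.integral_sum i)
    finally show ?thesis by simp
  qed
  have EEV: "(expectation ?V)\<^sup>2 = (\<Sum>t=1..n. \<Sum>q=1..n. ((w t)\<^sup>2 * (w q)\<^sup>2) * (vol2_mean t * vol2_mean q))"
    unfolding expectation_cond_var(2) power2_eq_square[of "sum _ _"] sum_product by (simp add: mult_ac)
  define D where "D = stat_mean\<^sup>2 * s * exp s"
  have D: "0 \<le> D" unfolding D_def using s_pos by simp
  have "variance ?V = expectation (\<lambda>\<omega>. (?V \<omega>)\<^sup>2) - (expectation ?V)\<^sup>2"
    by (rule variance_eq[OF expectation_cond_var(1) V2])
  also have "\<dots> = (\<Sum>t=1..n. \<Sum>q=1..n. ((w t)\<^sup>2 * (w q)\<^sup>2) * (expectation (\<lambda>\<omega>. (vol t \<omega>)\<^sup>2 * (vol q \<omega>)\<^sup>2) - vol2_mean t * vol2_mean q))"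
    unfolding EV2 EEV sum_subtractf[symmetric] by (simp add: right_diff_distrib)
  also have "\<dots> \<le> (\<Sum>t=1..n. \<Sum>q=1..n. ((w t)\<^sup>2 * W) * (D * \<bar>\<phi>\<bar> ^ ((q - t) + (t - q))))"
  proof (intro sum_mono)
    fix t q assume tq: "t \<in> {1..n}" "q \<in> {1..n}"
    have "((w t)\<^sup>2 * (w q)\<^sup>2) * (expectation (\<lambda>\<omega>. (vol t \<omega>)\<^sup>2 * (vol q \<omega>)\<^sup>2) - vol2_mean t * vol2_mean q)
        \<le> ((w t)\<^sup>2 * (w q)\<^sup>2) * (D * \<bar>\<phi>\<bar> ^ ((q - t) + (t - q)))"
      using vol2_covariance_le[of t q] unfolding D_def by (intro mult_left_mono) auto
    also have "\<dots> \<le> ((w t)\<^sup>2 * W) * (D * \<bar>\<phi>\<bar> ^ ((q - t) + (t - q)))"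
      using D W(1)[OF tq(2)] by (intro mult_right_mono mult_left_mono) auto
    finally show "((w t)\<^sup>2 * (w q)\<^sup>2) * (expectation (\<lambda>\<omega>. (vol t \<omega>)\<^sup>2 * (vol q \<omega>)\<^sup>2) - vol2_mean t * vol2_mean q)
      \<le> ((w t)\<^sup>2 * W) * (D * \<bar>\<phi>\<bar> ^ ((q - t) + (t - q)))" .
  qed
  also have "\<dots> = (\<Sum>t=1..n. ((w t)\<^sup>2 * W * D) * (\<Sum>q=1..n. \<bar>\<phi>\<bar> ^ ((q - t) + (t - q))))"
    by (simp add: sum_distrib_left mult_ac)
  also have "\<dots> \<le> (\<Sum>t=1..n. ((w t)\<^sup>2 * W * D) * (2 / (1 - \<bar>\<phi>\<bar>)))"
    using D W \<phi>_stable by (intro sum_mono mult_left_mono sum_geometric_two_sided_le) auto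
  also have "\<dots> = (\<Sum>t=1..n. (w t)\<^sup>2) * (W * D * (2 / (1 - \<bar>\<phi>\<bar>)))"
    by (simp only: sum_distrib_right mult.assoc)
  also have "\<dots> \<le> A * (W * D * (2 * (2 * s / \<alpha>\<^sup>2)))"
  proof (intro mult_mono A mult_left_mono)
    show "2 / (1 - \<bar>\<phi>\<bar>) \<le> 2 * (2 * s / \<alpha>\<^sup>2)" using inverse_gap_le by simp
    show "0 \<le> A" using A by (rule order_trans[rotated]) (auto intro: sum_nonneg)
  qed (use D W \<phi>_stable in auto)
  also have "\<dots> = 4 * stat_mean\<^sup>2 * s\<^sup>2 * exp s * W * A / \<alpha>\<^sup>2"
    unfolding D_def by (simp add: power2_eq_square)
  finally have var: "variance ?V \<le> 4 * stat_mean\<^sup>2 * s\<^sup>2 * exp s * W * A / \<alpha>\<^sup>2" .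
  have "expectation (\<lambda>\<omega>. \<bar>?V \<omega> - expectation ?V\<bar>) \<le> sqrt (variance ?V)"
  proof (rule expectation_abs_le_sqrt(2))
    have "integrable M (\<lambda>\<omega>. (?V \<omega>)\<^sup>2 - 2 * expectation ?V * ?V \<omega> + (expectation ?V)\<^sup>2)"
      using V2 expectation_cond_var(1)[of n w] by simp
    then show "integrable M (\<lambda>\<omega>. (?V \<omega> - expectation ?V)\<^sup>2)"
      by (simp add: power2_diff algebra_simps)
  qed measurable
  also have "\<dots> \<le> sqrt (4 * stat_mean\<^sup>2 * s\<^sup>2 * exp s * W * A / \<alpha>\<^sup>2)"
    using var by simp
  finally show ?thesis .
qed

text \<open>
  Replaces the random conditional variance by the constant \<open>\<theta>\<close>, using that \<open>x \<mapsto> exp (- x)\<close> is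
  a contraction on the nonnegative half-line.
\<close>

lemma gaussian_approximation:
  assumes W: "\<And>t. t \<in> {1..n} \<Longrightarrow> \<bar>w t\<bar> \<le> W" "0 \<le> W"
    and A: "(\<Sum>t=1..n. (w t)\<^sup>2) \<le> A" and \<theta>: "0 \<le> \<theta>"
  shows "cmod ((CLINT \<omega>|M. iexp (\<Sum>t=1..n. w t * u t \<omega>)) - complex_of_real (exp (- \<theta> / 2)))
    \<le> char_const * (W * A) * exp (9 * s / 8)
      + (\<bar>(\<Sum>t=1..n. (w t)\<^sup>2 * vol2_mean t) - \<theta>\<bar> + sqrt (4 * stat_mean\<^sup>2 * s\<^sup>2 * exp s * W\<^sup>2 * A / \<alpha>\<^sup>2)) / 2"
proof -
  let ?V = "cond_var n w"
  let ?E = "expectation (\<lambda>\<omega>. exp (- ?V \<omega> / 2))"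
  have cube: "(\<Sum>t=1..n. \<bar>w t\<bar> ^ 3) \<le> W * A"
  proof -
    have "(\<Sum>t=1..n. \<bar>w t\<bar> ^ 3) \<le> (\<Sum>t=1..n. W * (w t)\<^sup>2)"
    proof (intro sum_mono)
      fix t assume "t \<in> {1..n}"
      then have "\<bar>w t\<bar> * (w t)\<^sup>2 \<le> W * (w t)\<^sup>2" by (intro mult_right_mono W) auto
      then show "\<bar>w t\<bar> ^ 3 \<le> W * (w t)\<^sup>2" by (simp add: power3_eq_cube power2_eq_square mult.assoc)
    qed
    also have "\<dots> = W * (\<Sum>t=1..n. (w t)\<^sup>2)" by (simp add: sum_distrib_left)
    also have "\<dots> \<le> W * A" using W A by (intro mult_left_mono) auto
    finally show ?thesis .
  qed
  have 1: "cmod ((CLINT \<omega>|M. iexp (\<Sum>t=1..n. w t * u t \<omega>)) - complex_of_real ?E) \<le> char_const * (W * A) * exp (9 * s / 8)"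
    using conditional_gaussian_approximation[of w n] cube char_const_nonneg
    unfolding cond_var_def by (elim order_trans) (intro mult_right_mono mult_left_mono, auto)
  have iV: "integrable M (\<lambda>\<omega>. exp (- ?V \<omega> / 2))"
    by (rule integrable_const_bound[where B=1]) (auto intro!: AE_I2 cond_var_nonneg)
  have id: "integrable M (\<lambda>\<omega>. ?V \<omega> - expectation ?V)"
    using expectation_cond_var(1)[of n w] by simp
  have "\<bar>?E - exp (- \<theta> / 2)\<bar> = \<bar>expectation (\<lambda>\<omega>. exp (- ?V \<omega> / 2) - exp (- \<theta> / 2))\<bar>"
    using iV by (simp add: prob_space)
  also have "\<dots> \<le> expectation (\<lambda>\<omega>. \<bar>exp (- ?V \<omega> / 2) - exp (- \<theta> / 2)\<bar>)"
    by (rule integral_abs_bound)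
  also have "\<dots> \<le> expectation (\<lambda>\<omega>. (\<bar>?V \<omega> - expectation ?V\<bar> + \<bar>expectation ?V - \<theta>\<bar>) / 2)"
  proof (rule integral_mono)
    fix \<omega>
    have "\<bar>exp (- ?V \<omega> / 2) - exp (- \<theta> / 2)\<bar> \<le> \<bar>?V \<omega> / 2 - \<theta> / 2\<bar>"
      using abs_exp_minus_diff_le[of "?V \<omega> / 2" "\<theta> / 2"] cond_var_nonneg \<theta> by simp
    also have "\<dots> \<le> (\<bar>?V \<omega> - expectation ?V\<bar> + \<bar>expectation ?V - \<theta>\<bar>) / 2"
    proof -
      have "\<bar>?V \<omega> / 2 - \<theta> / 2\<bar> = \<bar>?V \<omega> - \<theta>\<bar> / 2"
        by (simp add: diff_divide_distrib[symmetric])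
      moreover have "\<bar>?V \<omega> - \<theta>\<bar> \<le> \<bar>?V \<omega> - expectation ?V\<bar> + \<bar>expectation ?V - \<theta>\<bar>"
        by linarith
      ultimately show ?thesis by simp
    qed
    finally show "\<bar>exp (- ?V \<omega> / 2) - exp (- \<theta> / 2)\<bar> \<le> (\<bar>?V \<omega> - expectation ?V\<bar> + \<bar>expectation ?V - \<theta>\<bar>) / 2" .
  qed (use iV id in auto)
  also have "\<dots> = (expectation (\<lambda>\<omega>. \<bar>?V \<omega> - expectation ?V\<bar>) + \<bar>expectation ?V - \<theta>\<bar>) / 2"
    using id by (simp add: prob_space)
  also have "\<dots> \<le> (\<bar>(\<Sum>t=1..n. (w t)\<^sup>2 * vol2_mean t) - \<theta>\<bar> + sqrt (4 * stat_mean\<^sup>2 * s\<^sup>2 * exp s * W\<^sup>2 * A / \<alpha>\<^sup>2)) / 2"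
  proof -
    have "(w t)\<^sup>2 \<le> W\<^sup>2" if "t \<in> {1..n}" for t
      using power_mono[OF W(1)[OF that], of 2] by simp
    from cond_var_deviation[OF this _ A] show ?thesis
      unfolding expectation_cond_var(2) by simp
  qed
  finally have 2: "cmod (complex_of_real ?E - complex_of_real (exp (- \<theta> / 2))) \<le> (\<bar>(\<Sum>t=1..n. (w t)\<^sup>2 * vol2_mean t) - \<theta>\<bar> + sqrt (4 * stat_mean\<^sup>2 * s\<^sup>2 * exp s * W\<^sup>2 * A / \<alpha>\<^sup>2)) / 2"
    by (simp del: of_real_exp of_real_diff flip: of_real_diff)
  show ?thesis
    by (rule norm_diff_triangle_le[OF 1 2])
qed

end

section \<open>Algebra of the explosive autoregression\<close>

text \<open>
  The solution of \<open>C\<^sub>t = C\<^sub>t\<^sub>-\<^sub>1 / \<rho> + u\<^sub>t\<close>: the backward counterpart of the autoregression, in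
  which recent shocks dominate.
\<close>

definition discounted :: "real \<Rightarrow> (nat \<Rightarrow> real) \<Rightarrow> nat \<Rightarrow> real" where
  "discounted \<rho> u n = (\<Sum>t=1..n. u t / \<rho> ^ (n - t))"

lemma discounted_0 [simp]: "discounted \<rho> u 0 = 0"
  unfolding discounted_def by simp

lemma discounted_Suc:
  assumes "\<rho> \<noteq> 0"
  shows "discounted \<rho> u (Suc n) = discounted \<rho> u n / \<rho> + u (Suc n)"
proof -
  have "discounted \<rho> u (Suc n) = (\<Sum>t=1..n. u t / \<rho> ^ (Suc n - t)) + u (Suc n)"
    unfolding discounted_def by simp
  also have "(\<Sum>t=1..n. u t / \<rho> ^ (Suc n - t)) = (\<Sum>t=1..n. u t / \<rho> ^ (n - t) / \<rho>)"
    using assms by (intro sum.cong refl) (auto simp: Suc_diff_le mult.commute)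
  finally show ?thesis
    by (simp add: discounted_def sum_divide_distrib)
qed

lemma ar1_solution:
  fixes y u :: "nat \<Rightarrow> real"
  assumes y: "\<And>t. 1 \<le> t \<Longrightarrow> t \<le> n \<Longrightarrow> y t = \<rho> * y (t - 1) + u t" and \<rho>: "\<rho> \<noteq> 0"
  shows "m \<le> n \<Longrightarrow> y m = \<rho> ^ m * (y 0 + (\<Sum>t=1..m. u t / \<rho> ^ t))"
proof (induction m)
  case (Suc m)
  then have "y (Suc m) = \<rho> * (\<rho> ^ m * (y 0 + (\<Sum>t=1..m. u t / \<rho> ^ t))) + u (Suc m)"
    using y[of "Suc m"] by simp
  then show ?case using \<rho> by (simp add: algebra_simps)
qed simp

text \<open>
  Up to the factor \<open>\<rho>\<close>, \<open>discounted \<rho> u m\<close> is the sum of late shocks, so the leading term is the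
  product of the explosive endpoint with the late shocks.
\<close>

lemma ar1_score:
  fixes y u :: "nat \<Rightarrow> real"
  assumes y: "\<And>t. 1 \<le> t \<Longrightarrow> t \<le> n \<Longrightarrow> y t = \<rho> * y (t - 1) + u t" and \<rho>: "\<rho> \<noteq> 0"
  shows "m \<le> n \<Longrightarrow> \<rho> * (\<Sum>t=1..m. y (t - 1) * u t) = y m * discounted \<rho> u m - (\<Sum>t=1..m. u t * discounted \<rho> u t)"
proof (induction m)
  case (Suc m)
  let ?C = "discounted \<rho> u"
  have C: "\<rho> * ?C (Suc m) = ?C m + \<rho> * u (Suc m)"
    unfolding discounted_Suc[OF \<rho>] using \<rho> by (simp add: algebra_simps)
  have "\<rho> * (\<Sum>t=1..Suc m. y (t - 1) * u t) = y m * ?C m - (\<Sum>t=1..m. u t * ?C t) + \<rho> * (y m * u (Suc m))"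
    using Suc by (simp add: distrib_left)
  also have "\<dots> = y m * (\<rho> * ?C (Suc m)) - (\<Sum>t=1..m. u t * ?C t)"
    unfolding C by (simp add: algebra_simps)
  also have "\<dots> = y (Suc m) * ?C (Suc m) - (\<Sum>t=1..Suc m. u t * ?C t)"
    using y[of "Suc m"] Suc.prems by (simp add: algebra_simps)
  finally show ?case .
qed simp

text \<open>
  The point is that the right-hand side contains only squares: the remainder in \<open>ar1_score\<close> is
  nonnegative, and its mean needs nothing but second moments of the shocks.
\<close>

lemma discounted_score:
  assumes \<rho>: "\<rho> \<noteq> 0"
  shows "2 * (\<Sum>t=1..n. u t * discounted \<rho> u t) =
    (1 - 1 / \<rho>\<^sup>2) * (\<Sum>t=1..n. (discounted \<rho> u t)\<^sup>2) + (discounted \<rho> u n)\<^sup>2 / \<rho>\<^sup>2 + (\<Sum>t=1..n. (u t)\<^sup>2)"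
proof (induction n)
  case (Suc n)
  let ?C = "discounted \<rho> u"
  have "?C n = \<rho> * (?C (Suc n) - u (Suc n))"
    unfolding discounted_Suc[OF \<rho>] using \<rho> by simp
  then have "(?C n)\<^sup>2 / \<rho>\<^sup>2 = (?C (Suc n) - u (Suc n))\<^sup>2"
    using \<rho> by (simp add: power_mult_distrib)
  then have "2 * (u (Suc n) * ?C (Suc n)) = (?C (Suc n))\<^sup>2 - (?C n)\<^sup>2 / \<rho>\<^sup>2 + (u (Suc n))\<^sup>2"
    by (simp add: power2_diff)
  with Suc show ?case by (simp add: algebra_simps)
qed simp

text \<open>
  Summing the squared recursion telescopes.
\<close>

lemma ar1_energy:
  fixes y u :: "nat \<Rightarrow> real"
  assumes y: "\<And>t. 1 \<le> t \<Longrightarrow> t \<le> n \<Longrightarrow> y t = \<rho> * y (t - 1) + u t"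
  shows "m \<le> n \<Longrightarrow> (\<rho>\<^sup>2 - 1) * (\<Sum>t=1..m. (y (t - 1))\<^sup>2) =
    (y m)\<^sup>2 - (y 0)\<^sup>2 - 2 * \<rho> * (\<Sum>t=1..m. y (t - 1) * u t) - (\<Sum>t=1..m. (u t)\<^sup>2)"
proof (induction m)
  case (Suc m)
  have "(y (Suc m))\<^sup>2 = \<rho>\<^sup>2 * (y m)\<^sup>2 + 2 * \<rho> * (y m * u (Suc m)) + (u (Suc m))\<^sup>2"
    using y[of "Suc m"] Suc.prems by (simp add: power2_sum power_mult_distrib)
  with Suc show ?case by (simp add: algebra_simps)
qed simp

lemma ar1_least_squares:
  fixes y u :: "nat \<Rightarrow> real"
  assumes y: "\<And>t. 1 \<le> t \<Longrightarrow> t \<le> n \<Longrightarrow> y t = \<rho> * y (t - 1) + u t"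
    and nz: "(\<Sum>t=1..n. (y (t - 1))\<^sup>2) \<noteq> 0"
  shows "least_squares_ar1 n y = \<rho> + (\<Sum>t=1..n. y (t - 1) * u t) / (\<Sum>t=1..n. (y (t - 1))\<^sup>2)"
proof -
  have "(\<Sum>t=1..n. y (t - 1) * y t) = (\<Sum>t=1..n. \<rho> * (y (t - 1))\<^sup>2 + y (t - 1) * u t)"
    by (intro sum.cong refl) (auto simp: y power2_eq_square algebra_simps)
  also have "\<dots> = \<rho> * (\<Sum>t=1..n. (y (t - 1))\<^sup>2) + (\<Sum>t=1..n. y (t - 1) * u t)"
    by (simp add: sum.distrib sum_distrib_left)
  finally show ?thesis
    unfolding least_squares_ar1_def using nz by (simp add: add_divide_distrib)
qed

lemma sum_inverse_powers_sq:
  assumes "\<rho> \<noteq> (0::real)"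
  shows "(\<rho>\<^sup>2 - 1) * (\<Sum>t=1..n. (1 / \<rho> ^ t)\<^sup>2) = 1 - 1 / (\<rho> ^ n)\<^sup>2"
proof (induction n)
  case (Suc n)
  have "(\<rho>\<^sup>2 - 1) * (1 / \<rho> ^ Suc n)\<^sup>2 = 1 / (\<rho> ^ n)\<^sup>2 - 1 / (\<rho> ^ Suc n)\<^sup>2"
    using assms by (simp add: power_divide field_simps power2_eq_square)
  with Suc show ?case by (simp add: distrib_left)
qed simp

lemma sum_reverse_1:
  fixes f :: "nat \<Rightarrow> real"
  shows "(\<Sum>t=1..n. f (n + 1 - t)) = (\<Sum>t=1..n. f t)"
  by (rule sum.reindex_bij_witness[where i="\<lambda>t. n + 1 - t" and j="\<lambda>t. n + 1 - t"]) (auto simp: One_nat_def)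

section \<open>Early and late shocks\<close>

locale sv_explosive = sv_volatility +
  fixes \<rho> :: real
  assumes \<rho>_gt_1: "\<rho> > 1"
begin

definition \<kappa> :: real where "\<kappa> = \<rho>\<^sup>2 - 1"

text \<open>
  The asymptotic standard deviation of the sum of early shocks and of the sum of late shocks.
\<close>

definition scale :: real where "scale = sqrt (stat_mean / \<kappa>)"

text \<open>
  The two standardised sums whose quotient governs the estimation error: shocks weighted by
  their lasting effect on the path, and shocks weighted by their recency.
\<close>

definition early :: "nat \<Rightarrow> 'a \<Rightarrow> real" where
  "early n \<omega> = (\<Sum>t=1..n. 1 / \<rho> ^ t * u t \<omega>) / scale"

definition late :: "nat \<Rightarrow> 'a \<Rightarrow> real" where
  "late n \<omega> = (\<Sum>t=1..n. 1 / \<rho> ^ (n + 1 - t) * u t \<omega>) / scale"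

lemma \<kappa>_pos: "\<kappa> > 0"
  unfolding \<kappa>_def using \<rho>_gt_1 one_less_power[of \<rho> 2] by simp

lemma scale_pos: "scale > 0"
  unfolding scale_def using \<kappa>_pos stat_mean_ge_1 by simp

lemma scale2: "scale\<^sup>2 = stat_mean / \<kappa>"
  unfolding scale_def using \<kappa>_pos stat_mean_ge_1 by simp

lemma inverse_scale_le: "1 / scale \<le> sqrt \<kappa>"
proof -
  have "(1 / scale)\<^sup>2 = \<kappa> / stat_mean" by (simp add: power_divide scale2)
  also have "\<dots> \<le> \<kappa>" using stat_mean_ge_1 \<kappa>_pos by (simp add: field_simps)
  finally show ?thesis by (rule real_le_rsqrt)
qed

lemma early_measurable[measurable]: "early n \<in> borel_measurable M"
  unfolding early_def[abs_def]
  by (intro borel_measurable_divide borel_measurable_sum borel_measurable_times borel_measurable_const u_measurable) auto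

lemma late_measurable[measurable]: "late n \<in> borel_measurable M"
  unfolding late_def[abs_def]
  by (intro borel_measurable_divide borel_measurable_sum borel_measurable_times borel_measurable_const u_measurable) auto

lemma sum_sq_early: "\<kappa> * (\<Sum>t=1..n. (1 / \<rho> ^ t)\<^sup>2) = 1 - 1 / (\<rho> ^ n)\<^sup>2"
  unfolding \<kappa>_def using \<rho>_gt_1 by (intro sum_inverse_powers_sq) auto

lemma sum_sq_late: "\<kappa> * (\<Sum>t=1..n. (1 / \<rho> ^ (n + 1 - t))\<^sup>2) = 1 - 1 / (\<rho> ^ n)\<^sup>2"
  using sum_sq_early sum_reverse_1[of "\<lambda>t. (1 / \<rho> ^ t)\<^sup>2" n] by simp

lemma second_moment_le_1:
  assumes "\<kappa> * (\<Sum>t=1..n. (g t)\<^sup>2) \<le> 1"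
  shows "integrable M (\<lambda>\<omega>. ((\<Sum>t=1..n. g t * u t \<omega>) / scale)\<^sup>2)"
    and "expectation (\<lambda>\<omega>. ((\<Sum>t=1..n. g t * u t \<omega>) / scale)\<^sup>2) \<le> 1"
proof -
  note m = u_lincomb_second_moment[of "{1..n}" g]
  show "integrable M (\<lambda>\<omega>. ((\<Sum>t=1..n. g t * u t \<omega>) / scale)\<^sup>2)"
    using m(1) by (simp add: power_divide)
  have "expectation (\<lambda>\<omega>. ((\<Sum>t=1..n. g t * u t \<omega>) / scale)\<^sup>2) = (\<Sum>t=1..n. (g t)\<^sup>2 * vol2_mean t) / scale\<^sup>2"
    using m(2) by (simp add: power_divide)
  also have "\<dots> \<le> (\<Sum>t=1..n. (g t)\<^sup>2 * stat_mean) / scale\<^sup>2"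
    by (intro divide_right_mono sum_mono mult_left_mono vol2_mean_le) auto
  also have "\<dots> = \<kappa> * (\<Sum>t=1..n. (g t)\<^sup>2)"
    using stat_mean_ge_1 \<kappa>_pos by (simp add: scale2 sum_distrib_right[symmetric])
  finally show "expectation (\<lambda>\<omega>. ((\<Sum>t=1..n. g t * u t \<omega>) / scale)\<^sup>2) \<le> 1"
    using assms by simp
qed

lemma early_second_moment: "integrable M (\<lambda>\<omega>. (early n \<omega>)\<^sup>2)" "expectation (\<lambda>\<omega>. (early n \<omega>)\<^sup>2) \<le> 1"
  unfolding early_def by (intro second_moment_le_1; unfold sum_sq_early; simp)+

lemma late_second_moment: "integrable M (\<lambda>\<omega>. (late n \<omega>)\<^sup>2)" "expectation (\<lambda>\<omega>. (late n \<omega>)\<^sup>2) \<le> 1"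
  unfolding late_def by (intro second_moment_le_1; unfold sum_sq_late; simp)+

text \<open>
  The three summands bound the third-moment error of the conditional approximation, the bias of
  the mean conditional variance and its random fluctuation.
\<close>

definition clt_error :: "real \<Rightarrow> real \<Rightarrow> nat \<Rightarrow> real" where
  "clt_error a b n =
    char_const * ((\<bar>a\<bar> + \<bar>b\<bar>) * sqrt \<kappa> * (2 * (a\<^sup>2 + b\<^sup>2))) * exp (9 * s / 8)
    + (((a\<^sup>2 + b\<^sup>2) / (\<rho> ^ n)\<^sup>2 + 2 * \<bar>a * b\<bar> * (\<kappa> * n / \<rho> ^ n) + \<kappa> * (\<bar>a\<bar> + \<bar>b\<bar>)\<^sup>2 * (s\<^sup>2 / (2 * \<alpha>\<^sup>2)))
       + sqrt (4 * stat_mean\<^sup>2 * s\<^sup>2 * exp s * ((\<bar>a\<bar> + \<bar>b\<bar>) * sqrt \<kappa>)\<^sup>2 * (2 * (a\<^sup>2 + b\<^sup>2)) / \<alpha>\<^sup>2)) / 2"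

lemma sum_phi_le: "(\<Sum>t=1..n. (\<phi>\<^sup>2) ^ t) \<le> s / \<alpha>\<^sup>2"
proof -
  have "(\<Sum>t=1..n. (\<phi>\<^sup>2) ^ t) \<le> (\<Sum>t. (\<phi>\<^sup>2) ^ t)"
    using \<phi>2 by (intro sum_le_suminf summable_geometric) auto
  also have "\<dots> = s / \<alpha>\<^sup>2"
    using \<phi>2 \<alpha>_pos by (subst suminf_geometric) (auto simp: s_def)
  finally show ?thesis .
qed

text \<open>
  The weights are \<open>g t / scale\<close> with \<open>g t = a / \<rho>\<^sup>t + b / \<rho>\<^sup>(\<^sup>n\<^sup>+\<^sup>1\<^sup>-\<^sup>t\<^sup>)\<close>.  The sum of \<open>(g t)\<^sup>2\<close> is
  nearly \<open>(a\<^sup>2 + b\<^sup>2) / \<kappa>\<close> since the two geometric parts overlap only in a term of order \<open>n / \<rho>\<^sup>n\<close>; this is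
  the reason for the asymptotic independence of early and late shocks.
\<close>

lemma char_early_late:
  "cmod ((CLINT \<omega>|M. iexp (a * early n \<omega> + b * late n \<omega>)) - complex_of_real (exp (- (a\<^sup>2 + b\<^sup>2) / 2))) \<le> clt_error a b n"
proof -
  define p where "p t = 1 / \<rho> ^ t" for t
  define q where "q t = 1 / \<rho> ^ (n + 1 - t)" for t
  define g where "g t = a * p t + b * q t" for t
  define L where "L = \<bar>a\<bar> + \<bar>b\<bar>"
  define w where "w t = g t / scale" for t
  define \<theta> where "\<theta> = a\<^sup>2 + b\<^sup>2"
  have pq: "0 \<le> p t" "p t \<le> 1" "0 \<le> q t" "q t \<le> 1" for t
    using \<rho>_gt_1 by (auto simp: p_def q_def)
  have L0: "0 \<le> L" by (simp add: L_def)
  have gL: "\<bar>g t\<bar> \<le> L" for t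
  proof -
    have "\<bar>g t\<bar> \<le> \<bar>a\<bar> * p t + \<bar>b\<bar> * q t"
      unfolding g_def using abs_triangle_ineq[of "a * p t" "b * q t"] pq[of t] by (simp add: abs_mult)
    also have "\<dots> \<le> \<bar>a\<bar> * 1 + \<bar>b\<bar> * 1"
      using pq by (intro add_mono mult_left_mono) auto
    finally show ?thesis by (simp add: L_def)
  qed
  have sp: "\<kappa> * (\<Sum>t=1..n. (p t)\<^sup>2) = 1 - 1 / (\<rho> ^ n)\<^sup>2"
    unfolding p_def by (rule sum_sq_early)
  have sq: "\<kappa> * (\<Sum>t=1..n. (q t)\<^sup>2) = 1 - 1 / (\<rho> ^ n)\<^sup>2"
    unfolding q_def by (rule sum_sq_late)
  have pqs: "(\<Sum>t=1..n. p t * q t) = n / \<rho> ^ (n + 1)"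
  proof -
    have "p t * q t = 1 / \<rho> ^ (n + 1)" if "t \<in> {1..n}" for t
    proof -
      have "\<rho> ^ (n + 1) = \<rho> ^ (t + (n + 1 - t))" using that by simp
      then show ?thesis unfolding p_def q_def power_add by simp
    qed
    then show ?thesis by simp
  qed
  have g2: "\<kappa> * (\<Sum>t=1..n. (g t)\<^sup>2) = \<theta> * (1 - 1 / (\<rho> ^ n)\<^sup>2) + 2 * a * b * (\<kappa> * n / \<rho> ^ (n + 1))"
  proof -
    have "(\<Sum>t=1..n. (g t)\<^sup>2) = a\<^sup>2 * (\<Sum>t=1..n. (p t)\<^sup>2) + b\<^sup>2 * (\<Sum>t=1..n. (q t)\<^sup>2) + 2 * a * b * (\<Sum>t=1..n. p t * q t)"
      unfolding sum_distrib_left sum.distrib[symmetric] g_def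
      by (intro sum.cong refl) (simp add: power2_eq_square algebra_simps)
    then have "\<kappa> * (\<Sum>t=1..n. (g t)\<^sup>2) = a\<^sup>2 * (\<kappa> * (\<Sum>t=1..n. (p t)\<^sup>2)) + b\<^sup>2 * (\<kappa> * (\<Sum>t=1..n. (q t)\<^sup>2)) + 2 * a * b * (\<kappa> * (\<Sum>t=1..n. p t * q t))"
      by (simp add: distrib_left mult_ac)
    then show ?thesis unfolding sp sq pqs \<theta>_def by (simp add: distrib_right)
  qed
  have g2': "\<kappa> * (\<Sum>t=1..n. (g t)\<^sup>2) \<le> 2 * \<theta>"
  proof -
    have "(\<Sum>t=1..n. (g t)\<^sup>2) \<le> (\<Sum>t=1..n. 2 * a\<^sup>2 * (p t)\<^sup>2 + 2 * b\<^sup>2 * (q t)\<^sup>2)"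
    proof (intro sum_mono)
      fix t
      have "0 \<le> (a * p t - b * q t)\<^sup>2" by simp
      then show "(g t)\<^sup>2 \<le> 2 * a\<^sup>2 * (p t)\<^sup>2 + 2 * b\<^sup>2 * (q t)\<^sup>2"
        unfolding g_def by (simp add: power2_eq_square algebra_simps)
    qed
    then have "\<kappa> * (\<Sum>t=1..n. (g t)\<^sup>2) \<le> \<kappa> * (\<Sum>t=1..n. 2 * a\<^sup>2 * (p t)\<^sup>2 + 2 * b\<^sup>2 * (q t)\<^sup>2)"
      using \<kappa>_pos by (intro mult_left_mono) auto
    also have "\<dots> = 2 * a\<^sup>2 * (\<kappa> * (\<Sum>t=1..n. (p t)\<^sup>2)) + 2 * b\<^sup>2 * (\<kappa> * (\<Sum>t=1..n. (q t)\<^sup>2))"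
      by (simp add: sum.distrib sum_distrib_left[symmetric] distrib_left mult_ac)
    also have "\<dots> \<le> 2 * a\<^sup>2 * 1 + 2 * b\<^sup>2 * 1"
      unfolding sp sq by (intro add_mono mult_left_mono) auto
    finally show ?thesis by (simp add: \<theta>_def)
  qed
  have comb: "a * early n \<omega> + b * late n \<omega> = (\<Sum>t=1..n. w t * u t \<omega>)" for \<omega>
    unfolding early_def late_def w_def g_def p_def q_def
    by (simp add: sum_divide_distrib sum_distrib_left sum.distrib[symmetric] add_divide_distrib distrib_right)
  have W: "\<bar>w t\<bar> \<le> L * sqrt \<kappa>" for t
  proof -
    have "\<bar>w t\<bar> = \<bar>g t\<bar> * (1 / scale)" unfolding w_def using scale_pos by simp
    also have "\<dots> \<le> L * sqrt \<kappa>"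
      using gL inverse_scale_le scale_pos L0 by (intro mult_mono) auto
    finally show ?thesis .
  qed
  have w2: "(w t)\<^sup>2 = \<kappa> * (g t)\<^sup>2 / stat_mean" for t
    unfolding w_def power_divide scale2 by simp
  have A: "(\<Sum>t=1..n. (w t)\<^sup>2) \<le> 2 * \<theta>"
  proof -
    have "(\<Sum>t=1..n. (w t)\<^sup>2) = \<kappa> * (\<Sum>t=1..n. (g t)\<^sup>2) / stat_mean"
      unfolding w2 by (simp add: sum_distrib_left sum_divide_distrib)
    also have "\<dots> \<le> \<kappa> * (\<Sum>t=1..n. (g t)\<^sup>2) / 1"
      using stat_mean_ge_1 \<kappa>_pos by (intro divide_left_mono mult_nonneg_nonneg sum_nonneg) auto
    finally show ?thesis using g2' by simp
  qed
  have EV: "\<bar>(\<Sum>t=1..n. (w t)\<^sup>2 * vol2_mean t) - \<theta>\<bar> \<le> \<theta> / (\<rho> ^ n)\<^sup>2 + 2 * \<bar>a * b\<bar> * (\<kappa> * n / \<rho> ^ n) + \<kappa> * L\<^sup>2 * (s\<^sup>2 / (2 * \<alpha>\<^sup>2))"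
  proof -
    define d where "d t = 1 - vol2_mean t / stat_mean" for t
    have d0: "0 \<le> d t" for t using vol2_mean_le[of t] stat_mean_ge_1 by (simp add: d_def)
    have "(\<Sum>t=1..n. (w t)\<^sup>2 * vol2_mean t) = (\<Sum>t=1..n. \<kappa> * (g t)\<^sup>2 - \<kappa> * ((g t)\<^sup>2 * d t))"
      unfolding w2 d_def using stat_mean_ge_1 by (intro sum.cong refl) (simp add: field_simps)
    also have "\<dots> = \<kappa> * (\<Sum>t=1..n. (g t)\<^sup>2) - \<kappa> * (\<Sum>t=1..n. (g t)\<^sup>2 * d t)"
      by (simp add: sum_subtractf sum_distrib_left)
    finally have 1: "(\<Sum>t=1..n. (w t)\<^sup>2 * vol2_mean t) - \<theta> =
       - \<theta> / (\<rho> ^ n)\<^sup>2 + 2 * a * b * (\<kappa> * n / \<rho> ^ (n + 1)) - \<kappa> * (\<Sum>t=1..n. (g t)\<^sup>2 * d t)"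
      unfolding g2 by (simp add: algebra_simps)
    have "(\<Sum>t=1..n. (g t)\<^sup>2 * d t) \<le> (\<Sum>t=1..n. L\<^sup>2 * (s * (\<phi>\<^sup>2) ^ t / 2))"
    proof (intro sum_mono mult_mono)
      fix t show "(g t)\<^sup>2 \<le> L\<^sup>2" using power_mono[OF gL, of t 2] by simp
      show "d t \<le> s * (\<phi>\<^sup>2) ^ t / 2" unfolding d_def by (rule vol2_mean_deficit)
    qed (use d0 in auto)
    also have "\<dots> = L\<^sup>2 * s / 2 * (\<Sum>t=1..n. (\<phi>\<^sup>2) ^ t)"
      by (simp add: sum_distrib_left mult_ac)
    also have "\<dots> \<le> L\<^sup>2 * s / 2 * (s / \<alpha>\<^sup>2)"
      using s_pos by (intro mult_left_mono sum_phi_le) auto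
    finally have "\<kappa> * (\<Sum>t=1..n. (g t)\<^sup>2 * d t) \<le> \<kappa> * (L\<^sup>2 * s / 2 * (s / \<alpha>\<^sup>2))"
      using \<kappa>_pos by (intro mult_left_mono) auto
    then have 2: "\<kappa> * (\<Sum>t=1..n. (g t)\<^sup>2 * d t) \<le> \<kappa> * L\<^sup>2 * (s\<^sup>2 / (2 * \<alpha>\<^sup>2))"
      by (simp add: power2_eq_square mult_ac)
    have 3: "0 \<le> \<kappa> * (\<Sum>t=1..n. (g t)\<^sup>2 * d t)"
      using \<kappa>_pos d0 by (intro mult_nonneg_nonneg sum_nonneg) auto
    have "\<rho> ^ n \<le> \<rho> ^ (n + 1)" using \<rho>_gt_1 by (intro power_increasing) auto
    then have le: "\<kappa> * n / \<rho> ^ (n + 1) \<le> \<kappa> * n / \<rho> ^ n"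
      using \<rho>_gt_1 \<kappa>_pos by (intro divide_left_mono) auto
    have "\<bar>2 * a * b * (\<kappa> * n / \<rho> ^ (n + 1))\<bar> \<le> 2 * \<bar>a * b\<bar> * (\<kappa> * n / \<rho> ^ n)"
    proof -
      have "0 \<le> \<kappa> * n / \<rho> ^ (n + 1)" using \<kappa>_pos \<rho>_gt_1 by simp
      then have "\<bar>2 * a * b * (\<kappa> * n / \<rho> ^ (n + 1))\<bar> = 2 * \<bar>a * b\<bar> * (\<kappa> * n / \<rho> ^ (n + 1))"
        unfolding abs_mult by (simp only: abs_of_nonneg abs_numeral mult.assoc)
      then show ?thesis
        using le by (simp only: mult_left_mono abs_ge_zero mult_nonneg_nonneg zero_le_numeral)
    qed
    moreover have "0 \<le> \<theta> / (\<rho> ^ n)\<^sup>2" by (simp add: \<theta>_def)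
    ultimately show ?thesis using 1 2 3 unfolding abs_le_iff by linarith
  qed
  have "cmod ((CLINT \<omega>|M. iexp (\<Sum>t=1..n. w t * u t \<omega>)) - complex_of_real (exp (- \<theta> / 2)))
    \<le> char_const * (L * sqrt \<kappa> * (2 * \<theta>)) * exp (9 * s / 8)
      + (\<bar>(\<Sum>t=1..n. (w t)\<^sup>2 * vol2_mean t) - \<theta>\<bar> + sqrt (4 * stat_mean\<^sup>2 * s\<^sup>2 * exp s * (L * sqrt \<kappa>)\<^sup>2 * (2 * \<theta>) / \<alpha>\<^sup>2)) / 2"
    using W A L0 \<kappa>_pos by (intro gaussian_approximation) (auto simp: \<theta>_def)
  also have "\<dots> \<le> clt_error a b n"
    unfolding clt_error_def L_def[symmetric] \<theta>_def[symmetric]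
    using EV by (intro add_left_mono divide_right_mono add_right_mono) auto
  finally show ?thesis
    unfolding comb \<theta>_def .
qed

definition score :: "nat \<Rightarrow> 'a \<Rightarrow> real" where
  "score n \<omega> = (\<Sum>t=1..n. u t \<omega> * discounted \<rho> (\<lambda>t. u t \<omega>) t)"

definition energy :: "nat \<Rightarrow> 'a \<Rightarrow> real" where
  "energy n \<omega> = (\<Sum>t=1..n. (u t \<omega>)\<^sup>2)"

lemma discounted_u_second_moment:
  "integrable M (\<lambda>\<omega>. (discounted \<rho> (\<lambda>t. u t \<omega>) n)\<^sup>2)"
  "expectation (\<lambda>\<omega>. (discounted \<rho> (\<lambda>t. u t \<omega>) n)\<^sup>2) \<le> stat_mean * \<rho>\<^sup>2 / \<kappa>"
proof -
  have e: "discounted \<rho> (\<lambda>t. u t \<omega>) n = (\<Sum>t=1..n. 1 / \<rho> ^ (n - t) * u t \<omega>)" for \<omega>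
    unfolding discounted_def by simp
  note m = u_lincomb_second_moment[of "{1..n}" "\<lambda>t. 1 / \<rho> ^ (n - t)"]
  show "integrable M (\<lambda>\<omega>. (discounted \<rho> (\<lambda>t. u t \<omega>) n)\<^sup>2)"
    unfolding e using m(1) by auto
  have "expectation (\<lambda>\<omega>. (discounted \<rho> (\<lambda>t. u t \<omega>) n)\<^sup>2) = (\<Sum>t=1..n. (1 / \<rho> ^ (n - t))\<^sup>2 * vol2_mean t)"
    unfolding e using m(2) by auto
  also have "\<dots> \<le> (\<Sum>t=1..n. (1 / \<rho> ^ (n - t))\<^sup>2 * stat_mean)"
    by (intro sum_mono mult_left_mono vol2_mean_le) auto
  also have "\<dots> = (\<Sum>t=1..n. \<rho>\<^sup>2 * stat_mean * (1 / \<rho> ^ (n + 1 - t))\<^sup>2)"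
  proof (intro sum.cong refl)
    fix t assume "t \<in> {1..n}"
    then have "n + 1 - t = Suc (n - t)" by (auto simp: One_nat_def)
    then show "(1 / \<rho> ^ (n - t))\<^sup>2 * stat_mean = \<rho>\<^sup>2 * stat_mean * (1 / \<rho> ^ (n + 1 - t))\<^sup>2"
      using \<rho>_gt_1 by (simp add: power_divide power_mult_distrib)
  qed
  also have "\<dots> = \<rho>\<^sup>2 * stat_mean / \<kappa> * (\<kappa> * (\<Sum>t=1..n. (1 / \<rho> ^ (n + 1 - t))\<^sup>2))"
    using \<kappa>_pos by (simp add: sum_distrib_left mult.assoc)
  also have "\<dots> \<le> \<rho>\<^sup>2 * stat_mean / \<kappa> * 1"
    unfolding sum_sq_late using \<kappa>_pos stat_mean_ge_1 by (intro mult_left_mono) auto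
  finally show "expectation (\<lambda>\<omega>. (discounted \<rho> (\<lambda>t. u t \<omega>) n)\<^sup>2) \<le> stat_mean * \<rho>\<^sup>2 / \<kappa>"
    by (simp add: mult.commute)
qed

lemma energy_moment:
  "integrable M (energy n)" "expectation (energy n) \<le> n * stat_mean" "0 \<le> energy n \<omega>"
proof -
  have i: "integrable M (\<lambda>\<omega>. (u t \<omega>)\<^sup>2)" "expectation (\<lambda>\<omega>. (u t \<omega>)\<^sup>2) = vol2_mean t" if "t \<in> {1..n}" for t
    using u_product_moment[of t t] that by (auto simp: power2_eq_square)
  show "integrable M (energy n)"
    unfolding energy_def[abs_def] by (intro Bochner_Integration.integrable_sum i)
  have "expectation (energy n) = (\<Sum>t=1..n. vol2_mean t)"
    unfolding energy_def[abs_def] using i by (subst Bochner_Integration.integral_sum) auto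
  also have "\<dots> \<le> (\<Sum>t=1..n. stat_mean)" by (intro sum_mono vol2_mean_le)
  finally show "expectation (energy n) \<le> n * stat_mean" by simp
  show "0 \<le> energy n \<omega>" unfolding energy_def by (intro sum_nonneg) auto
qed

text \<open>
  Taking expectations in \<open>discounted_score\<close>: each of the \<open>n\<close> discounted sums has second moment at
  most \<open>stat_mean \<rho>\<^sup>2 / \<kappa>\<close>, and the prefactor \<open>1 - 1 / \<rho>\<^sup>2\<close> cancels the factor \<open>\<rho>\<^sup>2 / \<kappa>\<close>.
\<close>

lemma score_moment:
  "integrable M (score n)" "expectation (score n) \<le> stat_mean * (n + 1 / (2 * \<kappa>))" "0 \<le> score n \<omega>"
proof -
  let ?C = "\<lambda>t \<omega>. discounted \<rho> (\<lambda>t. u t \<omega>) t"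
  have e: "score n \<omega> = ((1 - 1 / \<rho>\<^sup>2) * (\<Sum>t=1..n. (?C t \<omega>)\<^sup>2) + (?C n \<omega>)\<^sup>2 / \<rho>\<^sup>2 + energy n \<omega>) / 2" for \<omega>
    unfolding score_def energy_def using discounted_score[of \<rho> "\<lambda>t. u t \<omega>" n] \<rho>_gt_1 by simp
  have k: "1 - 1 / \<rho>\<^sup>2 = \<kappa> / \<rho>\<^sup>2" unfolding \<kappa>_def using \<rho>_gt_1 by (simp add: diff_divide_distrib)
  have k0: "0 \<le> 1 - 1 / \<rho>\<^sup>2" unfolding k using \<kappa>_pos by simp
  show "0 \<le> score n \<omega>"
    unfolding e using k0 energy_moment(3) by (auto intro!: add_nonneg_nonneg mult_nonneg_nonneg sum_nonneg)
  have iC: "integrable M (\<lambda>\<omega>. \<Sum>t=1..n. (?C t \<omega>)\<^sup>2)"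
    by (intro Bochner_Integration.integrable_sum discounted_u_second_moment(1))
  show "integrable M (score n)"
    unfolding e[abs_def] using iC discounted_u_second_moment(1) energy_moment(1) by auto
  have "expectation (score n) = ((1 - 1 / \<rho>\<^sup>2) * expectation (\<lambda>\<omega>. \<Sum>t=1..n. (?C t \<omega>)\<^sup>2) + expectation (\<lambda>\<omega>. (?C n \<omega>)\<^sup>2) / \<rho>\<^sup>2 + expectation (energy n)) / 2"
    unfolding e[abs_def] using iC discounted_u_second_moment(1) energy_moment(1) by simp
  also have "expectation (\<lambda>\<omega>. \<Sum>t=1..n. (?C t \<omega>)\<^sup>2) = (\<Sum>t=1..n. expectation (\<lambda>\<omega>. (?C t \<omega>)\<^sup>2))"
    by (intro Bochner_Integration.integral_sum discounted_u_second_moment(1))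
  also have "((1 - 1 / \<rho>\<^sup>2) * (\<Sum>t=1..n. expectation (\<lambda>\<omega>. (?C t \<omega>)\<^sup>2)) + expectation (\<lambda>\<omega>. (?C n \<omega>)\<^sup>2) / \<rho>\<^sup>2 + expectation (energy n)) / 2
     \<le> ((1 - 1 / \<rho>\<^sup>2) * (\<Sum>t=1..n. stat_mean * \<rho>\<^sup>2 / \<kappa>) + (stat_mean * \<rho>\<^sup>2 / \<kappa>) / \<rho>\<^sup>2 + n * stat_mean) / 2"
    by (intro divide_right_mono add_mono mult_left_mono sum_mono discounted_u_second_moment(2) energy_moment(2) k0) auto
  also have "\<dots> = stat_mean * (n + 1 / (2 * \<kappa>))"
    unfolding k using \<kappa>_pos \<rho>_gt_1 by (simp add: field_simps)
  finally show "expectation (score n) \<le> stat_mean * (n + 1 / (2 * \<kappa>))" .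
qed

lemma late_eq_discounted: "discounted \<rho> (\<lambda>t. u t \<omega>) n = \<rho> * scale * late n \<omega>"
proof -
  have "discounted \<rho> (\<lambda>t. u t \<omega>) n = (\<Sum>t=1..n. \<rho> * (1 / \<rho> ^ (n + 1 - t) * u t \<omega>))"
    unfolding discounted_def
  proof (intro sum.cong refl)
    fix t assume "t \<in> {1..n}"
    then have "n + 1 - t = Suc (n - t)" by (auto simp: One_nat_def)
    then show "u t \<omega> / \<rho> ^ (n - t) = \<rho> * (1 / \<rho> ^ (n + 1 - t) * u t \<omega>)"
      using \<rho>_gt_1 by simp
  qed
  then show ?thesis
    unfolding late_def sum_distrib_left[symmetric] using scale_pos by simp
qed

text \<open>
  The errors in numerator and denominator come from the initial value, from the score and
  energy of the shocks, and from replacing the endpoint by its leading part.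
\<close>

definition num_error :: "nat \<Rightarrow> ('a \<Rightarrow> real) \<Rightarrow> 'a \<Rightarrow> real" where
  "num_error n y0 \<omega> = y0 \<omega> / scale * late n \<omega> - score n \<omega> / (\<rho> * \<rho> ^ n * scale\<^sup>2)"

definition den_error :: "nat \<Rightarrow> ('a \<Rightarrow> real) \<Rightarrow> 'a \<Rightarrow> real" where
  "den_error n y0 \<omega> = 2 * (y0 \<omega> / scale * early n \<omega>) + (1 - 1 / (\<rho> ^ n)\<^sup>2) * (y0 \<omega> / scale)\<^sup>2
     - 2 * \<rho> / \<rho> ^ n * (early n \<omega> * late n \<omega> + num_error n y0 \<omega>) - energy n \<omega> / ((\<rho> ^ n)\<^sup>2 * scale\<^sup>2)"

text \<open>
  Dividing \<open>ar1_score\<close> and \<open>ar1_energy\<close> by \<open>\<rho>\<^sup>n scale\<^sup>2\<close> and \<open>\<rho>\<^sup>2\<^sup>n scale\<^sup>2\<close> leaves the product of early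
  and late sums over the square of the early sum, up to the two errors.
\<close>

lemma normalized_estimation_error:
  fixes y :: "nat \<Rightarrow> real"
  assumes y: "\<And>t. 1 \<le> t \<Longrightarrow> t \<le> n \<Longrightarrow> y t = \<rho> * y (t - 1) + u t \<omega>" and y0: "y 0 = y0 \<omega>"
  shows "\<rho> ^ n * (\<Sum>t=1..n. y (t - 1) * u t \<omega>) / (\<kappa> * (\<Sum>t=1..n. (y (t - 1))\<^sup>2)) =
    (early n \<omega> * late n \<omega> + num_error n y0 \<omega>) / ((early n \<omega>)\<^sup>2 + den_error n y0 \<omega>)"
proof -
  have \<rho>: "\<rho> \<noteq> 0" using \<rho>_gt_1 by simp
  define R where "R = \<rho> ^ n"
  have R: "R > 0" unfolding R_def using \<rho>_gt_1 by simp
  define x where "x = early n \<omega> + y0 \<omega> / scale"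
  define N where "N = (\<Sum>t=1..n. y (t - 1) * u t \<omega>)"
  have yn: "y n = R * scale * x"
    using ar1_solution[where y=y and u="\<lambda>t. u t \<omega>" and n=n and m=n, OF y \<rho> order_refl] scale_pos
    unfolding R_def x_def early_def y0 by (simp add: distrib_left)
  have "\<rho> * N = y n * discounted \<rho> (\<lambda>t. u t \<omega>) n - score n \<omega>"
    unfolding N_def score_def by (rule ar1_score[where y=y and u="\<lambda>t. u t \<omega>" and n=n and m=n, OF y \<rho> order_refl])
  also have "\<dots> = R * scale * x * (\<rho> * scale * late n \<omega>) - score n \<omega>"
    unfolding yn late_eq_discounted ..
  finally have "N = R * scale\<^sup>2 * (x * late n \<omega>) - score n \<omega> / \<rho>"
    using \<rho> by (simp add: field_simps power2_eq_square)
  also have "\<dots> = R * scale\<^sup>2 * (early n \<omega> * late n \<omega> + num_error n y0 \<omega>)"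
    unfolding num_error_def x_def R_def[symmetric] using \<rho> R scale_pos by (simp add: field_simps)
  finally have N: "N = R * scale\<^sup>2 * (early n \<omega> * late n \<omega> + num_error n y0 \<omega>)" .
  have "\<kappa> * (\<Sum>t=1..n. (y (t - 1))\<^sup>2) = (y n)\<^sup>2 - (y 0)\<^sup>2 - 2 * \<rho> * N - energy n \<omega>"
    unfolding \<kappa>_def N_def energy_def by (rule ar1_energy[where y=y and u="\<lambda>t. u t \<omega>" and n=n and m=n, OF y order_refl])
  also have "\<dots> = R\<^sup>2 * scale\<^sup>2 * ((early n \<omega>)\<^sup>2 + den_error n y0 \<omega>)"
    unfolding yn N y0 den_error_def x_def R_def[symmetric] using R scale_pos
    by (simp add: field_simps power2_eq_square)
  finally have D: "\<kappa> * (\<Sum>t=1..n. (y (t - 1))\<^sup>2) = R\<^sup>2 * scale\<^sup>2 * ((early n \<omega>)\<^sup>2 + den_error n y0 \<omega>)" .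
  show ?thesis
    unfolding D N_def[symmetric] N R_def[symmetric] using R scale_pos by (simp add: power2_eq_square)
qed

end

section \<open>Limit law of the scaled estimation error\<close>

context prob_space
begin

lemma small_o_p_mono:
  assumes "small_o_p M Y (\<lambda>_. 1)" and [measurable]: "\<And>n. Y n \<in> borel_measurable M"
    and le: "\<forall>\<^sub>F n in sequentially. \<forall>\<omega>\<in>space M. \<bar>X n \<omega>\<bar> \<le> \<bar>Y n \<omega>\<bar>"
  shows "small_o_p M X (\<lambda>_. 1)"
  unfolding small_o_p_def
proof (intro allI impI)
  fix e :: real assume "e > 0"
  then have "(\<lambda>n. \<P>(\<omega> in M. \<bar>Y n \<omega> / 1\<bar> > e)) \<longlonglongrightarrow> 0"
    using assms(1) unfolding small_o_p_def by blast
  moreover have "\<forall>\<^sub>F n in sequentially. norm (\<P>(\<omega> in M. \<bar>X n \<omega> / 1\<bar> > e)) \<le> \<P>(\<omega> in M. \<bar>Y n \<omega> / 1\<bar> > e)"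
    using le
  proof eventually_elim
    case (elim n)
    then have "{\<omega> \<in> space M. \<bar>X n \<omega>\<bar> > e} \<subseteq> {\<omega> \<in> space M. \<bar>Y n \<omega>\<bar> > e}" by force
    then show ?case by (simp add: finite_measure_mono)
  qed
  ultimately show "(\<lambda>n. \<P>(\<omega> in M. \<bar>X n \<omega> / 1\<bar> > e)) \<longlonglongrightarrow> 0"
    by (rule Lim_null_comparison[rotated])
qed

lemma small_o_p_add:
  assumes X: "small_o_p M X (\<lambda>_. 1)" and Y: "small_o_p M Y (\<lambda>_. 1)"
    and [measurable]: "\<And>n. X n \<in> borel_measurable M" "\<And>n. Y n \<in> borel_measurable M"
  shows "small_o_p M (\<lambda>n \<omega>. X n \<omega> + Y n \<omega>) (\<lambda>_. 1)"
  unfolding small_o_p_def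
proof (intro allI impI)
  fix e :: real assume e: "e > 0"
  have "e / 2 > 0" using e by simp
  then have "(\<lambda>n. \<P>(\<omega> in M. \<bar>X n \<omega> / 1\<bar> > e / 2) + \<P>(\<omega> in M. \<bar>Y n \<omega> / 1\<bar> > e / 2)) \<longlonglongrightarrow> 0 + 0"
    using X Y unfolding small_o_p_def by (intro tendsto_add) blast+
  then have lim: "(\<lambda>n. \<P>(\<omega> in M. \<bar>X n \<omega> / 1\<bar> > e / 2) + \<P>(\<omega> in M. \<bar>Y n \<omega> / 1\<bar> > e / 2)) \<longlonglongrightarrow> 0"
    by simp
  show "(\<lambda>n. \<P>(\<omega> in M. \<bar>(X n \<omega> + Y n \<omega>) / 1\<bar> > e)) \<longlonglongrightarrow> 0"
  proof (rule Lim_null_comparison[OF always_eventually lim], intro allI)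
    fix n
    have "{\<omega> \<in> space M. \<bar>X n \<omega> + Y n \<omega>\<bar> > e} \<subseteq> {\<omega> \<in> space M. \<bar>X n \<omega>\<bar> > e / 2} \<union> {\<omega> \<in> space M. \<bar>Y n \<omega>\<bar> > e / 2}"
      by auto
    then have "prob {\<omega> \<in> space M. \<bar>X n \<omega> + Y n \<omega>\<bar> > e} \<le> prob {\<omega> \<in> space M. \<bar>X n \<omega>\<bar> > e / 2} + prob {\<omega> \<in> space M. \<bar>Y n \<omega>\<bar> > e / 2}"
      by (intro order_trans[OF finite_measure_mono measure_Un_le]) auto
    then show "norm (\<P>(\<omega> in M. \<bar>(X n \<omega> + Y n \<omega>) / 1\<bar> > e)) \<le> \<P>(\<omega> in M. \<bar>X n \<omega> / 1\<bar> > e / 2) + \<P>(\<omega> in M. \<bar>Y n \<omega> / 1\<bar> > e / 2)"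
      by simp
  qed
qed

lemma small_o_p_scale:
  assumes X: "small_o_p M X (\<lambda>_. 1)" and [measurable]: "\<And>n. X n \<in> borel_measurable M"
    and c: "\<forall>\<^sub>F n in sequentially. \<bar>c n\<bar> \<le> C"
  shows "small_o_p M (\<lambda>n \<omega>. c n * X n \<omega>) (\<lambda>_. 1)"
proof (rule small_o_p_mono)
  show "small_o_p M (\<lambda>n \<omega>. (\<bar>C\<bar> + 1) * X n \<omega>) (\<lambda>_. 1)"
    unfolding small_o_p_def
  proof (intro allI impI)
    fix e :: real assume "e > 0"
    then have "e / (\<bar>C\<bar> + 1) > 0" by simp
    moreover have "(\<bar>(\<bar>C\<bar> + 1) * X n \<omega> / 1\<bar> > e) \<longleftrightarrow> (\<bar>X n \<omega> / 1\<bar> > e / (\<bar>C\<bar> + 1))" for n \<omega>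
      by (simp add: abs_mult pos_divide_less_eq mult.commute)
    ultimately show "(\<lambda>n. \<P>(\<omega> in M. \<bar>(\<bar>C\<bar> + 1) * X n \<omega> / 1\<bar> > e)) \<longlonglongrightarrow> 0"
      using X unfolding small_o_p_def by presburger
  qed
  show "\<forall>\<^sub>F n in sequentially. \<forall>\<omega>\<in>space M. \<bar>c n * X n \<omega>\<bar> \<le> \<bar>(\<bar>C\<bar> + 1) * X n \<omega>\<bar>"
    using c by eventually_elim (auto simp: abs_mult intro!: mult_right_mono)
qed measurable

text \<open>
  Variables with bounded second moments are bounded in probability.
\<close>

lemma small_o_p_mult_second_moment:
  assumes X: "small_o_p M X (\<lambda>_. 1)"
    and [measurable]: "\<And>n. X n \<in> borel_measurable M" "\<And>n. Y n \<in> borel_measurable M"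
    and Y: "\<And>n. integrable M (\<lambda>\<omega>. (Y n \<omega>)\<^sup>2)" "\<And>n. expectation (\<lambda>\<omega>. (Y n \<omega>)\<^sup>2) \<le> 1"
  shows "small_o_p M (\<lambda>n \<omega>. X n \<omega> * Y n \<omega>) (\<lambda>_. 1)"
  unfolding small_o_p_def
proof (intro allI impI tendstoI)
  fix e \<delta> :: real assume e: "e > 0" and \<delta>: "\<delta> > 0"
  \<comment> \<open>By Markov's inequality the second factor exceeds \<open>K\<close> with probability at most \<open>\<delta> / 2\<close>.\<close>
  define K where "K = sqrt (2 / \<delta>)"
  have K: "K > 0" "1 / K\<^sup>2 = \<delta> / 2" using \<delta> by (auto simp: K_def)
  have "(\<lambda>n. \<P>(\<omega> in M. \<bar>X n \<omega> / 1\<bar> > e / K)) \<longlonglongrightarrow> 0"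
    using X e K(1) unfolding small_o_p_def by auto
  then have "\<forall>\<^sub>F n in sequentially. \<P>(\<omega> in M. \<bar>X n \<omega> / 1\<bar> > e / K) < \<delta> / 2"
    using \<delta> by (intro order_tendstoD(2)) auto
  then show "\<forall>\<^sub>F n in sequentially. dist (\<P>(\<omega> in M. \<bar>X n \<omega> * Y n \<omega> / 1\<bar> > e)) 0 < \<delta>"
  proof eventually_elim
    case (elim n)
    have "\<bar>X n \<omega> * Y n \<omega>\<bar> \<le> e" if "\<bar>X n \<omega>\<bar> \<le> e / K" "\<bar>Y n \<omega>\<bar> \<le> K" for \<omega>
      using mult_mono[OF that] e K by (simp add: abs_mult)
    then have "{\<omega> \<in> space M. \<bar>X n \<omega> * Y n \<omega>\<bar> > e} \<subseteq> {\<omega> \<in> space M. \<bar>X n \<omega>\<bar> > e / K} \<union> {\<omega> \<in> space M. (Y n \<omega>)\<^sup>2 \<ge> K\<^sup>2}"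
      using K(1) by (auto simp: not_le[symmetric] abs_le_square_iff[symmetric])
    then have "prob {\<omega> \<in> space M. \<bar>X n \<omega> * Y n \<omega>\<bar> > e} \<le> prob {\<omega> \<in> space M. \<bar>X n \<omega>\<bar> > e / K} + prob {\<omega> \<in> space M. (Y n \<omega>)\<^sup>2 \<ge> K\<^sup>2}"
      by (intro order_trans[OF finite_measure_mono measure_Un_le]) auto
    also have "prob {\<omega> \<in> space M. (Y n \<omega>)\<^sup>2 \<ge> K\<^sup>2} \<le> expectation (\<lambda>\<omega>. (Y n \<omega>)\<^sup>2) / K\<^sup>2"
      using Y K by (intro integral_Markov_inequality_measure[where A="{}"]) auto
    also have "\<dots> \<le> 1 / K\<^sup>2" using Y(2)[of n] by (intro divide_right_mono) auto
    finally show ?case using elim K by simp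
  qed
qed

lemma small_o_p_square:
  assumes X: "small_o_p M X (\<lambda>_. 1)" and [measurable]: "\<And>n. X n \<in> borel_measurable M"
  shows "small_o_p M (\<lambda>n \<omega>. (X n \<omega>)\<^sup>2) (\<lambda>_. 1)"
  unfolding small_o_p_def
proof (intro allI impI)
  fix e :: real assume "e > 0"
  then have "sqrt e > 0" by simp
  moreover have "(\<bar>(X n \<omega>)\<^sup>2 / 1\<bar> > e) \<longleftrightarrow> (\<bar>X n \<omega> / 1\<bar> > sqrt e)" for n \<omega>
    using \<open>e > 0\<close> real_less_lsqrt real_sqrt_less_iff[of e "(X n \<omega>)\<^sup>2"] by simp
  ultimately show "(\<lambda>n. \<P>(\<omega> in M. \<bar>(X n \<omega>)\<^sup>2 / 1\<bar> > e)) \<longlonglongrightarrow> 0"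
    using X unfolding small_o_p_def by presburger
qed

end

text \<open>
  The triangular array with the asymptotic requirements in the form in which the proof uses them.
  The last one makes the initial value negligible against the early shocks, whose standard
  deviation is at least of the order \<open>1 / sqrt (\<rho>\<^sup>2 - 1)\<close>.
\<close>

locale sv_array = sv_noise +
  fixes \<phi> \<rho> :: "nat \<Rightarrow> real" and y :: "nat \<Rightarrow> nat \<Rightarrow> 'a \<Rightarrow> real"
  assumes \<phi>_stable: "\<And>n. \<bar>\<phi> n\<bar> < 1"
    and \<rho>_gt_1: "\<And>n. \<rho> n > 1"
    and y0_measurable[measurable]: "\<And>n. y n 0 \<in> borel_measurable M"
    and y_eq: "\<And>n t \<omega>. 1 \<le> t \<Longrightarrow> t \<le> n \<Longrightarrow> \<omega> \<in> space M \<Longrightarrow>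
          y n t \<omega> = \<rho> n * y n (t - 1) \<omega> + exp (log_vol (\<phi> n) t (\<lambda>j. \<eta> j \<omega>) / 2) * \<epsilon> t \<omega>"
    and vol_rate: "\<And>q. q \<ge> 0 \<Longrightarrow> (\<lambda>n. ((\<rho> n)\<^sup>2 - 1) * exp (q * (\<alpha>\<^sup>2 / (1 - (\<phi> n)\<^sup>2)))) \<longlonglongrightarrow> 0"
    and \<rho>_power_at_top: "filterlim (\<lambda>n. \<rho> n ^ n) at_top sequentially"
    and \<rho>_rate: "(\<lambda>n. ((\<rho> n)\<^sup>2 - 1) * n / \<rho> n ^ n) \<longlonglongrightarrow> 0"
    and y0_small: "small_o_p M (\<lambda>n \<omega>. sqrt ((\<rho> n)\<^sup>2 - 1) * y n 0 \<omega>) (\<lambda>_. 1)"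
begin

sublocale row: sv_explosive M \<alpha> \<epsilon> \<eta> "\<phi> n" "\<rho> n" for n
  by unfold_locales (rule \<phi>_stable \<rho>_gt_1)+

text \<open>
  This is \<open>\<rho>\<^sup>n (\<rho>hat - \<rho>) / \<kappa>\<close> whenever the estimator is defined, and 0 otherwise.
\<close>

definition scaled_error :: "nat \<Rightarrow> 'a \<Rightarrow> real" where
  "scaled_error n \<omega> = \<rho> n ^ n * (\<Sum>t=1..n. y n (t - 1) \<omega> * row.u n t \<omega>) / (row.\<kappa> n * (\<Sum>t=1..n. (y n (t - 1) \<omega>)\<^sup>2))"

lemma vol_rate': "q \<ge> 0 \<Longrightarrow> (\<lambda>n. row.\<kappa> n * exp (q * row.s n)) \<longlonglongrightarrow> 0"
  using vol_rate unfolding row.\<kappa>_def row.s_def .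

lemma \<rho>_rate': "(\<lambda>n. row.\<kappa> n * n / \<rho> n ^ n) \<longlonglongrightarrow> 0"
  using \<rho>_rate unfolding row.\<kappa>_def .

lemma \<kappa>_tendsto_0: "row.\<kappa> \<longlonglongrightarrow> 0"
  using vol_rate'[of 0] by simp

lemma inverse_\<rho>_power_tendsto_0: "(\<lambda>n. 1 / \<rho> n ^ n) \<longlonglongrightarrow> 0"
  using tendsto_inverse_0_at_top[OF \<rho>_power_at_top] by (simp add: inverse_eq_divide)

text \<open>
  Two terms of the bias vanish by the growth of \<open>\<rho>\<^sup>n\<close>.  Every other term is a product of a power of
  \<open>\<kappa>\<close> with powers and exponentials of \<open>s\<close>; the powers of \<open>s\<close> are absorbed by \<open>s\<^sup>2 \<le> 2 exp s\<close>.
\<close>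

lemma clt_error_tendsto_0: "(\<lambda>n. row.clt_error n a b n) \<longlonglongrightarrow> 0"
proof -
  define L where "L = \<bar>a\<bar> + \<bar>b\<bar>"
  define \<theta> where "\<theta> = a\<^sup>2 + b\<^sup>2"
  have sqrt_rate: "(\<lambda>n. sqrt (row.\<kappa> n) * exp (9 * row.s n / 8)) \<longlonglongrightarrow> 0"
  proof -
    have "(\<lambda>n. sqrt (row.\<kappa> n * exp (9 / 4 * row.s n))) \<longlonglongrightarrow> sqrt 0"
      by (intro tendsto_real_sqrt vol_rate') simp
    moreover have "sqrt (exp (9 / 4 * row.s n)) = exp (9 * row.s n / 8)" for n
      by (rule real_sqrt_unique) (simp_all add: power2_eq_square exp_add[symmetric])
    ultimately show ?thesis by (simp add: real_sqrt_mult)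
  qed
  have s2: "(row.s n)\<^sup>2 \<le> 2 * exp (row.s n)" for n
    using exp_lower_Taylor_quadratic[of "row.s n"] row.s_pos[of n] by simp
  have s2_rate: "(\<lambda>n. row.\<kappa> n * ((row.s n)\<^sup>2 * exp (q * row.s n))) \<longlonglongrightarrow> 0" if q: "q \<ge> 0" for q
  proof (rule Lim_null_comparison[OF always_eventually], intro allI)
    show "(\<lambda>n. 2 * (row.\<kappa> n * exp ((q + 1) * row.s n))) \<longlonglongrightarrow> 0"
      using tendsto_mult[OF tendsto_const[of 2] vol_rate'[of "q + 1"]] q by simp
    fix n
    have "row.\<kappa> n * ((row.s n)\<^sup>2 * exp (q * row.s n)) \<le> row.\<kappa> n * ((2 * exp (row.s n)) * exp (q * row.s n))"
      using row.\<kappa>_pos[of n] s2 by (intro mult_left_mono mult_right_mono) auto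
    then show "norm (row.\<kappa> n * ((row.s n)\<^sup>2 * exp (q * row.s n))) \<le> 2 * (row.\<kappa> n * exp ((q + 1) * row.s n))"
      using row.\<kappa>_pos[of n] by (simp add: distrib_right exp_add mult_ac)
  qed
  have e: "row.clt_error n a b n = char_const * L * (2 * \<theta>) * (sqrt (row.\<kappa> n) * exp (9 * row.s n / 8))
    + ((\<theta> * (1 / \<rho> n ^ n)\<^sup>2 + 2 * \<bar>a * b\<bar> * (row.\<kappa> n * n / \<rho> n ^ n) + L\<^sup>2 / (2 * \<alpha>\<^sup>2) * (row.\<kappa> n * ((row.s n)\<^sup>2 * exp (0 * row.s n))))
       + sqrt (8 * L\<^sup>2 * \<theta> / \<alpha>\<^sup>2 * (row.\<kappa> n * ((row.s n)\<^sup>2 * exp (2 * row.s n))))) / 2" for n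
  proof -
    have "(row.stat_mean n)\<^sup>2 * exp (row.s n) = exp (2 * row.s n)"
      unfolding row.stat_mean_def by (simp add: power2_eq_square exp_add[symmetric])
    moreover have "(L * sqrt (row.\<kappa> n))\<^sup>2 = L\<^sup>2 * row.\<kappa> n"
      using row.\<kappa>_pos[of n] by (simp add: power_mult_distrib)
    ultimately have "4 * (row.stat_mean n)\<^sup>2 * (row.s n)\<^sup>2 * exp (row.s n) * (L * sqrt (row.\<kappa> n))\<^sup>2 * (2 * \<theta>) / \<alpha>\<^sup>2
       = 8 * L\<^sup>2 * \<theta> / \<alpha>\<^sup>2 * (row.\<kappa> n * ((row.s n)\<^sup>2 * exp (2 * row.s n)))"
      by (simp add: mult_ac)
    then show ?thesis
      unfolding row.clt_error_def L_def[symmetric] \<theta>_def[symmetric] by (simp add: power_divide mult_ac)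
  qed
  have "(\<lambda>n. row.clt_error n a b n) \<longlonglongrightarrow> char_const * L * (2 * \<theta>) * 0
    + ((\<theta> * 0\<^sup>2 + 2 * \<bar>a * b\<bar> * 0 + L\<^sup>2 / (2 * \<alpha>\<^sup>2) * 0) + sqrt (8 * L\<^sup>2 * \<theta> / \<alpha>\<^sup>2 * 0)) / 2"
    unfolding e
    by (intro tendsto_intros sqrt_rate inverse_\<rho>_power_tendsto_0 \<rho>_rate' s2_rate) auto
  then show ?thesis by simp
qed

lemma early_late_clt:
  "(\<lambda>n. CLINT \<omega>|M. iexp (a * row.early n n \<omega> + b * row.late n n \<omega>)) \<longlonglongrightarrow> exp (- (a\<^sup>2 + b\<^sup>2) / 2)"
proof (rule LIM_zero_cancel)
  show "(\<lambda>n. (CLINT \<omega>|M. iexp (a * row.early n n \<omega> + b * row.late n n \<omega>)) - complex_of_real (exp (- (a\<^sup>2 + b\<^sup>2) / 2))) \<longlonglongrightarrow> 0"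
    by (rule Lim_null_comparison[OF always_eventually clt_error_tendsto_0[of a b]], intro allI, rule row.char_early_late)
qed

lemma num_error_measurable[measurable]: "row.num_error n m (y n 0) \<in> borel_measurable M"
proof -
  have [measurable]: "row.score n m \<in> borel_measurable M" by (rule borel_measurable_integrable[OF row.score_moment(1)])
  show ?thesis unfolding row.num_error_def[abs_def] by measurable
qed

lemma den_error_measurable[measurable]: "row.den_error n m (y n 0) \<in> borel_measurable M"
proof -
  have [measurable]: "row.energy n m \<in> borel_measurable M" by (rule borel_measurable_integrable[OF row.energy_moment(1)])
  show ?thesis unfolding row.den_error_def[abs_def] by measurable
qed

lemma y0_scaled_small: "small_o_p M (\<lambda>n \<omega>. y n 0 \<omega> / row.scale n) (\<lambda>_. 1)"
proof (rule small_o_p_mono[OF y0_small])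
  show "\<forall>\<^sub>F n in sequentially. \<forall>\<omega>\<in>space M. \<bar>y n 0 \<omega> / row.scale n\<bar> \<le> \<bar>sqrt ((\<rho> n)\<^sup>2 - 1) * y n 0 \<omega>\<bar>"
  proof (intro always_eventually allI ballI)
    fix n \<omega>
    have "\<bar>y n 0 \<omega> / row.scale n\<bar> = 1 / row.scale n * \<bar>y n 0 \<omega>\<bar>"
      using row.scale_pos[of n] by simp
    also have "\<dots> \<le> sqrt (row.\<kappa> n) * \<bar>y n 0 \<omega>\<bar>"
      by (intro mult_right_mono row.inverse_scale_le) auto
    also have "\<dots> = \<bar>sqrt ((\<rho> n)\<^sup>2 - 1) * y n 0 \<omega>\<bar>"
      using row.\<kappa>_pos[of n] by (simp add: abs_mult row.\<kappa>_def)
    finally show "\<bar>y n 0 \<omega> / row.scale n\<bar> \<le> \<bar>sqrt ((\<rho> n)\<^sup>2 - 1) * y n 0 \<omega>\<bar>" .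
  qed
qed measurable

lemma num_error_small: "small_o_p M (\<lambda>n. row.num_error n n (y n 0)) (\<lambda>_. 1)"
proof -
  have [measurable]: "row.score n m \<in> borel_measurable M" for n m by (rule borel_measurable_integrable[OF row.score_moment(1)])
  define W where "W n \<omega> = - (row.score n n \<omega> / (\<rho> n * \<rho> n ^ n * (row.scale n)\<^sup>2))" for n \<omega>
  have [measurable]: "W n \<in> borel_measurable M" for n unfolding W_def[abs_def] by measurable
  have "small_o_p M W (\<lambda>_. 1)"
  proof (rule small_o_p_of_expectation)
    show "(\<lambda>n. row.\<kappa> n * n / \<rho> n ^ n + (1 / 2) * (1 / \<rho> n ^ n)) \<longlonglongrightarrow> 0"
      using tendsto_add[OF \<rho>_rate' tendsto_mult[OF tendsto_const[of "1/2"] inverse_\<rho>_power_tendsto_0]] by simp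
    show "\<forall>\<^sub>F n in sequentially. integrable M (W n) \<and> expectation (\<lambda>\<omega>. \<bar>W n \<omega>\<bar>) \<le> row.\<kappa> n * n / \<rho> n ^ n + (1 / 2) * (1 / \<rho> n ^ n)"
    proof (intro always_eventually allI conjI)
      fix n
      have r: "\<rho> n > 1" "\<rho> n ^ n > 0" using \<rho>_gt_1[of n] by auto
      have k: "row.\<kappa> n > 0" "row.stat_mean n \<ge> 1" by (rule row.\<kappa>_pos row.stat_mean_ge_1)+
      show "integrable M (W n)"
        unfolding W_def[abs_def] using row.score_moment(1)[of n n] by simp
      have "expectation (\<lambda>\<omega>. \<bar>W n \<omega>\<bar>) = expectation (row.score n n) / (\<rho> n * \<rho> n ^ n * (row.scale n)\<^sup>2)"
        unfolding W_def using row.score_moment(3)[of n n] r by simp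
      also have "\<dots> \<le> (row.stat_mean n * (n + 1 / (2 * row.\<kappa> n))) / (1 * \<rho> n ^ n * (row.scale n)\<^sup>2)"
        using r k row.scale_pos[of n] by (intro frac_le row.score_moment(2) mult_right_mono) auto
      also have "\<dots> = row.\<kappa> n * n / \<rho> n ^ n + (1 / 2) * (1 / \<rho> n ^ n)"
        unfolding row.scale2 using r k by (simp add: field_simps)
      finally show "expectation (\<lambda>\<omega>. \<bar>W n \<omega>\<bar>) \<le> row.\<kappa> n * n / \<rho> n ^ n + (1 / 2) * (1 / \<rho> n ^ n)" .
    qed
  qed measurable
  then have "small_o_p M (\<lambda>n \<omega>. y n 0 \<omega> / row.scale n * row.late n n \<omega> + W n \<omega>) (\<lambda>_. 1)"
    by (intro small_o_p_add small_o_p_mult_second_moment[OF y0_scaled_small] row.late_second_moment) measurable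
  then show ?thesis
    unfolding W_def row.num_error_def[abs_def] by simp
qed

lemma early_late_product:
  "integrable M (\<lambda>\<omega>. row.early n n \<omega> * row.late n n \<omega>)"
  "expectation (\<lambda>\<omega>. \<bar>row.early n n \<omega> * row.late n n \<omega>\<bar>) \<le> 1"
proof -
  let ?S = "\<lambda>\<omega>. ((row.early n n \<omega>)\<^sup>2 + (row.late n n \<omega>)\<^sup>2) / 2"
  have le: "\<bar>row.early n n \<omega> * row.late n n \<omega>\<bar> \<le> ?S \<omega>" for \<omega>
    using sum_squares_bound[of "\<bar>row.early n n \<omega>\<bar>" "\<bar>row.late n n \<omega>\<bar>"] by (simp add: abs_mult)
  have i: "integrable M ?S"
    using row.early_second_moment(1)[of n n] row.late_second_moment(1)[of n n] by simp
  show p: "integrable M (\<lambda>\<omega>. row.early n n \<omega> * row.late n n \<omega>)"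
    by (rule Bochner_Integration.integrable_bound[OF i]) (use le in \<open>auto intro!: AE_I2 intro: order_trans[OF le abs_ge_self] simp del: abs_divide abs_mult\<close>)
  have "expectation (\<lambda>\<omega>. \<bar>row.early n n \<omega> * row.late n n \<omega>\<bar>) \<le> expectation ?S"
    using p i le by (intro integral_mono) auto
  also have "\<dots> = (expectation (\<lambda>\<omega>. (row.early n n \<omega>)\<^sup>2) + expectation (\<lambda>\<omega>. (row.late n n \<omega>)\<^sup>2)) / 2"
    using row.early_second_moment(1)[of n n] row.late_second_moment(1)[of n n] by simp
  also have "\<dots> \<le> 1" using row.early_second_moment(2)[of n n] row.late_second_moment(2)[of n n] by simp
  finally show "expectation (\<lambda>\<omega>. \<bar>row.early n n \<omega> * row.late n n \<omega>\<bar>) \<le> 1" .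
qed

lemma \<rho>_bounded: "\<forall>\<^sub>F n in sequentially. \<rho> n \<le> 2"
proof -
  have "\<forall>\<^sub>F n in sequentially. row.\<kappa> n < 3"
    using \<kappa>_tendsto_0 by (rule order_tendstoD) simp
  then show ?thesis
  proof eventually_elim
    case (elim n)
    then have "(\<rho> n)\<^sup>2 \<le> 2\<^sup>2" by (simp add: row.\<kappa>_def)
    then show ?case by (rule power2_le_imp_le) simp
  qed
qed

lemma den_error_small: "small_o_p M (\<lambda>n. row.den_error n n (y n 0)) (\<lambda>_. 1)"
proof -
  have [measurable]: "row.energy n m \<in> borel_measurable M" for n m by (rule borel_measurable_integrable[OF row.energy_moment(1)])
  have r: "\<rho> n > 1" "\<rho> n ^ n \<ge> 1" for n using \<rho>_gt_1[of n] by (auto simp: one_le_power)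
  define e3 where "e3 n \<omega> = y n 0 \<omega> / row.scale n" for n \<omega>
  have [measurable]: "e3 n \<in> borel_measurable M" for n unfolding e3_def[abs_def] by measurable
  have e3: "small_o_p M e3 (\<lambda>_. 1)" unfolding e3_def[abs_def] by (rule y0_scaled_small)
  define XY where "XY n \<omega> = 1 / \<rho> n ^ n * (row.early n n \<omega> * row.late n n \<omega>)" for n \<omega>
  have [measurable]: "XY n \<in> borel_measurable M" for n unfolding XY_def[abs_def] by measurable
  have XY: "small_o_p M XY (\<lambda>_. 1)"
  proof (rule small_o_p_of_expectation[OF _ always_eventually inverse_\<rho>_power_tendsto_0], goal_cases)
    case 2
    show ?case
    proof (intro allI conjI)
      fix n
      show "integrable M (XY n)" unfolding XY_def[abs_def] by (intro integrable_mult_right early_late_product)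
      have "expectation (\<lambda>\<omega>. \<bar>XY n \<omega>\<bar>) = 1 / \<rho> n ^ n * expectation (\<lambda>\<omega>. \<bar>row.early n n \<omega> * row.late n n \<omega>\<bar>)"
        unfolding XY_def abs_mult[of "1 / \<rho> n ^ n"] using r(2)[of n] by simp
      also have "\<dots> \<le> 1 / \<rho> n ^ n * 1"
        using r(2)[of n] by (intro mult_left_mono early_late_product) auto
      finally show "expectation (\<lambda>\<omega>. \<bar>XY n \<omega>\<bar>) \<le> 1 / \<rho> n ^ n" by simp
    qed
  qed measurable
  define Q where "Q n \<omega> = - (row.energy n n \<omega> / ((\<rho> n ^ n)\<^sup>2 * (row.scale n)\<^sup>2))" for n \<omega>
  have [measurable]: "Q n \<in> borel_measurable M" for n unfolding Q_def[abs_def] by measurable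
  have Q: "small_o_p M Q (\<lambda>_. 1)"
  proof (rule small_o_p_of_expectation[OF _ always_eventually \<rho>_rate'], goal_cases)
    case 2
    show ?case
    proof (intro allI conjI)
      fix n
      have k: "row.\<kappa> n > 0" "row.stat_mean n \<ge> 1" by (rule row.\<kappa>_pos row.stat_mean_ge_1)+
      show "integrable M (Q n)" unfolding Q_def[abs_def] using row.energy_moment(1)[of n n] by simp
      have "\<rho> n ^ n * 1 \<le> (\<rho> n ^ n)\<^sup>2" unfolding power2_eq_square using r(2)[of n] by (intro mult_left_mono) auto
      then have "expectation (row.energy n n) / ((\<rho> n ^ n)\<^sup>2 * (row.scale n)\<^sup>2) \<le> (n * row.stat_mean n) / (\<rho> n ^ n * (row.scale n)\<^sup>2)"
        using r(2)[of n] k row.scale_pos[of n] by (intro frac_le row.energy_moment(2) mult_right_mono) auto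
      also have "\<dots> = row.\<kappa> n * n / \<rho> n ^ n"
        unfolding row.scale2 using r(2)[of n] k by (simp add: field_simps)
      finally show "expectation (\<lambda>\<omega>. \<bar>Q n \<omega>\<bar>) \<le> row.\<kappa> n * n / \<rho> n ^ n"
        unfolding Q_def using row.energy_moment(3)[of n n] by simp
    qed
  qed measurable
  have c1: "\<forall>\<^sub>F n in sequentially. \<bar>1 - 1 / (\<rho> n ^ n)\<^sup>2\<bar> \<le> 1"
  proof (intro always_eventually allI)
    fix n
    have "1 \<le> (\<rho> n ^ n)\<^sup>2" using r(2)[of n] by (rule one_le_power)
    then have "1 / (\<rho> n ^ n)\<^sup>2 \<le> 1"
      by (subst divide_le_eq_1_pos) linarith+
    moreover have "0 \<le> 1 / (\<rho> n ^ n)\<^sup>2" by simp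
    ultimately show "\<bar>1 - 1 / (\<rho> n ^ n)\<^sup>2\<bar> \<le> 1" by linarith
  qed
  have c2: "\<forall>\<^sub>F n in sequentially. \<bar>- 2 * \<rho> n\<bar> \<le> 4"
    using \<rho>_bounded
  proof eventually_elim
    case (elim n)
    with r(1)[of n] show ?case by simp
  qed
  have c3: "\<forall>\<^sub>F n in sequentially. \<bar>- 2 * \<rho> n / \<rho> n ^ n\<bar> \<le> 4"
    using \<rho>_bounded
  proof eventually_elim
    case (elim n)
    have "\<bar>- 2 * \<rho> n / \<rho> n ^ n\<bar> = 2 * \<rho> n / \<rho> n ^ n" using r[of n] by (simp add: abs_mult)
    also have "\<dots> \<le> 4 / 1" using elim r[of n] by (intro frac_le) auto
    finally show ?case by simp
  qed
  have c4: "\<forall>\<^sub>F n in sequentially. \<bar>2 :: real\<bar> \<le> 2" by simp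
  have "small_o_p M (\<lambda>n \<omega>. (2 * (e3 n \<omega> * row.early n n \<omega>) + (1 - 1 / (\<rho> n ^ n)\<^sup>2) * (e3 n \<omega>)\<^sup>2)
     + ((- 2 * \<rho> n) * XY n \<omega> + (- 2 * \<rho> n / \<rho> n ^ n) * row.num_error n n (y n 0) \<omega>) + Q n \<omega>) (\<lambda>_. 1)"
    by (intro small_o_p_add small_o_p_scale[OF _ _ c1] small_o_p_scale[OF XY _ c2] small_o_p_scale[OF num_error_small _ c3]
        small_o_p_scale[OF _ _ c4] small_o_p_mult_second_moment[OF e3] small_o_p_square[OF e3] Q row.early_second_moment)
       measurable
  also have "(\<lambda>n \<omega>. (2 * (e3 n \<omega> * row.early n n \<omega>) + (1 - 1 / (\<rho> n ^ n)\<^sup>2) * (e3 n \<omega>)\<^sup>2)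
     + ((- 2 * \<rho> n) * XY n \<omega> + (- 2 * \<rho> n / \<rho> n ^ n) * row.num_error n n (y n 0) \<omega>) + Q n \<omega>) = (\<lambda>n. row.den_error n n (y n 0))"
    unfolding row.den_error_def e3_def XY_def Q_def by (intro ext) (simp add: distrib_left)
  finally show ?thesis .
qed

lemma scaled_error_eq:
  assumes "\<omega> \<in> space M"
  shows "scaled_error n \<omega> = (row.early n n \<omega> * row.late n n \<omega> + row.num_error n n (y n 0) \<omega>) /
    ((row.early n n \<omega>)\<^sup>2 + row.den_error n n (y n 0) \<omega>)"
  unfolding scaled_error_def
  by (rule row.normalized_estimation_error) (use assms y_eq in \<open>auto simp: row.u_def row.vol_def\<close>)

lemma scaled_error_tends_to_cauchy:
  assumes "w > 0"
  shows "(\<lambda>n. prob {\<omega>\<in>space M. \<bar>scaled_error n \<omega>\<bar> \<le> w}) \<longlonglongrightarrow> 2 * arctan w / pi"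
proof -
  have "{\<omega>\<in>space M. \<bar>scaled_error n \<omega>\<bar> \<le> w} = {\<omega>\<in>space M. \<bar>(row.early n n \<omega> * row.late n n \<omega> + row.num_error n n (y n 0) \<omega>) /
    ((row.early n n \<omega>)\<^sup>2 + row.den_error n n (y n 0) \<omega>)\<bar> \<le> w}" for n
    by (auto simp: scaled_error_eq)
  then show ?thesis
    using perturbed_ratio_tends_to_cauchy[where X="\<lambda>n. row.early n n" and Y="\<lambda>n. row.late n n",
        OF _ _ _ _ early_late_clt num_error_small den_error_small assms]
    by simp
qed

lemma scaled_error_measurable[measurable]: "scaled_error n \<in> borel_measurable M"
  by (subst measurable_cong[OF scaled_error_eq]) measurable

lemma least_squares_eq:
  assumes "\<omega> \<in> space M" "scaled_error n \<omega> \<noteq> 0"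
  shows "least_squares_ar1 n (\<lambda>t. y n t \<omega>) = \<rho> n + row.\<kappa> n * scaled_error n \<omega> / \<rho> n ^ n"
proof -
  have nz: "(\<Sum>t=1..n. (y n (t - 1) \<omega>)\<^sup>2) \<noteq> 0"
    using assms(2) unfolding scaled_error_def by auto
  have "least_squares_ar1 n (\<lambda>t. y n t \<omega>) = \<rho> n + (\<Sum>t=1..n. y n (t - 1) \<omega> * row.u n t \<omega>) / (\<Sum>t=1..n. (y n (t - 1) \<omega>)\<^sup>2)"
    by (rule ar1_least_squares[OF _ nz]) (use assms(1) y_eq in \<open>auto simp: row.u_def row.vol_def\<close>)
  then show ?thesis
    unfolding scaled_error_def using row.\<kappa>_pos[of n] \<rho>_gt_1[of n] by simp
qed

end

section \<open>Interval membership as a threshold for the scaled error\<close>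

text \<open>
  Upper bound by \<open>1 + d \<le> exp d\<close>, lower bound by Bernoulli's inequality.
\<close>

lemma abs_power_one_plus_minus_one_le:
  fixes d :: real
  assumes "\<bar>d\<bar> \<le> 1"
  shows "\<bar>(1 + d) ^ n - 1\<bar> \<le> exp (n * \<bar>d\<bar>) - 1"
proof -
  have "(1 + d) ^ n \<le> exp d ^ n"
    using assms exp_ge_add_one_self[of d] by (intro power_mono) auto
  also have "\<dots> = exp (n * d)" by (simp add: exp_of_nat_mult)
  also have "\<dots> \<le> exp (n * \<bar>d\<bar>)" by (simp add: mult_left_mono)
  finally have 1: "(1 + d) ^ n \<le> exp (n * \<bar>d\<bar>)" .
  have "1 - n * \<bar>d\<bar> \<le> 1 + n * d"
  proof -
    have "real n * (- \<bar>d\<bar>) \<le> real n * d" by (intro mult_left_mono) auto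
    then show ?thesis by simp
  qed
  also have "\<dots> \<le> (1 + d) ^ n"
    using assms Bernoulli_inequality[of d n] by simp
  finally have 2: "1 - n * \<bar>d\<bar> \<le> (1 + d) ^ n" .
  have "n * \<bar>d\<bar> \<le> exp (n * \<bar>d\<bar>) - 1"
    using exp_ge_add_one_self[of "n * \<bar>d\<bar>"] by linarith
  with 1 2 show ?thesis by linarith
qed

lemma abs_mult_minus_one_le:
  fixes f g :: real
  assumes "\<bar>g\<bar> \<le> 2"
  shows "\<bar>f * g - 1\<bar> \<le> 2 * \<bar>f - 1\<bar> + \<bar>g - 1\<bar>"
proof -
  have "f * g - 1 = (f - 1) * g + (g - 1)" by (simp add: algebra_simps)
  then have "\<bar>f * g - 1\<bar> \<le> \<bar>f - 1\<bar> * \<bar>g\<bar> + \<bar>g - 1\<bar>"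
    using abs_triangle_ineq[of "(f - 1) * g" "g - 1"] by (simp add: abs_mult)
  also have "\<dots> \<le> \<bar>f - 1\<bar> * 2 + \<bar>g - 1\<bar>" using assms by (intro add_mono mult_left_mono) auto
  finally show ?thesis by simp
qed

text \<open>
  Bounds, for \<open>\<bar>T\<bar> \<le> K\<close>, the distortion by the factor \<open>(\<rho>hat / \<rho>)\<^sup>n\<close>, by \<open>(\<rho> + 1) / 2\<close>
  and by the relative error of \<open>\<rho>hat - 1\<close>, in this order.
\<close>

definition interval_distortion :: "real \<Rightarrow> nat \<Rightarrow> real \<Rightarrow> real" where
  "interval_distortion \<rho> n K =
    4 * (exp (K * ((\<rho>\<^sup>2 - 1) * n / \<rho> ^ n)) - 1) + (\<rho>\<^sup>2 - 1) + 6 * K * (1 / \<rho> ^ n)"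

text \<open>
  The event \<open>Q\<close> is \<open>\<bar>T\<bar> \<le> z\<close> up to a relative distortion \<open>\<mu>\<close> of both sides.
\<close>

definition threshold_within :: "real \<Rightarrow> real \<Rightarrow> real \<Rightarrow> bool \<Rightarrow> bool" where
  "threshold_within \<mu> z T Q \<longleftrightarrow>
    (\<exists>F F'. \<bar>F - 1\<bar> \<le> \<mu> \<and> \<bar>F' - 1\<bar> \<le> \<mu> \<and> (Q \<longleftrightarrow> \<bar>T\<bar> * F \<le> z * F'))"

text \<open>
  With \<open>r - 1 = (\<rho> - 1) (1 + h)\<close> and \<open>r\<^sup>n = \<rho>\<^sup>n m\<close>, the half-width of the first interval is
  \<open>2 z (\<rho> - 1) (1 + h) / (\<rho>\<^sup>n m)\<close>, to be compared with \<open>\<bar>r - \<rho>\<bar> = \<kappa> \<bar>T\<bar> / \<rho>\<^sup>n\<close>.  For the second interval,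
  \<open>\<gamma> - g = ln (1 + h) / ln n\<close>, and \<open>\<bar>ln (1 + h)\<bar>\<close> is \<open>\<bar>h\<bar>\<close> up to a factor close to 1.
\<close>

lemma interval_membership:
  fixes \<rho> T K z \<gamma> :: real and n :: nat
  defines "\<mu> \<equiv> interval_distortion \<rho> n K"
    and "r \<equiv> \<rho> + (\<rho>\<^sup>2 - 1) * T / \<rho> ^ n"
  defines "g \<equiv> - ln \<bar>r - 1\<bar> / ln (real n)"
  assumes \<rho>: "1 < \<rho>" "\<rho> \<le> 2" and T: "T \<noteq> 0" "\<bar>T\<bar> \<le> K" and n: "n \<ge> 2"
    and \<mu>: "\<mu> \<le> 1 / 2" and \<gamma>: "\<rho> = 1 + real n powr (- \<gamma>)"
  shows "r > 1"
    and "threshold_within \<mu> z T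
      (\<rho> \<in> {r - z * (2 / (real n powr g * r ^ n)) .. r + z * (2 / (real n powr g * r ^ n))})"
    and "threshold_within \<mu> z T
      (\<gamma> \<in> {g - z * (2 / ((1 + real n powr (- g)) ^ n * ln (real n))) ..
            g + z * (2 / ((1 + real n powr (- g)) ^ n * ln (real n)))})"
proof -
  define R where "R = \<rho> ^ n"
  define \<kappa> where "\<kappa> = \<rho>\<^sup>2 - 1"
  define h where "h = (\<rho> + 1) * T / R"
  define d where "d = \<kappa> * T / (\<rho> * R)"
  define m where "m = (1 + d) ^ n"
  have R: "R > 1" unfolding R_def using \<rho> n by (intro one_less_power) auto
  have \<kappa>: "\<kappa> = (\<rho> - 1) * (\<rho> + 1)" unfolding \<kappa>_def by (simp add: power2_eq_square algebra_simps)
  have \<kappa>0: "\<kappa> > 0" unfolding \<kappa> using \<rho> by simp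
  have K: "K > 0" using T by auto
  define E where "E = exp (K * (\<kappa> * n / R)) - 1"
  have E0: "0 \<le> E" unfolding E_def using K \<kappa>0 R by simp
  define k where "k = K / R"
  have \<mu>_eq: "\<mu> = 4 * E + \<kappa> + 6 * k"
    unfolding \<mu>_def interval_distortion_def E_def \<kappa>_def R_def k_def by simp
  have KR: "0 < k" unfolding k_def using K R by simp
  have h: "\<bar>h\<bar> \<le> 3 * k" "h \<noteq> 0"
  proof -
    have "\<bar>h\<bar> = (\<rho> + 1) * \<bar>T\<bar> / R" unfolding h_def using \<rho> R by (simp add: abs_mult)
    also have "\<dots> \<le> 3 * K / R" using \<rho> T R by (intro divide_right_mono mult_mono) auto
    finally show "\<bar>h\<bar> \<le> 3 * k" by (simp add: k_def)
    show "h \<noteq> 0" unfolding h_def using \<rho> R T by simp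
  qed
  have h': "\<bar>h\<bar> \<le> 1 / 4" using h(1) \<mu> \<mu>_eq E0 \<kappa>0 KR by simp
  have d_le: "\<bar>d\<bar> \<le> K * \<kappa> / R"
  proof -
    have "\<bar>d\<bar> = \<kappa> * \<bar>T\<bar> / (\<rho> * R)" unfolding d_def using \<rho> R \<kappa>0 by (simp add: abs_mult)
    also have "\<dots> \<le> \<kappa> * K / (1 * R)" using \<rho> T R \<kappa>0 by (intro frac_le mult_mono) auto
    finally show ?thesis by (simp add: mult.commute)
  qed
  have m: "\<bar>m - 1\<bar> \<le> E"
  proof -
    have "K * \<kappa> / R = k * \<kappa>" by (simp add: k_def)
    also have "\<dots> \<le> 1 / 12 * 1"
      using \<mu> \<mu>_eq E0 \<kappa>0 KR by (intro mult_mono) auto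
    finally have "K * \<kappa> / R \<le> 1 / 12 * 1" .
    with d_le have "\<bar>d\<bar> \<le> 1 / 12 * 1" by (rule order_trans)
    then have "\<bar>d\<bar> \<le> 1" by simp
    then have "\<bar>m - 1\<bar> \<le> exp (n * \<bar>d\<bar>) - 1" unfolding m_def by (rule abs_power_one_plus_minus_one_le)
    also have "\<dots> \<le> E"
      unfolding E_def using mult_left_mono[OF d_le, of "real n"] by (simp add: mult_ac)
    finally show ?thesis .
  qed
  have m0: "m > 0" using m \<mu> \<mu>_eq \<kappa>0 KR by linarith
  have r1: "r - 1 = (\<rho> - 1) * (1 + h)"
    unfolding r_def h_def \<kappa>_def[symmetric] R_def[symmetric] \<kappa> using R by (simp add: field_simps)
  have r\<rho>: "r - \<rho> = \<kappa> * T / R" unfolding r_def \<kappa>_def R_def by simp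
  have rn: "r ^ n = R * m"
  proof -
    have "r = \<rho> * (1 + d)"
      unfolding r_def d_def \<kappa>_def[symmetric] R_def[symmetric] using \<rho> R by (simp add: field_simps)
    then show ?thesis by (simp add: power_mult_distrib R_def m_def)
  qed
  have r1_pos: "r - 1 > 0" unfolding r1 using \<rho> h' by (intro mult_pos_pos) auto
  then show "r > 1" by simp
  have ln_n: "ln (real n) > 0" using n by simp
  have pg: "real n powr (- g) = r - 1"
    unfolding g_def powr_def using r1_pos ln_n n by simp
  have pg': "1 / real n powr g = r - 1"
    using pg by (simp add: powr_minus_divide)
  have f1: "\<bar>m * (\<rho> + 1) / 2 - 1\<bar> \<le> 2 * E + \<kappa> / 2"
  proof -
    have "m * (\<rho> + 1) / 2 - 1 = (m - 1) * ((\<rho> + 1) / 2) + (\<rho> - 1) / 2" by (simp add: field_simps)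
    then have "\<bar>m * (\<rho> + 1) / 2 - 1\<bar> \<le> \<bar>m - 1\<bar> * ((\<rho> + 1) / 2) + (\<rho> - 1) / 2"
      using \<rho> abs_triangle_ineq[of "(m - 1) * ((\<rho> + 1) / 2)" "(\<rho> - 1) / 2"] by (simp add: abs_mult)
    also have "\<dots> \<le> E * 2 + \<kappa> / 2"
    proof (intro add_mono mult_mono m divide_right_mono)
      show "\<rho> - 1 \<le> \<kappa>" unfolding \<kappa> using \<rho> mult_left_mono[of 1 "\<rho> + 1" "\<rho> - 1"] by simp
    qed (use \<rho> E0 in auto)
    finally show ?thesis by simp
  qed
  show "threshold_within \<mu> z T
      (\<rho> \<in> {r - z * (2 / (real n powr g * r ^ n)) .. r + z * (2 / (real n powr g * r ^ n))})"
    unfolding threshold_within_def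
  proof (intro exI conjI)
    show "\<bar>m * (\<rho> + 1) / 2 - 1\<bar> \<le> \<mu>" using f1 E0 \<kappa>0 KR \<mu>_eq by simp
    show "\<bar>(1 + h) - 1\<bar> \<le> \<mu>" using h(1) E0 \<kappa>0 KR \<mu>_eq by simp
    have "2 / (real n powr g * r ^ n) = 2 * (1 / real n powr g) / r ^ n" by simp
    also have "\<dots> = 2 * (\<rho> - 1) * (1 + h) / (R * m)" unfolding pg' rn r1 by simp
    finally have w: "2 / (real n powr g * r ^ n) = 2 * (\<rho> - 1) * (1 + h) / (R * m)" .
    have "\<rho> \<in> {r - z * (2 / (real n powr g * r ^ n)) .. r + z * (2 / (real n powr g * r ^ n))} \<longleftrightarrow>
        \<bar>r - \<rho>\<bar> \<le> z * (2 / (real n powr g * r ^ n))"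
      unfolding atLeastAtMost_iff abs_le_iff by linarith
    also have "\<bar>r - \<rho>\<bar> = \<kappa> * \<bar>T\<bar> / R" unfolding r\<rho> using \<kappa>0 R by (simp add: abs_mult)
    also have "(\<kappa> * \<bar>T\<bar> / R \<le> z * (2 / (real n powr g * r ^ n))) \<longleftrightarrow> (\<kappa> * \<bar>T\<bar> * m \<le> z * (2 * (\<rho> - 1) * (1 + h)))"
      unfolding w using R m0 by (simp add: field_simps)
    also have "\<dots> \<longleftrightarrow> (2 * (\<rho> - 1)) * (\<bar>T\<bar> * (m * (\<rho> + 1) / 2)) \<le> (2 * (\<rho> - 1)) * (z * (1 + h))"
    proof -
      have e1: "\<kappa> * \<bar>T\<bar> * m = (2 * (\<rho> - 1)) * (\<bar>T\<bar> * (m * (\<rho> + 1) / 2))" unfolding \<kappa> by simp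
      have e2: "z * (2 * (\<rho> - 1) * (1 + h)) = (2 * (\<rho> - 1)) * (z * (1 + h))" by simp
      show ?thesis unfolding e1 e2 ..
    qed
    also have "\<dots> \<longleftrightarrow> \<bar>T\<bar> * (m * (\<rho> + 1) / 2) \<le> z * (1 + h)"
      using \<rho> by (subst mult_le_cancel_left_pos) auto
    finally show "\<rho> \<in> {r - z * (2 / (real n powr g * r ^ n)) .. r + z * (2 / (real n powr g * r ^ n))} \<longleftrightarrow>
       \<bar>T\<bar> * (m * (\<rho> + 1) / 2) \<le> z * (1 + h)" .
  qed
  show "threshold_within \<mu> z T
      (\<gamma> \<in> {g - z * (2 / ((1 + real n powr (- g)) ^ n * ln (real n))) ..
            g + z * (2 / ((1 + real n powr (- g)) ^ n * ln (real n)))})"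
    unfolding threshold_within_def
  proof (intro exI conjI)
    define f where "f = \<bar>ln (1 + h)\<bar> / \<bar>h\<bar>"
    have f: "\<bar>f - 1\<bar> \<le> 6 * k"
    proof -
      have "\<bar>ln (1 + h) - h\<bar> \<le> 2 * h\<^sup>2"
        using h' by (intro abs_ln_one_plus_x_minus_x_bound) auto
      then have "\<bar>\<bar>ln (1 + h)\<bar> - \<bar>h\<bar>\<bar> \<le> 2 * \<bar>h\<bar> * \<bar>h\<bar>"
        by (simp add: power2_eq_square mult.assoc)
      moreover have "\<bar>f - 1\<bar> = \<bar>\<bar>ln (1 + h)\<bar> - \<bar>h\<bar>\<bar> / \<bar>h\<bar>"
      proof -
        have "f - 1 = (\<bar>ln (1 + h)\<bar> - \<bar>h\<bar>) / \<bar>h\<bar>" unfolding f_def using h(2) by (simp add: diff_divide_distrib)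
        then show ?thesis by simp
      qed
      ultimately have "\<bar>f - 1\<bar> \<le> 2 * \<bar>h\<bar>" using h(2) by (simp add: pos_divide_le_eq)
      then show ?thesis using h(1) by simp
    qed
    have "\<bar>f\<bar> \<le> 2" using f \<mu> \<mu>_eq E0 \<kappa>0 by linarith
    then have "\<bar>m * (\<rho> + 1) / 2 * f - 1\<bar> \<le> 2 * \<bar>m * (\<rho> + 1) / 2 - 1\<bar> + \<bar>f - 1\<bar>"
      by (rule abs_mult_minus_one_le)
    also have "\<dots> \<le> 2 * (2 * E + \<kappa> / 2) + 6 * k"
      by (intro add_mono mult_left_mono f1 f) simp
    finally show "\<bar>m * (\<rho> + 1) / 2 * f - 1\<bar> \<le> \<mu>" unfolding \<mu>_eq by simp
    show "\<bar>1 - 1\<bar> \<le> \<mu>" using \<mu>_eq E0 \<kappa>0 KR by simp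
    have "ln (\<rho> - 1) = - \<gamma> * ln (real n)"
      using \<gamma> n by (simp add: ln_powr)
    then have \<gamma>': "\<gamma> = - ln (\<rho> - 1) / ln (real n)" using ln_n by simp
    have "ln \<bar>r - 1\<bar> = ln (\<rho> - 1) + ln (1 + h)"
      using r1_pos unfolding r1 using \<rho> h' by (simp add: ln_mult abs_mult)
    then have gg: "\<gamma> - g = ln (1 + h) / ln (real n)"
      unfolding \<gamma>' g_def by (simp add: add_divide_distrib diff_divide_distrib)
    have w: "2 / ((1 + real n powr (- g)) ^ n * ln (real n)) = 2 / (R * m) / ln (real n)"
      unfolding pg rn[symmetric] by simp
    have "\<gamma> \<in> {g - z * (2 / ((1 + real n powr (- g)) ^ n * ln (real n))) ..
            g + z * (2 / ((1 + real n powr (- g)) ^ n * ln (real n)))} \<longleftrightarrow>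
       \<bar>\<gamma> - g\<bar> \<le> z * (2 / ((1 + real n powr (- g)) ^ n * ln (real n)))"
      unfolding atLeastAtMost_iff abs_le_iff by linarith
    also have "\<dots> \<longleftrightarrow> \<bar>ln (1 + h)\<bar> / ln (real n) \<le> z * (2 / (R * m)) / ln (real n)"
      unfolding gg w using ln_n by simp
    also have "\<dots> \<longleftrightarrow> \<bar>ln (1 + h)\<bar> \<le> z * (2 / (R * m))"
      using ln_n by (subst divide_le_cancel) auto
    also have "\<dots> \<longleftrightarrow> R / 2 * \<bar>ln (1 + h)\<bar> * m \<le> z"
      using R m0 by (simp add: field_simps)
    also have "R / 2 * \<bar>ln (1 + h)\<bar> * m = \<bar>T\<bar> * (m * (\<rho> + 1) / 2 * f)"
    proof -
      have "\<bar>ln (1 + h)\<bar> = \<bar>h\<bar> * f" unfolding f_def using h(2) by simp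
      also have "\<bar>h\<bar> = (\<rho> + 1) * \<bar>T\<bar> / R" unfolding h_def using \<rho> R by (simp add: abs_mult)
      finally show ?thesis using R by simp
    qed
    finally show "\<gamma> \<in> {g - z * (2 / ((1 + real n powr (- g)) ^ n * ln (real n))) ..
            g + z * (2 / ((1 + real n powr (- g)) ^ n * ln (real n)))} \<longleftrightarrow> \<bar>T\<bar> * (m * (\<rho> + 1) / 2 * f) \<le> z * 1"
      by simp
  qed
qed

lemma threshold_withinD:
  fixes T z \<tau> \<mu> :: real
  assumes "threshold_within \<mu> z T Q" "\<mu> \<le> 1 / 2" "\<mu> * (2 * z + \<tau>) \<le> \<tau>" "z > 0" "\<tau> > 0"
  shows "(Q \<longrightarrow> \<bar>T\<bar> \<le> z + \<tau>) \<and> (\<bar>T\<bar> \<le> z - \<tau> \<longrightarrow> Q)"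
proof -
  obtain F F' where FF: "\<bar>F - 1\<bar> \<le> \<mu>" "\<bar>F' - 1\<bar> \<le> \<mu>" and Q: "Q \<longleftrightarrow> \<bar>T\<bar> * F \<le> z * F'"
    using assms(1) unfolding threshold_within_def by blast
  have F: "1 - \<mu> \<le> F" "F \<le> 1 + \<mu>" "1 - \<mu> \<le> F'" "F' \<le> 1 + \<mu>" "F > 0" "\<mu> \<ge> 0" using FF assms(2) by auto
  show ?thesis
    unfolding Q
proof (intro conjI impI)
  show "\<bar>T\<bar> \<le> z + \<tau>" if "\<bar>T\<bar> * F \<le> z * F'"
  proof -
    have "z * F' \<le> z * (1 + \<mu>)" using F assms by (intro mult_left_mono) auto
    with that have "\<bar>T\<bar> * F \<le> z * (1 + \<mu>)" by simp
    also have "\<dots> \<le> (z + \<tau>) * (1 - \<mu>)" using assms by (simp add: algebra_simps)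
    also have "\<dots> \<le> (z + \<tau>) * F" using F assms by (intro mult_left_mono) auto
    finally show ?thesis using F(5) by simp
  qed
  show "\<bar>T\<bar> * F \<le> z * F'" if "\<bar>T\<bar> \<le> z - \<tau>"
  proof -
    have "\<bar>T\<bar> * F \<le> (z - \<tau>) * (1 + \<mu>)" using that F by (intro mult_mono) auto
    also have "\<dots> = z - \<tau> + \<mu> * (2 * z + \<tau>) - \<mu> * (z + 2 * \<tau>)" by (simp add: algebra_simps)
    also have "\<dots> \<le> z - \<mu> * z"
    proof -
      have "0 \<le> \<mu> * (2 * \<tau>)" using F assms by simp
      moreover have "\<mu> * (z + 2 * \<tau>) = \<mu> * z + \<mu> * (2 * \<tau>)" by (simp add: algebra_simps)
      ultimately show ?thesis using assms(3) by linarith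
    qed
    also have "\<dots> = z * (1 - \<mu>)" by (simp add: algebra_simps)
    also have "\<dots> \<le> z * F'" using F assms by (intro mult_left_mono) auto
    finally show ?thesis .
  qed
  qed
qed

context sv_array
begin

definition \<rho>hat :: "nat \<Rightarrow> 'a \<Rightarrow> real" where
  "\<rho>hat n \<omega> = least_squares_ar1 n (\<lambda>t. y n t \<omega>)"

definition \<gamma>hat :: "nat \<Rightarrow> 'a \<Rightarrow> real" where
  "\<gamma>hat n \<omega> = - ln \<bar>\<rho>hat n \<omega> - 1\<bar> / ln (real n)"

lemma y_measurable: "t \<le> n \<Longrightarrow> y n t \<in> borel_measurable M"
proof (induction t)
  case (Suc t)
  have [measurable]: "\<epsilon> (Suc t) \<in> borel_measurable M" by (rule \<epsilon>_measurable) (simp add: One_nat_def)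
  have [measurable]: "y n t \<in> borel_measurable M" using Suc by simp
  have "y n (Suc t) \<omega> = \<rho> n * y n t \<omega> + row.vol n (Suc t) \<omega> * \<epsilon> (Suc t) \<omega>" if "\<omega> \<in> space M" for \<omega>
    using y_eq[of "Suc t" n \<omega>] Suc.prems that by (simp add: row.vol_def One_nat_def)
  then show ?case
    by (subst measurable_cong) measurable
qed simp

lemma \<rho>hat_measurable[measurable]: "\<rho>hat n \<in> borel_measurable M"
  unfolding \<rho>hat_def[abs_def] least_squares_ar1_def
  by (intro borel_measurable_divide borel_measurable_sum borel_measurable_times borel_measurable_power y_measurable) auto

lemma \<gamma>hat_measurable[measurable]: "\<gamma>hat n \<in> borel_measurable M"
  unfolding \<gamma>hat_def[abs_def] by measurable

lemma interval_distortion_tendsto_0: "(\<lambda>n. interval_distortion (\<rho> n) n K) \<longlonglongrightarrow> 0"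
proof -
  have "(\<lambda>n. interval_distortion (\<rho> n) n K) \<longlonglongrightarrow> 4 * (exp (K * 0) - 1) + 0 + 6 * K * 0"
    unfolding interval_distortion_def using \<kappa>_tendsto_0 unfolding row.\<kappa>_def
    by (intro tendsto_intros \<rho>_rate inverse_\<rho>_power_tendsto_0)
  then show ?thesis by simp
qed

text \<open>
  Besides tightness, the scaled error is nonzero with probability tending to 1, because its limit
  law has no atom at 0.  This rules out a vanishing denominator in the estimator.
\<close>

lemma scaled_error_exceptional_events:
  assumes "\<epsilon>0 > 0"
  shows "\<exists>K B. (\<forall>n. B n \<in> events) \<and> (\<forall>\<^sub>F n in sequentially. prob (B n) \<le> \<epsilon>0) \<and>
    (\<forall>n. \<forall>\<omega>\<in>space M - B n. scaled_error n \<omega> \<noteq> 0 \<and> \<bar>scaled_error n \<omega>\<bar> \<le> K)"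
proof -
  have "((\<lambda>K. 2 * arctan K / pi) \<longlongrightarrow> 2 * (pi / 2) / pi) at_top"
    by (intro tendsto_intros tendsto_arctan_at_top) auto
  then have "\<forall>\<^sub>F K in at_top. 2 * arctan K / pi > 1 - \<epsilon>0 / 2"
    using assms by (intro order_tendstoD(1)) auto
  then have "\<forall>\<^sub>F K in at_top. 2 * arctan K / pi > 1 - \<epsilon>0 / 2 \<and> K > 0"
    using eventually_gt_at_top[of 0] by (rule eventually_conj)
  then obtain K where K: "2 * arctan K / pi > 1 - \<epsilon>0 / 2" "K > 0"
    by (auto dest: eventually_happens)
  have "((\<lambda>w. 2 * arctan w / pi) \<longlongrightarrow> 2 * arctan 0 / pi) (at_right 0)"
    by (intro tendsto_intros) auto
  then have "\<forall>\<^sub>F w in at_right 0. 2 * arctan w / pi < \<epsilon>0 / 2"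
    using assms by (intro order_tendstoD(2)) auto
  then have "\<forall>\<^sub>F w in at_right 0. 2 * arctan w / pi < \<epsilon>0 / 2 \<and> w > 0"
    using eventually_at_right_less[of 0] by (rule eventually_conj)
  then obtain w where w: "2 * arctan w / pi < \<epsilon>0 / 2" "w > 0"
    by (auto dest: eventually_happens)
  define B1 where "B1 n = space M - {\<omega>\<in>space M. \<bar>scaled_error n \<omega>\<bar> \<le> K}" for n
  define B2 where "B2 n = {\<omega>\<in>space M. \<bar>scaled_error n \<omega>\<bar> \<le> w}" for n
  have sets: "B1 n \<in> events" "B2 n \<in> events" for n
    unfolding B1_def B2_def by measurable
  have "\<forall>\<^sub>F n in sequentially. prob {\<omega>\<in>space M. \<bar>scaled_error n \<omega>\<bar> \<le> K} > 1 - \<epsilon>0 / 2"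
    using scaled_error_tends_to_cauchy[OF K(2)] K(1) by (rule order_tendstoD)
  then have e1: "\<forall>\<^sub>F n in sequentially. prob (B1 n) < \<epsilon>0 / 2"
    by eventually_elim (auto simp: B1_def prob_compl)
  have e2: "\<forall>\<^sub>F n in sequentially. prob (B2 n) < \<epsilon>0 / 2"
    unfolding B2_def using scaled_error_tends_to_cauchy[OF w(2)] w(1) by (rule order_tendstoD)
  show ?thesis
  proof (intro exI[of _ K] exI[of _ "\<lambda>n. B1 n \<union> B2 n"] conjI allI ballI)
    show "\<forall>\<^sub>F n in sequentially. prob (B1 n \<union> B2 n) \<le> \<epsilon>0"
      using e1 e2
    proof eventually_elim
      case (elim n)
      then show ?case using measure_Un_le[OF sets(1)[of n] sets(2)[of n]] by simp
    qed
    fix n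
    show "B1 n \<union> B2 n \<in> events" using sets by auto
    fix \<omega> assume \<omega>: "\<omega> \<in> space M - (B1 n \<union> B2 n)"
    show "scaled_error n \<omega> \<noteq> 0" "\<bar>scaled_error n \<omega>\<bar> \<le> K"
      using \<omega> w(2) by (auto simp: B1_def B2_def)
  qed
qed

lemma \<rho>hat_eq_scaled_error: "\<omega> \<in> space M \<Longrightarrow> scaled_error n \<omega> \<noteq> 0 \<Longrightarrow> \<rho>hat n \<omega> = \<rho> n + ((\<rho> n)\<^sup>2 - 1) * scaled_error n \<omega> / \<rho> n ^ n"
  unfolding \<rho>hat_def using least_squares_eq by (simp add: row.\<kappa>_def)

definition \<rho>_covered :: "real \<Rightarrow> nat \<Rightarrow> 'a \<Rightarrow> bool" where
  "\<rho>_covered z n \<omega> \<longleftrightarrow>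
     \<rho> n \<in> {\<rho>hat n \<omega> - z * (2 / (real n powr \<gamma>hat n \<omega> * \<rho>hat n \<omega> ^ n)) ..
            \<rho>hat n \<omega> + z * (2 / (real n powr \<gamma>hat n \<omega> * \<rho>hat n \<omega> ^ n))}"

definition \<gamma>_covered :: "(nat \<Rightarrow> real) \<Rightarrow> real \<Rightarrow> nat \<Rightarrow> 'a \<Rightarrow> bool" where
  "\<gamma>_covered \<gamma> z n \<omega> \<longleftrightarrow>
     \<gamma> n \<in> {\<gamma>hat n \<omega> - z * (2 / ((1 + real n powr (- \<gamma>hat n \<omega>)) ^ n * ln (real n))) ..
            \<gamma>hat n \<omega> + z * (2 / ((1 + real n powr (- \<gamma>hat n \<omega>)) ^ n * ln (real n)))}"

lemma covered_measurable[measurable]: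
  "Measurable.pred M (\<rho>_covered z n)" "Measurable.pred M (\<gamma>_covered \<gamma> z n)"
  unfolding \<rho>_covered_def[abs_def] \<gamma>_covered_def[abs_def] atLeastAtMost_iff by measurable

lemma covered_threshold:
  assumes \<gamma>: "\<forall>\<^sub>F n in sequentially. \<rho> n = 1 + real n powr (- \<gamma> n)"
  shows "\<forall>\<^sub>F n in sequentially. \<forall>\<omega>\<in>space M. scaled_error n \<omega> \<noteq> 0 \<and> \<bar>scaled_error n \<omega>\<bar> \<le> K \<longrightarrow> \<rho>hat n \<omega> > 1 \<and>
      threshold_within (interval_distortion (\<rho> n) n K) z (scaled_error n \<omega>) (\<rho>_covered z n \<omega>) \<and>
      threshold_within (interval_distortion (\<rho> n) n K) z (scaled_error n \<omega>) (\<gamma>_covered \<gamma> z n \<omega>)"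
proof -
  have "\<forall>\<^sub>F n in sequentially. interval_distortion (\<rho> n) n K < 1 / 2"
    by (rule order_tendstoD(2)[OF interval_distortion_tendsto_0]) simp
  then show ?thesis
    using \<rho>_bounded \<gamma> eventually_ge_at_top[of 2]
  proof eventually_elim
    case (elim n)
    have \<mu>: "interval_distortion (\<rho> n) n K \<le> 1 / 2" using elim(1) by simp
    show ?case
    proof (intro ballI impI)
      fix \<omega> assume \<omega>: "\<omega> \<in> space M" and st: "scaled_error n \<omega> \<noteq> 0 \<and> \<bar>scaled_error n \<omega>\<bar> \<le> K"
      note eq = \<rho>hat_eq_scaled_error[OF \<omega> conjunct1[OF st], symmetric]
      note im = interval_membership[OF \<rho>_gt_1 elim(2) conjunct1[OF st] conjunct2[OF st] elim(4) \<mu> elim(3),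
          unfolded eq, folded \<gamma>hat_def]
      show "\<rho>hat n \<omega> > 1 \<and>
        threshold_within (interval_distortion (\<rho> n) n K) z (scaled_error n \<omega>) (\<rho>_covered z n \<omega>) \<and>
        threshold_within (interval_distortion (\<rho> n) n K) z (scaled_error n \<omega>) (\<gamma>_covered \<gamma> z n \<omega>)"
        unfolding \<rho>_covered_def \<gamma>_covered_def by (intro conjI im)
    qed
  qed
qed

text \<open>
  The common end of both interval statements: the event \<open>\<rho>hat > 1\<close> has probability tending to
  1, so conditioning on it does not change the limit.
\<close>

lemma coverage:
  fixes P :: "nat \<Rightarrow> 'a \<Rightarrow> bool"
  assumes z: "z > 0" and P[measurable]: "\<And>n. Measurable.pred M (P n)"
    and threshold: "\<And>K. \<forall>\<^sub>F n in sequentially. \<forall>\<omega>\<in>space M. scaled_error n \<omega> \<noteq> 0 \<and> \<bar>scaled_error n \<omega>\<bar> \<le> K \<longrightarrow>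
      \<rho>hat n \<omega> > 1 \<and> threshold_within (interval_distortion (\<rho> n) n K) z (scaled_error n \<omega>) (P n \<omega>)"
  shows "(\<lambda>n. \<P>(\<omega> in M. P n \<omega> \<bar> \<rho>hat n \<omega> > 1)) \<longlonglongrightarrow> 2 * arctan z / pi"
proof -
  have key: "\<forall>\<^sub>F n in sequentially. \<forall>\<omega>\<in>space M. scaled_error n \<omega> \<noteq> 0 \<and> \<bar>scaled_error n \<omega>\<bar> \<le> K \<longrightarrow>
      \<rho>hat n \<omega> > 1 \<and> (P n \<omega> \<longrightarrow> \<bar>scaled_error n \<omega>\<bar> \<le> z + \<tau>) \<and> (\<bar>scaled_error n \<omega>\<bar> \<le> z - \<tau> \<longrightarrow> P n \<omega>)"
    if \<tau>: "\<tau> > 0" for K \<tau>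
  proof -
    have "\<forall>\<^sub>F n in sequentially. interval_distortion (\<rho> n) n K < 1 / 2"
      by (rule order_tendstoD(2)[OF interval_distortion_tendsto_0]) simp
    moreover have "\<forall>\<^sub>F n in sequentially. interval_distortion (\<rho> n) n K < \<tau> / (2 * z + \<tau>)"
      by (rule order_tendstoD(2)[OF interval_distortion_tendsto_0]) (use z \<tau> in simp)
    ultimately show ?thesis
      using threshold[of K]
    proof eventually_elim
      case (elim n)
      have \<mu>: "interval_distortion (\<rho> n) n K \<le> 1 / 2" "interval_distortion (\<rho> n) n K * (2 * z + \<tau>) \<le> \<tau>"
        using elim(1,2) z \<tau> by (auto simp: pos_less_divide_eq)
      show ?case
      proof (intro ballI impI)
        fix \<omega> assume "\<omega> \<in> space M" "scaled_error n \<omega> \<noteq> 0 \<and> \<bar>scaled_error n \<omega>\<bar> \<le> K"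
        then have "\<rho>hat n \<omega> > 1" and "threshold_within (interval_distortion (\<rho> n) n K) z (scaled_error n \<omega>) (P n \<omega>)"
          using elim(3) by blast+
        with threshold_withinD[OF this(2) \<mu> z \<tau>]
        show "\<rho>hat n \<omega> > 1 \<and> (P n \<omega> \<longrightarrow> \<bar>scaled_error n \<omega>\<bar> \<le> z + \<tau>) \<and> (\<bar>scaled_error n \<omega>\<bar> \<le> z - \<tau> \<longrightarrow> P n \<omega>)"
          by blast
      qed
    qed
  qed
  have m1: "{\<omega>\<in>space M. P n \<omega> \<and> \<rho>hat n \<omega> > 1} \<in> events" for n by measurable
  have m2: "{\<omega>\<in>space M. \<rho>hat n \<omega> > 1} \<in> events" for n by measurable
  have joint: "(\<lambda>n. prob {\<omega>\<in>space M. P n \<omega> \<and> \<rho>hat n \<omega> > 1}) \<longlonglongrightarrow> 2 * arctan z / pi"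
  proof (rule limit_of_sandwiched_events[where U=scaled_error and G="\<lambda>w. 2 * arctan w / pi", OF scaled_error_measurable m1 scaled_error_tends_to_cauchy z])
    show "isCont (\<lambda>w. 2 * arctan w / pi) z" by (intro continuous_intros) auto
    fix \<tau> \<epsilon>0 :: real assume \<tau>: "\<tau> > 0" and \<epsilon>0: "\<epsilon>0 > 0"
    obtain K B where Bs: "\<forall>n. B n \<in> events" and B2: "\<forall>\<^sub>F n in sequentially. prob (B n) \<le> \<epsilon>0"
      and B3: "\<forall>n. \<forall>\<omega>\<in>space M - B n. scaled_error n \<omega> \<noteq> 0 \<and> \<bar>scaled_error n \<omega>\<bar> \<le> K"
      using scaled_error_exceptional_events[OF \<epsilon>0] by (elim exE conjE)
    note B = Bs[rule_format] B2 B3[rule_format]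
    show "\<exists>B. (\<forall>n. B n \<in> events) \<and> (\<forall>\<^sub>F n in sequentially. prob (B n) \<le> \<epsilon>0 \<and>
        (\<forall>\<omega>\<in>space M - B n. (\<omega> \<in> {\<omega>\<in>space M. P n \<omega> \<and> \<rho>hat n \<omega> > 1} \<longrightarrow> \<bar>scaled_error n \<omega>\<bar> \<le> z + \<tau>) \<and>
          (\<bar>scaled_error n \<omega>\<bar> \<le> z - \<tau> \<longrightarrow> \<omega> \<in> {\<omega>\<in>space M. P n \<omega> \<and> \<rho>hat n \<omega> > 1})))"
      (is "\<exists>B. _ \<and> (\<forall>\<^sub>F n in _. ?Q B n)")
    proof (intro exI[of _ B] conjI allI B(1))
      show "\<forall>\<^sub>F n in sequentially. ?Q B n"
        using B(2) key[OF \<tau>, of K]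
      proof eventually_elim
        case (elim n)
        then show ?case using B(3)[of _ n] by blast
      qed
    qed
  qed
  have one: "(\<lambda>n. prob {\<omega>\<in>space M. \<rho>hat n \<omega> > 1}) \<longlonglongrightarrow> 1"
  proof (rule tendstoI)
    fix e :: real assume e: "e > 0"
    then have e2: "e / 2 > 0" by simp
    obtain K B where Bs: "\<forall>n. B n \<in> events" and B2: "\<forall>\<^sub>F n in sequentially. prob (B n) \<le> e / 2"
      and B3: "\<forall>n. \<forall>\<omega>\<in>space M - B n. scaled_error n \<omega> \<noteq> 0 \<and> \<bar>scaled_error n \<omega>\<bar> \<le> K"
      using scaled_error_exceptional_events[OF e2] by (elim exE conjE)
    note B = Bs[rule_format] B2 B3[rule_format]
    show "\<forall>\<^sub>F n in sequentially. dist (prob {\<omega>\<in>space M. \<rho>hat n \<omega> > 1}) 1 < e"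
      using B(2) key[OF z, of K]
    proof eventually_elim
      case (elim n)
      then have "space M - B n \<subseteq> {\<omega>\<in>space M. \<rho>hat n \<omega> > 1}" using B(3)[of _ n] by blast
      then have "prob (space M - B n) \<le> prob {\<omega>\<in>space M. \<rho>hat n \<omega> > 1}"
        by (intro finite_measure_mono m2)
      moreover have "prob (space M - B n) = 1 - prob (B n)" by (rule prob_compl[OF B(1)])
      moreover have "prob {\<omega>\<in>space M. \<rho>hat n \<omega> > 1} \<le> 1" by (rule prob_le_1)
      ultimately show ?case using elim(1) e by (simp add: dist_real_def)
    qed
  qed
  show ?thesis
    unfolding cond_prob_def using tendsto_divide[OF joint one] by simp
qed

lemma interval_coverage:
  assumes z: "z > 0" and \<gamma>: "\<forall>\<^sub>F n in sequentially. \<rho> n = 1 + real n powr (- \<gamma> n)"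
  shows "(\<lambda>n. \<P>(\<omega> in M. \<rho>_covered z n \<omega> \<bar> \<rho>hat n \<omega> > 1)) \<longlonglongrightarrow> 2 * arctan z / pi"
    and "(\<lambda>n. \<P>(\<omega> in M. \<gamma>_covered \<gamma> z n \<omega> \<bar> \<rho>hat n \<omega> > 1)) \<longlonglongrightarrow> 2 * arctan z / pi"
  by (rule coverage[OF z covered_measurable(1)], rule eventually_mono[OF covered_threshold[OF \<gamma>]], blast)
     (rule coverage[OF z covered_measurable(2)], rule eventually_mono[OF covered_threshold[OF \<gamma>]], blast)

end

section \<open>Rates and the confidence intervals\<close>

lemma half_square_le_exp:
  fixes x :: real
  assumes "x \<ge> 0"
  shows "x\<^sup>2 / 2 \<le> exp x"
  using exp_lower_Taylor_quadratic[OF assms] assms by simp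

text \<open>
  A quadratic lower bound in \<open>n / k\<close> is all that is needed: it makes both \<open>1 / \<rho>\<^sup>n\<close> and
  \<open>(n / k) / \<rho>\<^sup>n\<close> vanish as soon as \<open>n / k\<close> diverges.
\<close>

lemma mildly_explosive_power_lower_bound:
  fixes c k :: real
  assumes "c > 0" "k > 0" "c / k \<le> 1"
  shows "(c * n / k)\<^sup>2 / 8 \<le> (1 + c / k) ^ n"
proof -
  define x where "x = c / k"
  have x: "0 < x" "x \<le> 1" using assms by (auto simp: x_def)
  have "x / 2 \<le> ln (1 + x)"
  proof -
    have "1 - 1 / (1 + x) \<le> ln (1 + x)"
      using ln_le_minus_one[of "1 / (1 + x)"] x by (simp add: ln_div)
    moreover have "x / 2 \<le> 1 - 1 / (1 + x)"
    proof -
      have "1 - 1 / (1 + x) = x / (1 + x)" using x by (simp add: field_simps)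
      moreover have "x / 2 \<le> x / (1 + x)" using x by (intro divide_left_mono) auto
      ultimately show ?thesis by simp
    qed
    ultimately show ?thesis by simp
  qed
  then have "n * (x / 2) \<le> n * ln (1 + x)" by (intro mult_left_mono) auto
  then have "exp (n * (x / 2)) \<le> exp (n * ln (1 + x))" by simp
  also have "\<dots> = (1 + x) ^ n"
    using x by (simp add: exp_of_nat_mult)
  finally have "exp (n * (x / 2)) \<le> (1 + x) ^ n" .
  moreover have "(n * (x / 2))\<^sup>2 / 2 \<le> exp (n * (x / 2))"
    using x by (intro half_square_le_exp) auto
  moreover have "(n * (x / 2))\<^sup>2 / 2 = (c * n / k)\<^sup>2 / 8"
    unfolding x_def by (simp add: power2_eq_square mult_ac)
  ultimately show ?thesis unfolding x_def by linarith
qed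

lemma log_vol_0 [simp]: "log_vol \<phi> 0 e = 0"
  unfolding log_vol_def by simp

lemma log_vol_Suc: "log_vol \<phi> (Suc t) e = \<phi> * log_vol \<phi> t e + e (Suc t)"
proof -
  have "(\<Sum>j=1..t. \<phi> ^ (Suc t - j) * e j) = (\<Sum>j=1..t. \<phi> * (\<phi> ^ (t - j) * e j))"
    by (intro sum.cong refl) (auto simp: Suc_diff_le)
  then show ?thesis
    unfolding log_vol_def by (simp add: sum_distrib_left)
qed

text \<open>
  If \<open>r\<close> diverges, then \<open>1 - \<phi>\<^sup>2 \<ge> d / ln r\<close> eventually, which turns the exponential of the
  stationary log-variance into a power of \<open>r\<close>.  If \<open>r\<close> is constant, so is the numerator.
\<close>

lemma volatility_rate:
  fixes k r \<phi> :: "nat \<Rightarrow> real"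
  assumes d: "d > 0" and q: "q \<ge> 0"
    and k_infinity: "filterlim k at_top sequentially"
    and r_gt_1: "\<And>n. n \<ge> 1 \<Longrightarrow> r n > 1"
    and r_alternative: "filterlim r at_top sequentially \<or> (\<exists>r0. \<forall>n\<ge>1. r n = r0)"
    and separation: "\<And>q::real. q > 0 \<Longrightarrow> (\<lambda>n. r n powr q) \<in> o(k)"
    and \<phi>_eq: "\<And>n. n \<ge> 1 \<Longrightarrow> \<phi> n = 1 - d / ln (r n)"
  shows "(\<lambda>n. exp (q * (\<alpha>\<^sup>2 / (1 - (\<phi> n)\<^sup>2))) / k n) \<longlonglongrightarrow> 0"
  using r_alternative
proof
  assume r: "filterlim r at_top sequentially"
  \<comment> \<open>The summand 1 makes the exponent positive even for \<open>q = 0\<close>.\<close>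
  define p where "p = q * \<alpha>\<^sup>2 / d + 1"
  have p: "p > 0" using d q by (auto simp: p_def intro!: add_nonneg_pos)
  have lim: "(\<lambda>n. r n powr p / k n) \<longlonglongrightarrow> 0"
    using separation[OF p] by (rule smalloD_tendsto)
  have "filterlim (\<lambda>n. ln (r n)) at_top sequentially"
    by (rule filterlim_compose[OF ln_at_top r])
  then have "\<forall>\<^sub>F n in sequentially. ln (r n) \<ge> d"
    by (simp add: filterlim_at_top)
  moreover have "\<forall>\<^sub>F n in sequentially. k n \<ge> 1"
    using k_infinity by (simp add: filterlim_at_top)
  ultimately have "\<forall>\<^sub>F n in sequentially. norm (exp (q * (\<alpha>\<^sup>2 / (1 - (\<phi> n)\<^sup>2))) / k n) \<le> r n powr p / k n"
    using eventually_ge_at_top[of 1]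
  proof eventually_elim
    case (elim n)
    define x where "x = d / ln (r n)"
    have l: "ln (r n) > 0" using elim d by simp
    have x: "0 < x" "x \<le> 1" using elim d l by (auto simp: x_def)
    have "1 - (\<phi> n)\<^sup>2 = x * (2 - x)"
      unfolding \<phi>_eq[OF elim(3)] x_def[symmetric] by (simp add: power2_eq_square algebra_simps)
    moreover have "x * 1 \<le> x * (2 - x)" using x by (intro mult_left_mono) auto
    ultimately have "\<alpha>\<^sup>2 / (1 - (\<phi> n)\<^sup>2) \<le> \<alpha>\<^sup>2 / x" using x by (intro divide_left_mono) auto
    then have "q * (\<alpha>\<^sup>2 / (1 - (\<phi> n)\<^sup>2)) \<le> q * (\<alpha>\<^sup>2 / x)" using q by (rule mult_left_mono)
    also have "\<dots> = q * \<alpha>\<^sup>2 / d * ln (r n)" by (simp add: x_def)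
    also have "\<dots> \<le> p * ln (r n)" using l by (intro mult_right_mono) (auto simp: p_def)
    finally have "exp (q * (\<alpha>\<^sup>2 / (1 - (\<phi> n)\<^sup>2))) \<le> r n powr p"
      using r_gt_1[OF elim(3)] by (simp add: powr_def)
    then show ?case using elim by (simp add: divide_right_mono)
  qed
  then show ?thesis by (rule Lim_null_comparison[OF _ lim])
next
  assume "\<exists>r0. \<forall>n\<ge>1. r n = r0"
  then obtain r0 where r0: "\<And>n. n \<ge> 1 \<Longrightarrow> r n = r0" by blast
  define C where "C = exp (q * (\<alpha>\<^sup>2 / (1 - (1 - d / ln r0)\<^sup>2)))"
  have "(\<lambda>n. C / k n) \<longlonglongrightarrow> 0"
    by (rule tendsto_divide_0[OF tendsto_const filterlim_at_top_imp_at_infinity[OF k_infinity]])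
  moreover have "\<forall>\<^sub>F n in sequentially. C / k n = exp (q * (\<alpha>\<^sup>2 / (1 - (\<phi> n)\<^sup>2))) / k n"
    using eventually_ge_at_top[of 1] by eventually_elim (simp add: C_def \<phi>_eq r0)
  ultimately show ?thesis by (rule Lim_transform_eventually)
qed

theorem theorem4p5:
  fixes M :: "'a measure"
    and c d \<alpha> level z :: real
    and k r \<rho> \<phi> \<gamma> :: "nat \<Rightarrow> real"
    and \<epsilon> \<eta> :: "nat \<Rightarrow> 'a \<Rightarrow> real"
    and y u \<sigma> :: "nat \<Rightarrow> nat \<Rightarrow> 'a \<Rightarrow> real"
    and \<rho>hat \<gamma>hat :: "nat \<Rightarrow> 'a \<Rightarrow> real"
  assumes prob_space: "prob_space M"
    and const_pos: "c > 0" "d > 0" "\<alpha> > 0"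
    \<comment> \<open>rate sequences\<close>
    and k_pos: "\<And>n. n \<ge> 1 \<Longrightarrow> k n > 0"
    and k_infinity: "filterlim k at_top sequentially"
    and k_small: "k \<in> o(\<lambda>n. real n)"
    and r_gt_1: "\<And>n. n \<ge> 1 \<Longrightarrow> r n > 1"
    and r_alternative: "filterlim r at_top sequentially \<or> (\<exists>r0. \<forall>n\<ge>1. r n = r0)"
    and r_k_separation: "\<And>q::real. q > 0 \<Longrightarrow> (\<lambda>n. r n powr q) \<in> o(k)"
    and k_r_n_separation: "\<And>q::real. q > 0 \<Longrightarrow> (\<lambda>n. k n * r n powr q) \<in> o(\<lambda>n. real n)"
    \<comment> \<open>parameters\<close>
    and \<phi>_eq: "\<And>n. n \<ge> 1 \<Longrightarrow> \<phi> n = 1 - d / ln (r n)"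
    and \<phi>_stable: "\<And>n. n \<ge> 1 \<Longrightarrow> \<bar>\<phi> n\<bar> < 1"
    and \<rho>_eq: "\<And>n. n \<ge> 1 \<Longrightarrow> \<rho> n = 1 + c / k n"
    and \<gamma>_eq: "\<And>n. n \<ge> 2 \<Longrightarrow> \<rho> n = 1 + real n powr (- \<gamma> n)"
    \<comment> \<open>innovations\<close>
    and \<epsilon>_indep: "prob_space.indep_vars M (\<lambda>_. borel) \<epsilon> {1..}"
    and \<epsilon>_identical: "\<And>t. t \<ge> 1 \<Longrightarrow> distr M borel (\<epsilon> t) = distr M borel (\<epsilon> 1)"
    and \<epsilon>_mean: "prob_space.expectation M (\<epsilon> 1) = 0"
    and \<epsilon>_second_moment: "prob_space.expectation M (\<lambda>\<omega>. (\<epsilon> 1 \<omega>)\<^sup>2) = 1"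
    and \<epsilon>_fourth_moment: "integrable M (\<lambda>\<omega>. (\<epsilon> 1 \<omega>) ^ 4)"
    and \<eta>_indep: "prob_space.indep_vars M (\<lambda>_. borel) \<eta> {1..}"
    and \<eta>_normal: "\<And>t. t \<ge> 1 \<Longrightarrow> distributed M lborel (\<eta> t) (normal_density 0 \<alpha>)"
    and \<epsilon>_\<eta>_indep: "prob_space.indep_var M
          (Pi\<^sub>M {1..} (\<lambda>_. borel)) (\<lambda>\<omega>. \<lambda>t\<in>{1..}. \<epsilon> t \<omega>)
          (Pi\<^sub>M {1..} (\<lambda>_. borel)) (\<lambda>\<omega>. \<lambda>t\<in>{1..}. \<eta> t \<omega>)"
    \<comment> \<open>the autoregressive stochastic-volatility model, one row for each \<open>n\<close>\<close>
    and y_eq: "\<And>n t \<omega>. 1 \<le> t \<Longrightarrow> t \<le> n \<Longrightarrow> \<omega> \<in> space M \<Longrightarrow>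
          y n t \<omega> = \<rho> n * y n (t - 1) \<omega> + u n t \<omega>"
    and u_eq: "\<And>n t \<omega>. 1 \<le> t \<Longrightarrow> t \<le> n \<Longrightarrow> \<omega> \<in> space M \<Longrightarrow>
          u n t \<omega> = \<sigma> n t \<omega> * \<epsilon> t \<omega>"
    and \<sigma>_pos: "\<And>n t \<omega>. t \<le> n \<Longrightarrow> \<omega> \<in> space M \<Longrightarrow> \<sigma> n t \<omega> > 0"
    and \<sigma>_init: "\<And>n \<omega>. \<omega> \<in> space M \<Longrightarrow> \<sigma> n 0 \<omega> = 1"
    and \<sigma>_eq: "\<And>n t \<omega>. 1 \<le> t \<Longrightarrow> t \<le> n \<Longrightarrow> \<omega> \<in> space M \<Longrightarrow>
          ln ((\<sigma> n t \<omega>)\<^sup>2) = \<phi> n * ln ((\<sigma> n (t - 1) \<omega>)\<^sup>2) + \<eta> t \<omega>"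
    and y0_measurable: "\<And>n. n \<ge> 1 \<Longrightarrow> y n 0 \<in> borel_measurable M"
    and y0_indep: "\<And>n. n \<ge> 1 \<Longrightarrow> prob_space.indep_set M
          (sets (vimage_algebra (space M) (y n 0) borel))
          (sets (vimage_algebra (space M) (\<lambda>\<omega>. \<lambda>t\<in>{1..}. (\<epsilon> t \<omega>, \<eta> t \<omega>))
             (Pi\<^sub>M {1..} (\<lambda>_. borel \<Otimes>\<^sub>M borel))))"
    and y0_small: "small_o_p M (\<lambda>n. y n 0) (\<lambda>n. sqrt (k n))"
    \<comment> \<open>estimators and confidence level\<close>
    and \<rho>hat_eq: "\<And>n \<omega>. \<rho>hat n \<omega> = least_squares_ar1 n (\<lambda>t. y n t \<omega>)"
    and \<gamma>hat_eq: "\<And>n \<omega>. \<gamma>hat n \<omega> = - ln \<bar>\<rho>hat n \<omega> - 1\<bar> / ln (real n)"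
    and level_range: "0 < level" "level < 1"
    and z_eq: "z = quantile std_cauchy ((1 + level) / 2)"
  shows "((\<lambda>n. \<P>(\<omega> in M.
             \<rho> n \<in> {\<rho>hat n \<omega> - z * (2 / (real n powr \<gamma>hat n \<omega> * \<rho>hat n \<omega> ^ n)) ..
                     \<rho>hat n \<omega> + z * (2 / (real n powr \<gamma>hat n \<omega> * \<rho>hat n \<omega> ^ n))}
             \<bar> \<rho>hat n \<omega> > 1)) \<longlonglongrightarrow> level) \<and>
         ((\<lambda>n. \<P>(\<omega> in M.
             \<gamma> n \<in> {\<gamma>hat n \<omega> - z * (2 / ((1 + real n powr (- \<gamma>hat n \<omega>)) ^ n * ln (real n))) ..
                     \<gamma>hat n \<omega> + z * (2 / ((1 + real n powr (- \<gamma>hat n \<omega>)) ^ n * ln (real n)))}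
             \<bar> \<rho>hat n \<omega> > 1)) \<longlonglongrightarrow> level)"
proof -
  interpret prob_space M by (rule prob_space)
  interpret sv_noise M \<alpha> \<epsilon> \<eta>
    by unfold_locales (fact const_pos \<epsilon>_indep \<epsilon>_identical \<epsilon>_mean \<epsilon>_second_moment \<epsilon>_fourth_moment \<eta>_indep \<eta>_normal \<epsilon>_\<eta>_indep)+
  \<comment> \<open>The hypotheses say nothing about row 0; it is replaced by a trivial one.\<close>
  define \<phi>' where "\<phi>' n = (if n = 0 then 0 else \<phi> n)" for n
  define \<rho>' where "\<rho>' n = (if n = 0 then 2 else \<rho> n)" for n
  define y' where "y' n = (if n = 0 then (\<lambda>_ _. 0) else y n)" for n
  define \<kappa> where "\<kappa> n = (\<rho>' n)\<^sup>2 - 1" for n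
  have ev1: "\<forall>\<^sub>F n in sequentially. n \<ge> (1::nat)" by (rule eventually_ge_at_top)
  have ck: "\<forall>\<^sub>F n in sequentially. c / k n \<le> 1"
  proof -
    have "\<forall>\<^sub>F n in sequentially. c \<le> k n" using k_infinity by (simp add: filterlim_at_top)
    with ev1 show ?thesis by eventually_elim (use k_pos in simp)
  qed
  have \<kappa>: "\<forall>\<^sub>F n in sequentially. 0 \<le> \<kappa> n \<and> \<kappa> n \<le> 3 * c / k n"
    using ck ev1
  proof eventually_elim
    case (elim n)
    have x: "0 < c / k n" using k_pos[OF elim(2)] const_pos by simp
    have "\<kappa> n = (c / k n) * (2 + c / k n)"
    proof -
      have sq: "(1 + x)\<^sup>2 - 1 = x * (2 + x)" for x :: real by (simp add: power2_eq_square algebra_simps)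
      have "\<kappa> n = (1 + c / k n)\<^sup>2 - 1"
        using elim(2) \<rho>_eq[OF elim(2)] by (simp add: \<kappa>_def \<rho>'_def)
      then show ?thesis unfolding sq .
    qed
    moreover have "(c / k n) * (2 + c / k n) \<le> (c / k n) * 3" using x elim by (intro mult_left_mono) auto
    moreover have "0 \<le> (c / k n) * (2 + c / k n)" using x by (intro mult_nonneg_nonneg) auto
    ultimately show ?case by (simp add: mult.commute)
  qed
  have ratio: "filterlim (\<lambda>n. real n / k n) at_top sequentially"
  proof -
    have "(\<lambda>n. k n / real n) \<longlonglongrightarrow> 0" using k_small by (rule smalloD_tendsto)
    moreover have "\<forall>\<^sub>F n in sequentially. 0 < k n / real n"
      using ev1 by eventually_elim (use k_pos in simp)
    ultimately have "filterlim (\<lambda>n. inverse (k n / real n)) at_top sequentially"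
      by (rule filterlim_inverse_at_top)
    then show ?thesis by (simp add: inverse_eq_divide)
  qed
  have ratio_c: "filterlim (\<lambda>n. c * real n / k n) at_top sequentially"
    using filterlim_tendsto_pos_mult_at_top[OF tendsto_const const_pos(1) ratio] by simp
  have power_bound: "\<forall>\<^sub>F n in sequentially. (c * real n / k n)\<^sup>2 / 8 \<le> \<rho>' n ^ n"
    using ck ev1
  proof eventually_elim
    case (elim n)
    then show ?case
      using mildly_explosive_power_lower_bound[OF const_pos(1) k_pos[OF elim(2)], of n] \<rho>_eq[OF elim(2)]
      by (simp add: \<rho>'_def)
  qed
  interpret A: sv_array M \<alpha> \<epsilon> \<eta> \<phi>' \<rho>' y'
  proof unfold_locales
    show "\<bar>\<phi>' n\<bar> < 1" for n using \<phi>_stable[of n] by (simp add: \<phi>'_def)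
    show "1 < \<rho>' n" for n using \<rho>_eq[of n] k_pos[of n] const_pos(1) by (simp add: \<rho>'_def)
    show "y' n 0 \<in> borel_measurable M" for n using y0_measurable[of n] by (simp add: y'_def)
    show "y' n t \<omega> = \<rho>' n * y' n (t - 1) \<omega> + exp (log_vol (\<phi>' n) t (\<lambda>j. \<eta> j \<omega>) / 2) * \<epsilon> t \<omega>"
      if t: "1 \<le> t" "t \<le> n" and \<omega>: "\<omega> \<in> space M" for n t \<omega>
    proof -
      have n: "n \<noteq> 0" using t by simp
      have "ln ((\<sigma> n m \<omega>)\<^sup>2) = log_vol (\<phi> n) m (\<lambda>j. \<eta> j \<omega>)" if "m \<le> n" for m
        using that
      proof (induction m)
        case 0
        then show ?case using \<sigma>_init[OF \<omega>] by simp
      next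
        case (Suc m)
        then show ?case using \<sigma>_eq[of "Suc m" n \<omega>] \<omega> by (simp add: log_vol_Suc One_nat_def)
      qed
      from this[OF t(2)] have "2 * ln (\<sigma> n t \<omega>) = log_vol (\<phi> n) t (\<lambda>j. \<eta> j \<omega>)"
        using \<sigma>_pos[OF t(2) \<omega>] by (simp add: ln_realpow)
      then have "exp (log_vol (\<phi> n) t (\<lambda>j. \<eta> j \<omega>) / 2) = exp (ln (\<sigma> n t \<omega>))" by simp
      then have "exp (log_vol (\<phi> n) t (\<lambda>j. \<eta> j \<omega>) / 2) = \<sigma> n t \<omega>"
        using \<sigma>_pos[OF t(2) \<omega>] by simp
      then show ?thesis
        using y_eq[OF t \<omega>] u_eq[OF t \<omega>] n by (simp add: \<rho>'_def \<phi>'_def y'_def)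
    qed
    show "(\<lambda>n. ((\<rho>' n)\<^sup>2 - 1) * exp (q * (\<alpha>\<^sup>2 / (1 - (\<phi>' n)\<^sup>2)))) \<longlonglongrightarrow> 0" if q: "0 \<le> q" for q
    proof (rule Lim_null_comparison)
      show "(\<lambda>n. 3 * c * (exp (q * (\<alpha>\<^sup>2 / (1 - (\<phi> n)\<^sup>2))) / k n)) \<longlonglongrightarrow> 0"
        using tendsto_mult[OF tendsto_const[of "3 * c"]
            volatility_rate[OF const_pos(2) q k_infinity r_gt_1 r_alternative r_k_separation \<phi>_eq, where \<alpha>=\<alpha>]] by simp
      show "\<forall>\<^sub>F n in sequentially. norm (((\<rho>' n)\<^sup>2 - 1) * exp (q * (\<alpha>\<^sup>2 / (1 - (\<phi>' n)\<^sup>2)))) \<le> 3 * c * (exp (q * (\<alpha>\<^sup>2 / (1 - (\<phi> n)\<^sup>2))) / k n)"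
        using \<kappa> ev1
      proof eventually_elim
        case (elim n)
        then have "\<kappa> n * exp (q * (\<alpha>\<^sup>2 / (1 - (\<phi> n)\<^sup>2))) \<le> (3 * c / k n) * exp (q * (\<alpha>\<^sup>2 / (1 - (\<phi> n)\<^sup>2)))"
          by (intro mult_right_mono) auto
        with elim show ?case unfolding \<kappa>_def[symmetric] by (simp add: \<phi>'_def abs_mult)
      qed
    qed
    have sq: "filterlim (\<lambda>n. (1 / 8) * (c * real n / k n)\<^sup>2) at_top sequentially"
      by (intro filterlim_tendsto_pos_mult_at_top[OF tendsto_const] filterlim_pow_at_top ratio_c) auto
    show "filterlim (\<lambda>n. \<rho>' n ^ n) at_top sequentially"
      by (rule filterlim_at_top_mono[OF sq]) (use power_bound in simp)
    show "(\<lambda>n. ((\<rho>' n)\<^sup>2 - 1) * real n / \<rho>' n ^ n) \<longlonglongrightarrow> 0"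
    proof (rule Lim_null_comparison)
      show "(\<lambda>n. 24 / (c * real n / k n)) \<longlonglongrightarrow> 0"
        by (rule tendsto_divide_0[OF tendsto_const filterlim_at_top_imp_at_infinity[OF ratio_c]])
      show "\<forall>\<^sub>F n in sequentially. norm (((\<rho>' n)\<^sup>2 - 1) * real n / \<rho>' n ^ n) \<le> 24 / (c * real n / k n)"
        using \<kappa> power_bound ev1
      proof eventually_elim
        case (elim n)
        define m where "m = c * real n / k n"
        have m: "m > 0" using const_pos(1) k_pos[OF elim(3)] elim(3) by (simp add: m_def)
        have m2: "0 < m\<^sup>2 / 8" using m by simp
        have "\<kappa> n * real n \<le> (3 * c / k n) * real n" using elim by (intro mult_right_mono) auto
        then have "\<kappa> n * real n / \<rho>' n ^ n \<le> (3 * m) / (m\<^sup>2 / 8)"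
          using elim m m2 by (intro frac_le) (auto simp: m_def)
        also have "\<dots> = 24 / m" using m by (simp add: power2_eq_square)
        finally have "\<kappa> n * real n / \<rho>' n ^ n \<le> 24 / m" .
        moreover have "0 \<le> \<kappa> n * real n / \<rho>' n ^ n"
          using elim(1) order_trans[OF less_imp_le[OF m2] elim(2)[folded m_def]]
          by (intro divide_nonneg_nonneg mult_nonneg_nonneg) auto
        ultimately show ?case unfolding \<kappa>_def m_def by simp
      qed
    qed
    show "small_o_p M (\<lambda>n \<omega>. sqrt ((\<rho>' n)\<^sup>2 - 1) * y' n 0 \<omega>) (\<lambda>_. 1)"
    proof (rule small_o_p_mono)
      have meas: "(\<lambda>\<omega>. y' n 0 \<omega> / sqrt (k n)) \<in> borel_measurable M" for n
        using y0_measurable[of n] by (cases "n = 0") (auto simp: y'_def)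
      then show "(\<lambda>\<omega>. sqrt (3 * c) * (y' n 0 \<omega> / sqrt (k n))) \<in> borel_measurable M" for n
        by (rule borel_measurable_times[OF borel_measurable_const])
      have "small_o_p M (\<lambda>n \<omega>. y' n 0 \<omega> / sqrt (k n)) (\<lambda>_. 1)"
        unfolding small_o_p_def
      proof (intro allI impI)
        fix e :: real assume "e > 0"
        then have "(\<lambda>n. \<P>(\<omega> in M. \<bar>y n 0 \<omega> / sqrt (k n)\<bar> > e)) \<longlonglongrightarrow> 0"
          using y0_small unfolding small_o_p_def by blast
        moreover have "\<forall>\<^sub>F n in sequentially. \<P>(\<omega> in M. \<bar>y n 0 \<omega> / sqrt (k n)\<bar> > e) = \<P>(\<omega> in M. \<bar>y' n 0 \<omega> / sqrt (k n) / 1\<bar> > e)"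
          using ev1 by eventually_elim (simp add: y'_def)
        ultimately show "(\<lambda>n. \<P>(\<omega> in M. \<bar>y' n 0 \<omega> / sqrt (k n) / 1\<bar> > e)) \<longlonglongrightarrow> 0"
          by (rule Lim_transform_eventually)
      qed
      then show "small_o_p M (\<lambda>n \<omega>. sqrt (3 * c) * (y' n 0 \<omega> / sqrt (k n))) (\<lambda>_. 1)"
        by (rule small_o_p_scale[OF _ meas, where C="sqrt (3 * c)"]) (use const_pos(1) in simp)
      show "\<forall>\<^sub>F n in sequentially. \<forall>\<omega>\<in>space M. \<bar>sqrt ((\<rho>' n)\<^sup>2 - 1) * y' n 0 \<omega>\<bar> \<le> \<bar>sqrt (3 * c) * (y' n 0 \<omega> / sqrt (k n))\<bar>"
        using \<kappa> ev1
      proof eventually_elim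
        case (elim n)
        have "sqrt (\<kappa> n) \<le> sqrt (3 * c / k n)" using elim by simp
        then have le: "sqrt (\<kappa> n) \<le> sqrt (3 * c) / sqrt (k n)" by (simp add: real_sqrt_divide)
        show ?case
        proof
          fix \<omega>
          have "\<bar>sqrt (\<kappa> n) * y' n 0 \<omega>\<bar> = sqrt (\<kappa> n) * \<bar>y' n 0 \<omega>\<bar>" using elim by (simp add: abs_mult)
          also have "\<dots> \<le> sqrt (3 * c) / sqrt (k n) * \<bar>y' n 0 \<omega>\<bar>" using le by (rule mult_right_mono) simp
          also have "\<dots> = \<bar>sqrt (3 * c) * (y' n 0 \<omega> / sqrt (k n))\<bar>"
            using const_pos(1) k_pos[OF elim(2)] by (simp add: abs_mult)
          finally show "\<bar>sqrt ((\<rho>' n)\<^sup>2 - 1) * y' n 0 \<omega>\<bar> \<le> \<bar>sqrt (3 * c) * (y' n 0 \<omega> / sqrt (k n))\<bar>"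
            unfolding \<kappa>_def .
        qed
      qed
    qed
  qed
  have z: "z = tan (pi * level / 2)"
  proof -
    have "z = tan (pi * ((1 + level) / 2 - 1 / 2))"
      unfolding z_eq using level_range by (intro quantile_std_cauchy) auto
    also have "pi * ((1 + level) / 2 - 1 / 2) = pi * level / 2" by (simp add: field_simps)
    finally show ?thesis .
  qed
  have angle: "0 < pi * level / 2" "pi * level / 2 < pi / 2"
    using level_range by auto
  have z_pos: "z > 0" unfolding z using angle by (rule tan_gt_zero)
  have level: "2 * arctan z / pi = level"
  proof -
    have "- (pi / 2) < pi * level / 2" using angle pi_gt_zero by linarith
    then have "arctan (tan (pi * level / 2)) = pi * level / 2" using angle by (intro arctan_tan)
    then show ?thesis unfolding z by (simp only:) simp
  qed
  have \<gamma>: "\<forall>\<^sub>F n in sequentially. \<rho>' n = 1 + real n powr (- \<gamma> n)"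
    using eventually_ge_at_top[of 2] by eventually_elim (use \<gamma>_eq in \<open>simp add: \<rho>'_def\<close>)
  have hat: "A.\<rho>hat n = \<rho>hat n" "A.\<gamma>hat n = \<gamma>hat n" "\<rho>' n = \<rho> n" if "n \<ge> 1" for n
    using that unfolding fun_eq_iff A.\<gamma>hat_def A.\<rho>hat_def \<rho>hat_eq \<gamma>hat_eq by (auto simp: y'_def \<rho>'_def)
  note cov = A.interval_coverage[OF z_pos \<gamma>, unfolded A.\<rho>_covered_def A.\<gamma>_covered_def level]
  show ?thesis
    by (rule conjI,
        rule Lim_transform_eventually[OF cov(1)], rule eventually_mono[OF ev1], simp only: hat,
        rule Lim_transform_eventually[OF cov(2)], rule eventually_mono[OF ev1], simp only: hat)
qed

end
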